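(* Let $\Bbbk$ be a field, $S=\Bbbk[x_1,\ldots,x_n]$, and let $\phi$ be a $p\times q$ matrix over $S$ with $p\le q$ such that the maximal minors of $\phi$ generate an ideal $I$ of codimension $q-p+1$ with $S/I$ Cohen--Macaulay, and such that the Eagon--Northcott complex $\mathbf{EN}(\phi)$ is a minimal graded free resolution of $S/I$. Let $\mathbf{F}$ be the minimal free resolution of $S/I$ (so $\mathbf F=\mathbf{EN}(\phi)$), and let $r$ be an integer sequence. If $r\in\mathrm{RS}(\mathbf{F})$, then $r=(0,r_0,r_1,\ldots)$ or $r=(1,r_0,r_1,\ldots)$, where the sequence $(r_0,r_1,\ldots)$ lies in $$\sum_{j=0}^{q-p}\binom{q-j-1}{p-1}\,\mathrm{RS}(\mathbf{K}_{(q-p-j)}).$$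
   Context: Subcomplex: a complex of free modules $\mathbf{F}=(F_i,f_i)$ is a subcomplex of a complex of free modules $\mathbf{G}=(G_i,g_i)$ over the same ring if there are split injective maps $\varphi_i:F_i\to G_i$ with $\varphi_i\circ f_{i+1}=g_{i+1}\circ\varphi_{i+1}$ for all $i$. In the cases considered here the $\varphi_i$ are represented (with respect to chosen bases, the standard one on $G_i$) by matrices with entries in $\Bbbk$ and full column rank. Rank sequences: $\mathrm{rs}(\mathbf{F})=(r_0,r_1,\ldots)$ with $r_i=\operatorname{rank}F_i$, and $\mathrm{RS}(\mathbf{G})$ is the set of all $\mathrm{rs}(\mathbf{F})$ for $\mathbf{F}$ a subcomplex of $\mathbf{G}$. Sequences are padded by zeros on the right when necessary. For sets $A,B$ of sequences, $A+B$ is the set of entrywise sums of an element of $A$ and an element of $B$; for a positive integer $a$, $aA=A+\cdots+A$ ($a$ terms); $\sum$ denotes the iterated version of $+$. Koszul complex: $\mathbf{K}_{(m)}$ is the Koszul complex on $m$ variables $x_1,\ldots,x_m$ of a polynomial ring over $\Bbbk$: the term in homological degree $d$ is free with basis $e_T$, $T\subseteq\{1,\ldots,m\}$, $|T|=d$, and $\partial(e_T)=\sum_{j=1}^d(-1)^jx_{i_j}e_{T\setminus\{i_j\}}$ for $T=\{i_1<\cdots<i_d\}$. (For $m=0$ it is the ring itself in homological degree $0$.) Eagon--Northcott complex: for a $g\times f$ matrix $A$ ($g\le f$) over $S$ representing $\alpha:F=S^f\to G=S^g$ with bases $e_1,\ldots,e_f$ and $\varepsilon_1,\ldots,\varepsilon_g$,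 $\mathbf{EN}(A)=\mathbf{EN}(\alpha)$ is $$0\to EN_{f-g+1}\to\cdots\to EN_2\xrightarrow{d_2}EN_1\xrightarrow{\Lambda^g\alpha}\Lambda^gG\cong S,$$ with $\Lambda^gG$ in homological degree $0$, $EN_{k+1}=(\operatorname{Sym}_kG)^*\otimes\Lambda^{g+k}F$, and for $k\ge1$ and $p_1+\cdots+p_g=k$, $d_{k+1}$ sends $(\varepsilon_1^{p_1}\cdots\varepsilon_g^{p_g})^*\otimes e_{s_1}\wedge\cdots\wedge e_{s_{g+k}}$ to $$\sum_{i=1}^{g+k}(-1)^{i-1}\Big[\sum_{j=1}^gA_{j,s_i}(\varepsilon_1^{p_1}\cdots\varepsilon_j^{p_j-1}\cdots\varepsilon_g^{p_g})^*\Big]\otimes e_{s_1}\wedge\cdots\wedge\widehat{e_{s_i}}\wedge\cdots\wedge e_{s_{g+k}},$$ with the convention $\varepsilon_j^{p}=0$ for $p<0$. The standard basis of each term is the displayed one. *)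

theory Defs
  imports
    "HOL-Library.Poly_Mapping"
    "HOL-Library.Extended_Nat"
    "HOL-Library.Multiset"
    "HOL-Library.Set_Algebras"
    "HOL-Library.Function_Algebras"
    "HOL-Algebra.Algebra"
    "Jordan_Normal_Form.Determinant"
    "Jordan_Normal_Form.DL_Submatrix"
begin

section \<open>The polynomial ring in n variables\<close>

type_synonym 'k mpoly = "(nat \<Rightarrow>\<^sub>0 nat) \<Rightarrow>\<^sub>0 'k"

text \<open>The variables are numbered from 0: the carrier consists of the polynomials involving
  only the variables \<open>x\<^sub>i\<close> with \<open>i < n\<close>.\<close>

definition mpoly_ring :: "nat \<Rightarrow> 'k::field mpoly ring" where
  "mpoly_ring n =
    \<lparr>carrier = {f. \<forall>m \<in> Poly_Mapping.keys f. Poly_Mapping.keys m \<subseteq> {..<n}},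
     monoid.mult = (*), one = 1, ring.zero = 0, ring.add = (+)\<rparr>"

definition mconst :: "'k::field \<Rightarrow> 'k mpoly" where
  "mconst a = Poly_Mapping.single 0 a"

definition mvar :: "nat \<Rightarrow> 'k::field mpoly" where
  "mvar i = Poly_Mapping.single (Poly_Mapping.single i 1) 1"

definition monomial_degree :: "(nat \<Rightarrow>\<^sub>0 nat) \<Rightarrow> nat" where
  "monomial_degree m = (\<Sum>i \<in> Poly_Mapping.keys m. Poly_Mapping.lookup m i)"

text \<open>The zero polynomial is homogeneous of every degree.\<close>

definition homogeneous :: "int \<Rightarrow> 'k::field mpoly \<Rightarrow> bool" where
  "homogeneous d f \<longleftrightarrow> (\<forall>m \<in> Poly_Mapping.keys f. int (monomial_degree m) = d)"

definition irrelevant_ideal :: "nat \<Rightarrow> 'k::field mpoly set" where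
  "irrelevant_ideal n = Idl\<^bsub>mpoly_ring n\<^esub> (mvar ` {..<n})"


section \<open>Codimension, depth, Cohen--Macaulay rings\<close>

definition prime_height :: "('a, 'b) ring_scheme \<Rightarrow> 'a set \<Rightarrow> enat" where
  "prime_height R P = Sup {enat d | d. \<exists>C :: nat \<Rightarrow> 'a set.
      C d = P \<and> (\<forall>i\<le>d. primeideal (C i) R) \<and> (\<forall>i<d. C i \<subset> C (Suc i))}"

text \<open>The unit ideal gets codimension \<open>\<infinity>\<close>.\<close>

definition codimension :: "('a, 'b) ring_scheme \<Rightarrow> 'a set \<Rightarrow> enat" where
  "codimension R I = (INF P \<in> {P. primeideal P R \<and> I \<subseteq> P}. prime_height R P)"

definition regular_sequence :: "('a, 'b) ring_scheme \<Rightarrow> 'a list \<Rightarrow> bool" where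
  "regular_sequence R xs \<longleftrightarrow>
     set xs \<subseteq> carrier R \<and> Idl\<^bsub>R\<^esub> (set xs) \<noteq> carrier R \<and>
     (\<forall>i < length xs. \<forall>a \<in> carrier R.
        xs ! i \<otimes>\<^bsub>R\<^esub> a \<in> Idl\<^bsub>R\<^esub> (set (take i xs)) \<longrightarrow> a \<in> Idl\<^bsub>R\<^esub> (set (take i xs)))"

definition depth :: "('a, 'b) ring_scheme \<Rightarrow> 'a set \<Rightarrow> enat" where
  "depth R I = Sup {enat (length xs) | xs. set xs \<subseteq> I \<and> regular_sequence R xs}"

text \<open>Eisenbud's definition (Commutative Algebra, Section 18.2), which needs no localization.\<close>

definition cohen_macaulay :: "('a, 'b) ring_scheme \<Rightarrow> bool" where
  "cohen_macaulay R \<longleftrightarrow> cring R \<and> noetherian_ring R \<and>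
     (\<forall>P. maximalideal P R \<longrightarrow> depth R P = codimension R P)"


section \<open>Complexes of free modules with chosen bases\<close>

text \<open>The module in homological degree \<open>i\<close> is free on the finite set \<open>basis i\<close>; the entry
  \<open>diff i b c\<close> is the coefficient of \<open>b \<in> basis i\<close> in the image of \<open>c \<in> basis (Suc i)\<close>
  under the map from degree \<open>Suc i\<close> to degree \<open>i\<close>.  Values at other labels are irrelevant.\<close>

record ('b, 'a) cplx =
  basis :: "nat \<Rightarrow> 'b set"
  diff :: "nat \<Rightarrow> 'b \<Rightarrow> 'b \<Rightarrow> 'a"

definition free_complex :: "nat \<Rightarrow> ('b, 'k::field mpoly) cplx \<Rightarrow> bool" where
  "free_complex n G \<longleftrightarrow>
     (\<forall>i. finite (basis G i)) \<and>
     (\<forall>i. \<forall>b \<in> basis G i. \<forall>c \<in> basis G (Suc i). diff G i b c \<in> carrier (mpoly_ring n)) \<and>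
     (\<forall>i. \<forall>a \<in> basis G i. \<forall>c \<in> basis G (Suc (Suc i)).
        (\<Sum>b \<in> basis G (Suc i). diff G i a b * diff G (Suc i) b c) = 0)"

text \<open>Matrices over \<open>S\<close> and over \<open>k\<close> with rows indexed by \<open>B\<close> and columns indexed by \<open>C\<close>.
  A map of free modules is split injective iff it has a left inverse.\<close>

definition split_injective ::
  "nat \<Rightarrow> 'b set \<Rightarrow> 'c set \<Rightarrow> ('b \<Rightarrow> 'c \<Rightarrow> 'k::field mpoly) \<Rightarrow> bool" where
  "split_injective n B C M \<longleftrightarrow>
     (\<forall>b \<in> B. \<forall>c \<in> C. M b c \<in> carrier (mpoly_ring n)) \<and>
     (\<exists>N. (\<forall>c \<in> C. \<forall>b \<in> B. N c b \<in> carrier (mpoly_ring n)) \<and>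
          (\<forall>c \<in> C. \<forall>c' \<in> C. (\<Sum>b \<in> B. N c b * M b c') = (if c = c' then 1 else 0)))"

definition full_column_rank :: "'b set \<Rightarrow> 'c set \<Rightarrow> ('b \<Rightarrow> 'c \<Rightarrow> 'k::field) \<Rightarrow> bool" where
  "full_column_rank B C M \<longleftrightarrow>
     (\<forall>v. (\<forall>b \<in> B. (\<Sum>c \<in> C. M b c * v c) = 0) \<longrightarrow> (\<forall>c \<in> C. v c = 0))"

text \<open>The inclusion maps are required to have entries in the field \<open>k\<close> with respect to the
  chosen bases.\<close>

definition subcomplex :: "nat \<Rightarrow> ('c, 'k::field mpoly) cplx \<Rightarrow> ('b, 'k mpoly) cplx \<Rightarrow> bool" where
  "subcomplex n F G \<longleftrightarrow> free_complex n F \<and> free_complex n G \<and>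
     (\<exists>\<phi> :: nat \<Rightarrow> 'b \<Rightarrow> 'c \<Rightarrow> 'k. \<forall>i.
        split_injective n (basis G i) (basis F i) (\<lambda>b c. mconst (\<phi> i b c)) \<and>
        full_column_rank (basis G i) (basis F i) (\<phi> i) \<and>
        (\<forall>b \<in> basis G i. \<forall>c \<in> basis F (Suc i).
           (\<Sum>c' \<in> basis F i. mconst (\<phi> i b c') * diff F i c' c) =
           (\<Sum>b' \<in> basis G (Suc i). diff G i b b' * mconst (\<phi> (Suc i) b' c))))"

definition rank_seq :: "('b, 'k::field mpoly) cplx \<Rightarrow> nat \<Rightarrow> nat" where
  "rank_seq F = (\<lambda>i. card (basis F i))"

text \<open>Up to relabelling, the bases of a subcomplex are sets of natural numbers.\<close>

definition RS :: "nat \<Rightarrow> ('b, 'k::field mpoly) cplx \<Rightarrow> (nat \<Rightarrow> nat) set" where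
  "RS n G = {rank_seq F | F :: (nat, 'k mpoly) cplx. subcomplex n F G}"

text \<open>Sums of sequences are pointwise; sums of sets of sequences are elementwise.\<close>

definition set_multiple :: "nat \<Rightarrow> (nat \<Rightarrow> nat) set \<Rightarrow> (nat \<Rightarrow> nat) set" where
  "set_multiple a A = (\<Sum>_ \<in> {..<a}. A)"


section \<open>Minimal graded free resolutions\<close>

definition graded_complex :: "('b, 'k::field mpoly) cplx \<Rightarrow> bool" where
  "graded_complex G \<longleftrightarrow>
     (\<exists>deg :: nat \<Rightarrow> 'b \<Rightarrow> int. \<forall>i. \<forall>b \<in> basis G i. \<forall>c \<in> basis G (Suc i).
        homogeneous (deg (Suc i) c - deg i b) (diff G i b c))"

definition minimal_complex :: "nat \<Rightarrow> ('b, 'k::field mpoly) cplx \<Rightarrow> bool" where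
  "minimal_complex n G \<longleftrightarrow>
     (\<forall>i. \<forall>b \<in> basis G i. \<forall>c \<in> basis G (Suc i). diff G i b c \<in> irrelevant_ideal n)"

text \<open>A free resolution of the cyclic module \<open>S/I\<close>: the degree 0 term is \<open>S\<close> itself, the image
  of the map from degree 1 is \<open>I\<close>, and the complex is exact in positive degrees.\<close>

definition cyclic_resolution :: "nat \<Rightarrow> 'k::field mpoly set \<Rightarrow> ('b, 'k mpoly) cplx \<Rightarrow> bool" where
  "cyclic_resolution n I G \<longleftrightarrow> free_complex n G \<and>
     (\<exists>b\<^sub>0. basis G 0 = {b\<^sub>0} \<and>
        I = {\<Sum>c \<in> basis G 1. diff G 0 b\<^sub>0 c * v c | v. \<forall>c \<in> basis G 1. v c \<in> carrier (mpoly_ring n)}) \<and>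
     (\<forall>i v. (\<forall>b \<in> basis G (Suc i). v b \<in> carrier (mpoly_ring n)) \<and>
            (\<forall>a \<in> basis G i. (\<Sum>b \<in> basis G (Suc i). diff G i a b * v b) = 0) \<longrightarrow>
        (\<exists>w. (\<forall>c \<in> basis G (Suc (Suc i)). w c \<in> carrier (mpoly_ring n)) \<and>
             (\<forall>b \<in> basis G (Suc i).
                v b = (\<Sum>c \<in> basis G (Suc (Suc i)). diff G (Suc i) b c * w c))))"

definition minimal_graded_resolution :: "nat \<Rightarrow> 'k::field mpoly set \<Rightarrow> ('b, 'k mpoly) cplx \<Rightarrow> bool" where
  "minimal_graded_resolution n I G \<longleftrightarrow>
     cyclic_resolution n I G \<and> graded_complex G \<and> minimal_complex n G"


section \<open>Koszul and Eagon--Northcott complexes\<close>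

text \<open>The \<open>j\<close>-th smallest element \<open>s\<close> of \<open>T\<close> (counted from 1) has
  \<open>j = card {t \<in> T. t \<le> s}\<close>.\<close>

definition koszul :: "nat \<Rightarrow> (nat set, 'k::field mpoly) cplx" where
  "koszul m =
    \<lparr>basis = (\<lambda>d. {T. T \<subseteq> {..<m} \<and> card T = d}),
     diff = (\<lambda>d T' T. \<Sum>s \<in> T. if T' = T - {s} then (-1) ^ card {t \<in> T. t \<le> s} * mvar s else 0)\<rparr>"

definition maximal_minor :: "'k::field mpoly mat \<Rightarrow> nat set \<Rightarrow> 'k mpoly" where
  "maximal_minor A T = det (submatrix A {..<dim_row A} T)"

definition minors_ideal :: "nat \<Rightarrow> 'k::field mpoly mat \<Rightarrow> 'k mpoly set" where
  "minors_ideal n A = Idl\<^bsub>mpoly_ring n\<^esub>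
     {maximal_minor A T | T. T \<subseteq> {..<dim_col A} \<and> card T = dim_row A}"

text \<open>For a \<open>g \<times> f\<close> matrix, the basis element with label \<open>(M, T)\<close> in degree \<open>k + 1\<close> is
  \<open>(\<epsilon>\<^sub>0\<^bsup>p\<^sub>0\<^esup> \<cdots> \<epsilon>\<^sub>g\<^sub>-\<^sub>1\<^bsup>p\<^sub>g\<^sub>-\<^sub>1\<^esup>)\<^sup>* \<otimes> e\<^sub>T\<close>, where the monomial of degree \<open>k\<close> is encoded by the multiset
  \<open>M\<close> with \<open>p\<^sub>j = count M j\<close>, and \<open>e\<^sub>T\<close> is the exterior product of the \<open>e\<^sub>s\<close>, \<open>s \<in> T\<close>, in
  increasing order.  The generator in degree 0 has the label \<open>({#}, {})\<close>.  Restricting \<open>j\<close> to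
  \<open>set_mset M\<close> is the convention that negative powers of \<open>\<epsilon>\<^sub>j\<close> vanish.\<close>

definition eagon_northcott :: "'k::field mpoly mat \<Rightarrow> (nat multiset \<times> nat set, 'k mpoly) cplx" where
  "eagon_northcott A =
    \<lparr>basis = (\<lambda>i. case i of
        0 \<Rightarrow> {({#}, {})}
      | Suc k \<Rightarrow> {(M, T). set_mset M \<subseteq> {..<dim_row A} \<and> size M = k \<and>
                         T \<subseteq> {..<dim_col A} \<and> card T = dim_row A + k}),
     diff = (\<lambda>i (M', T') (M, T). case i of
        0 \<Rightarrow> maximal_minor A T
      | Suc k \<Rightarrow> (\<Sum>s \<in> T. \<Sum>j \<in> set_mset M.
           if M' = M - {#j#} \<and> T' = T - {s}
           then (-1) ^ card {t \<in> T. t < s} * A $$ (j, s) else 0))\<rparr>"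

end

theory Submission
  imports Defs "HOL-Library.Nat_Bijection"
begin

text \<open>
  Let \<open>m = q - p\<close>, and let \<open>E\<^sub>k\<close> be the vector space over \<open>k\<close> spanned by the standard basis of the term
  \<open>D\<^sub>k G \<otimes> \<Lambda>\<^bsup>p+k\<^esup> F\<close> of homological degree \<open>k + 1\<close> in the Eagon--Northcott complex.  In these degrees the differential is linear
  in the matrix: for every matrix \<open>A\<close> over any commutative ring there is an operator \<open>contract A\<close> that
  lowers \<open>k\<close> by one, and two such operators anticommute.  Write \<open>\<phi> = \<Sum>\<^sub>\<mu> x\<^sup>\<mu> B\<^sub>\<mu>\<close> with constant matrices \<open>B\<^sub>\<mu>\<close>.
  Since the inclusion maps of a subcomplex have constant entries, comparing coefficients of \<open>x\<^sup>\<mu>\<close> shows that a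
  subcomplex amounts to subspaces \<open>V\<^sub>k \<subseteq> E\<^sub>k\<close> that are closed under each \<open>contract B\<^sub>\<mu>\<close>.  After an extension of
  scalars they are closed under \<open>contract B\<close> for every linear combination \<open>B\<close> of the \<open>B\<^sub>\<mu>\<close>, and the entries
  \<open>r\<^sub>k\<^sub>+\<^sub>1\<close> of the rank sequence are the dimensions of the \<open>V\<^sub>k\<close>.

  The resolution property supplies sufficiently many good combinations.  Exactness passes from \<open>\<phi>\<close>, whose
  entries have no constant term when \<open>p < q\<close>, to the generic matrix \<open>\<Sum>\<^sub>\<mu> y\<^sub>\<mu> B\<^sub>\<mu>\<close> with independent variables \<open>y\<^sub>\<mu>\<close>:
  one substitutes \<open>x\<^sup>\<mu> + \<lambda> y\<^sub>\<mu>\<close>, solves order by order in \<open>\<lambda>\<close>, and then sets \<open>x = 0\<close>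
  (\<open>contract_exact_generic\<close>).  Taking several independent copies \<open>y\<^sup>(\<^sup>0\<^sup>), y\<^sup>(\<^sup>1\<^sup>), \<dots>\<close> of the variables gives operators
  \<open>d\<^sub>0, d\<^sub>1, \<dots>\<close> that form a regular sequence: on the common kernel of \<open>d\<^sub>0, \<dots>, d\<^sub>r\<^sub>-\<^sub>1\<close> every further \<open>d\<^sub>i\<close> is again
  exact for \<open>k \<ge> 1\<close> (\<open>joint_kernel_exact\<close>).

  The rest is linear algebra (\<open>graded_submodule_dimensions\<close>).  The subspaces \<open>d\<^sub>0 \<cdots> d\<^sub>j\<^sub>-\<^sub>1 E\<^sub>j\<close> form a decreasing flag in
  \<open>E\<^sub>0\<close>; choose a basis of \<open>E\<^sub>0\<close> adapted to it, and say that a basis vector \<open>b\<close> has level \<open>l\<close> if it lies in the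
  \<open>l\<close>-th step but not in the next.  An element \<open>v\<close> of \<open>E\<^sub>k\<close> is determined by the coordinates of the vectors \<open>d\<^sub>A v\<close> along \<open>b\<close>, where \<open>A\<close>
  runs through the \<open>k\<close>-element subsets of \<open>{0, \<dots>, l - 1}\<close> and \<open>l\<close> is the level of \<open>b\<close>.  Order the pairs \<open>(b, A)\<close>,
  lowest level first.  The dimension of \<open>V\<^sub>k\<close> is the number of leading pairs of its elements, and if \<open>(b, A)\<close> is a leading pair of
  \<open>v\<close>, then \<open>(b, A - {a})\<close> is one of \<open>d\<^sub>a v\<close>.  So for each \<open>b\<close> the leading pairs form a
  simplicial complex on \<open>l\<close> vertices, and its face numbers are the rank sequence of a subcomplex of \<open>K\<^sub>(\<^sub>l\<^sub>)\<close>
  (\<open>face_numbers_in_RS_koszul\<close>).  For \<open>V = E\<close> all pairs are leading, hence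
  \<open>dim E\<^sub>k = \<Sum>\<^sub>b (l(b) choose k)\<close>; as \<open>dim E\<^sub>k\<close> is known, this forces the number of basis vectors of level
  \<open>l = q - p - j\<close> to be \<open>(q - j - 1) choose (p - 1)\<close>.
\<close>

section \<open>Substitution in polynomials\<close>

definition monom_eval :: "(nat \<Rightarrow> 'a::comm_ring_1) \<Rightarrow> (nat \<Rightarrow>\<^sub>0 nat) \<Rightarrow> 'a" where
  "monom_eval \<sigma> m = (\<Prod>i\<in>Poly_Mapping.keys m. \<sigma> i ^ Poly_Mapping.lookup m i)"

text \<open>Coefficients and values may lie in different rings.  The values used below are polynomials in an additional
  parameter, or polynomials whose coefficients are themselves polynomials.\<close>

definition poly_subst :: "('c::comm_ring_1 \<Rightarrow> 'a::comm_ring_1) \<Rightarrow> (nat \<Rightarrow> 'a) \<Rightarrow> 'c mpoly \<Rightarrow> 'a" where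
  "poly_subst h \<sigma> f = (\<Sum>m\<in>Poly_Mapping.keys f. h (Poly_Mapping.lookup f m) * monom_eval \<sigma> m)"

definition const_poly :: "'c::comm_ring_1 \<Rightarrow> 'c mpoly" where
  "const_poly a = Poly_Mapping.single 0 a"

definition var_poly :: "nat \<Rightarrow> 'c::comm_ring_1 mpoly" where
  "var_poly i = Poly_Mapping.single (Poly_Mapping.single i 1) 1"

lemma const_poly_mult_single: "const_poly c * Poly_Mapping.single m d = Poly_Mapping.single m (c * d)"
  by (simp add: const_poly_def mult_single)

lemma monom_eval_superset:
  assumes "finite S" "Poly_Mapping.keys m \<subseteq> S"
  shows "monom_eval \<sigma> m = (\<Prod>i\<in>S. \<sigma> i ^ Poly_Mapping.lookup m i)"
  unfolding monom_eval_def
  by (rule prod.mono_neutral_left) (use assms in \<open>auto simp: in_keys_iff\<close>)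

lemma monom_eval_add: "monom_eval \<sigma> (m + m') = monom_eval \<sigma> m * monom_eval \<sigma> m'"
proof -
  let ?S = "Poly_Mapping.keys m \<union> Poly_Mapping.keys m'"
  have "monom_eval \<sigma> (m + m') = (\<Prod>i\<in>?S. \<sigma> i ^ Poly_Mapping.lookup (m + m') i)"
    by (rule monom_eval_superset) (use Poly_Mapping.keys_add[of m m'] in auto)
  also have "\<dots> = (\<Prod>i\<in>?S. \<sigma> i ^ Poly_Mapping.lookup m i) * (\<Prod>i\<in>?S. \<sigma> i ^ Poly_Mapping.lookup m' i)"
    by (simp add: lookup_add power_add prod.distrib)
  also have "\<dots> = monom_eval \<sigma> m * monom_eval \<sigma> m'"
    by (simp add: monom_eval_superset[of ?S m] monom_eval_superset[of ?S m'])
  finally show ?thesis .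
qed

lemma monom_eval_zero [simp]: "monom_eval \<sigma> 0 = 1"
  by (simp add: monom_eval_def)

lemma poly_mapping_sum_singles:
  "f = (\<Sum>m\<in>Poly_Mapping.keys f. Poly_Mapping.single m (Poly_Mapping.lookup f m))"
proof (rule poly_mapping_eqI)
  fix k
  have "Poly_Mapping.lookup (\<Sum>m\<in>Poly_Mapping.keys f. Poly_Mapping.single m (Poly_Mapping.lookup f m)) k
     = (\<Sum>m\<in>Poly_Mapping.keys f. if m = k then Poly_Mapping.lookup f m else 0)"
    by (simp add: lookup_sum lookup_single when_def)
  also have "\<dots> = Poly_Mapping.lookup f k"
    by (simp add: in_keys_iff)
  finally show "Poly_Mapping.lookup f k = Poly_Mapping.lookup
     (\<Sum>m\<in>Poly_Mapping.keys f. Poly_Mapping.single m (Poly_Mapping.lookup f m)) k" by simp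
qed

context
  fixes h :: "'c::comm_ring_1 \<Rightarrow> 'a::comm_ring_1"
  assumes h: "comm_ring_hom h"
begin

interpretation comm_ring_hom h by (rule h)

lemma poly_subst_superset:
  assumes "finite S" "Poly_Mapping.keys f \<subseteq> S"
  shows "poly_subst h \<sigma> f = (\<Sum>m\<in>S. h (Poly_Mapping.lookup f m) * monom_eval \<sigma> m)"
  unfolding poly_subst_def
  by (rule sum.mono_neutral_left) (use assms in \<open>auto simp: in_keys_iff\<close>)

lemma poly_subst_add: "poly_subst h \<sigma> (f + g) = poly_subst h \<sigma> f + poly_subst h \<sigma> g"
proof -
  let ?S = "Poly_Mapping.keys f \<union> Poly_Mapping.keys g"
  have "poly_subst h \<sigma> (f + g) = (\<Sum>m\<in>?S. h (Poly_Mapping.lookup (f + g) m) * monom_eval \<sigma> m)"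
    by (rule poly_subst_superset) (use Poly_Mapping.keys_add[of f g] in auto)
  then show ?thesis
    by (simp add: lookup_add hom_add distrib_right sum.distrib
        poly_subst_superset[of ?S f] poly_subst_superset[of ?S g])
qed

lemma poly_subst_zero [simp]: "poly_subst h \<sigma> 0 = 0"
  by (simp add: poly_subst_def)

lemma poly_subst_sum: "poly_subst h \<sigma> (sum F S) = (\<Sum>x\<in>S. poly_subst h \<sigma> (F x))"
  by (induction S rule: infinite_finite_induct) (simp_all add: poly_subst_add)

lemma poly_subst_single: "poly_subst h \<sigma> (Poly_Mapping.single m c) = h c * monom_eval \<sigma> m"
  by (cases "c = 0") (simp_all add: poly_subst_def)

lemma poly_subst_mult: "poly_subst h \<sigma> (f * g) = poly_subst h \<sigma> f * poly_subst h \<sigma> g"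
proof -
  let ?s = "\<lambda>f m. Poly_Mapping.single m (Poly_Mapping.lookup f m)"
  have "f * g = (\<Sum>m\<in>Poly_Mapping.keys f. ?s f m) * (\<Sum>m\<in>Poly_Mapping.keys g. ?s g m)"
    using poly_mapping_sum_singles[of f] poly_mapping_sum_singles[of g] by simp
  also have "poly_subst h \<sigma> \<dots> = (\<Sum>m\<in>Poly_Mapping.keys f. \<Sum>m'\<in>Poly_Mapping.keys g.
      (h (Poly_Mapping.lookup f m) * monom_eval \<sigma> m) * (h (Poly_Mapping.lookup g m') * monom_eval \<sigma> m'))"
    by (simp add: sum_product poly_subst_sum mult_single poly_subst_single hom_mult monom_eval_add
        algebra_simps)
  also have "\<dots> = poly_subst h \<sigma> f * poly_subst h \<sigma> g"
    by (simp add: poly_subst_def sum_product)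
  finally show ?thesis .
qed

lemma comm_ring_hom_poly_subst: "comm_ring_hom (poly_subst h \<sigma>)"
proof
  show "poly_subst h \<sigma> 1 = 1"
    using poly_subst_single[of \<sigma> 0 1] by (simp add: hom_one)
qed (simp_all add: poly_subst_add poly_subst_mult)

lemma poly_subst_const [simp]: "poly_subst h \<sigma> (const_poly c) = h c"
  by (simp add: poly_subst_single const_poly_def)

lemma poly_subst_var [simp]: "poly_subst h \<sigma> (var_poly i) = \<sigma> i"
  by (simp add: poly_subst_single var_poly_def monom_eval_def hom_one)

end

lemma comm_ring_hom_const_poly: "comm_ring_hom (const_poly :: 'c::comm_ring_1 \<Rightarrow> _)"
  by standard (simp_all add: const_poly_def single_add mult_single)

lemma monom_as_var_product:
  "Poly_Mapping.single m (1 :: 'c::comm_ring_1) = monom_eval var_poly m"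
proof -
  have 1: "Poly_Mapping.single (Poly_Mapping.single i k) (1::'c) = var_poly i ^ k" for i k
  proof (induction k)
    case (Suc k)
    have "Poly_Mapping.single (Poly_Mapping.single i (Suc k)) (1::'c)
        = Poly_Mapping.single (Poly_Mapping.single i 1 + Poly_Mapping.single i k) 1"
      by (simp add: single_add[symmetric])
    also have "\<dots> = var_poly i * Poly_Mapping.single (Poly_Mapping.single i k) 1"
      by (simp add: mult_single var_poly_def)
    finally show ?case using Suc by simp
  qed simp
  have 2: "Poly_Mapping.single (\<Sum>i\<in>S. M i) (1::'c) = (\<Prod>i\<in>S. Poly_Mapping.single (M i) 1)" for S and M :: "nat \<Rightarrow> nat \<Rightarrow>\<^sub>0 nat"
  proof (induction S rule: infinite_finite_induct)
    case (insert x S)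
    have "Poly_Mapping.single (M x + sum M S) (1::'c) = Poly_Mapping.single (M x) 1 * Poly_Mapping.single (sum M S) 1"
      by (simp add: mult_single)
    then show ?case using insert by simp
  qed simp_all
  show ?thesis
    unfolding monom_eval_def 1[symmetric] 2[symmetric]
    by (rule arg_cong[OF poly_mapping_sum_singles])
qed

lemma poly_hom_unique:
  fixes H H' :: "'c::comm_ring_1 mpoly \<Rightarrow> 'a::comm_ring_1"
  assumes H: "comm_ring_hom H" and H': "comm_ring_hom H'"
    and c: "\<And>c. H (const_poly c) = H' (const_poly c)"
    and v: "\<And>i. H (var_poly i) = H' (var_poly i)"
  shows "H f = H' f"
proof -
  interpret H: comm_ring_hom H by (rule H)
  interpret H': comm_ring_hom H' by (rule H')
  have "H (Poly_Mapping.single m c) = H' (Poly_Mapping.single m c)" for m c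
  proof -
    have "Poly_Mapping.single m c = const_poly c * Poly_Mapping.single m 1"
      by (simp add: const_poly_mult_single)
    then show ?thesis
      by (simp add: monom_as_var_product[of m] monom_eval_def H.hom_mult H'.hom_mult c v
          H.hom_prod H'.hom_prod H.hom_power H'.hom_power)
  qed
  then show ?thesis
    by (subst (1 2) poly_mapping_sum_singles[of f]) (simp only: H.hom_sum H'.hom_sum)
qed

section \<open>The contraction operators of the Eagon--Northcott complex\<close>

definition en_labels :: "nat \<Rightarrow> nat \<Rightarrow> nat \<Rightarrow> (nat multiset \<times> nat set) set" where
  "en_labels p q k = {(M, T). set_mset M \<subseteq> {..<p} \<and> size M = k \<and> T \<subseteq> {..<q} \<and> card T = p + k}"

definition en_space :: "nat \<Rightarrow> nat \<Rightarrow> nat \<Rightarrow> (nat multiset \<times> nat set \<Rightarrow> 'a::comm_ring_1) set" where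
  "en_space p q k = {v. \<forall>b. b \<notin> en_labels p q k \<longrightarrow> v b = 0}"

definition insert_sign :: "nat set \<Rightarrow> nat \<Rightarrow> 'a::comm_ring_1" where
  "insert_sign T s = (-1) ^ card {t \<in> T. t < s}"

text \<open>The term \<open>D\<^sub>k G \<otimes> \<Lambda>\<^bsup>p+k\<^esup> F\<close> consists of the functions supported on \<open>en_labels p q k\<close>.  The differential is written from
  the point of view of the target: the coordinate at \<open>(M, T)\<close> collects the coordinates at all labels with one
  more factor \<open>\<epsilon>\<^sub>j\<close> and one more factor \<open>e\<^sub>s\<close>.  In this form neither the multiplicities in \<open>M\<close> nor \<open>k\<close> have to be mentioned.\<close>

definition contract :: "nat \<Rightarrow> nat \<Rightarrow> (nat \<Rightarrow> nat \<Rightarrow> 'a::comm_ring_1) \<Rightarrow>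
    (nat multiset \<times> nat set \<Rightarrow> 'a) \<Rightarrow> (nat multiset \<times> nat set \<Rightarrow> 'a)" where
  "contract p q A v = (\<lambda>(M, T). \<Sum>j<p. \<Sum>s\<in>{..<q} - T.
      insert_sign T s * A j s * v (add_mset j M, insert s T))"

lemma finite_en_labels [simp]: "finite (en_labels p q k)"
proof (rule finite_subset)
  show "en_labels p q k \<subseteq> multisets_of_size {..<p} k \<times> Pow {..<q}"
    by (auto simp: en_labels_def multisets_of_size_def)
qed auto

lemma contract_en_space:
  assumes "v \<in> en_space p q (Suc k)"
  shows "contract p q A v \<in> en_space p q k"
proof -
  have "v (add_mset j M, insert s T) = 0"
    if "(M, T) \<notin> en_labels p q k" "s \<in> {..<q} - T" for j s M T
  proof -
    have "(add_mset j M, insert s T) \<notin> en_labels p q (Suc k)"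
    proof
      assume a: "(add_mset j M, insert s T) \<in> en_labels p q (Suc k)"
      then have "finite T" by (auto simp: en_labels_def intro: finite_subset)
      with a that show False by (auto simp: en_labels_def)
    qed
    then show ?thesis using assms by (simp add: en_space_def)
  qed
  then show ?thesis
    by (auto simp: en_space_def contract_def intro!: sum.neutral)
qed

lemma contract_add: "contract p q A (\<lambda>b. v b + w b) = (\<lambda>b. contract p q A v b + contract p q A w b)"
  by (auto simp: contract_def fun_eq_iff algebra_simps sum.distrib)

lemma contract_scale: "contract p q A (\<lambda>b. c * v b) = (\<lambda>b. c * contract p q A v b)"
  by (auto simp: contract_def fun_eq_iff sum_distrib_left mult_ac)

lemma contract_zero [simp]: "contract p q A (\<lambda>b. 0) = (\<lambda>b. 0)"
  by (auto simp: contract_def fun_eq_iff)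

lemma contract_diff: "contract p q A (\<lambda>b. v b - w b) = (\<lambda>b. contract p q A v b - contract p q A w b)"
  by (auto simp: contract_def fun_eq_iff algebra_simps sum_subtractf)

lemma contract_uminus: "contract p q A (\<lambda>b. - v b) = (\<lambda>b. - contract p q A v b)"
  using contract_scale[of p q A "-1" v] by simp

lemma contract_sum: "contract p q A (\<lambda>b. \<Sum>i\<in>I. v i b) = (\<lambda>b. \<Sum>i\<in>I. contract p q A (v i) b)"
  by (induction I rule: infinite_finite_induct) (simp_all add: contract_add)

lemma contract_matrix_sum:
  "contract p q (\<lambda>j s. \<Sum>i\<in>I. c i * B i j s) v = (\<lambda>b. \<Sum>i\<in>I. c i * contract p q (B i) v b)"
proof (rule ext, clarify)
  fix M T
  have "contract p q (\<lambda>j s. \<Sum>i\<in>I. c i * B i j s) v (M, T) =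
      (\<Sum>j<p. \<Sum>s\<in>{..<q} - T. \<Sum>i\<in>I. c i * (insert_sign T s * B i j s * v (add_mset j M, insert s T)))"
    by (simp add: contract_def sum_distrib_left sum_distrib_right mult_ac)
  also have "\<dots> = (\<Sum>j<p. \<Sum>i\<in>I. \<Sum>s\<in>{..<q} - T. c i * (insert_sign T s * B i j s * v (add_mset j M, insert s T)))"
    by (intro sum.cong refl sum.swap)
  also have "\<dots> = (\<Sum>i\<in>I. \<Sum>j<p. \<Sum>s\<in>{..<q} - T. c i * (insert_sign T s * B i j s * v (add_mset j M, insert s T)))"
    by (rule sum.swap)
  finally show "contract p q (\<lambda>j s. \<Sum>i\<in>I. c i * B i j s) v (M, T) = (\<Sum>i\<in>I. c i * contract p q (B i) v (M, T))"
    by (simp add: contract_def sum_distrib_left)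
qed

lemma hom_insert_sign:
  assumes "comm_ring_hom h"
  shows "h (insert_sign T s) = insert_sign T s"
proof -
  interpret comm_ring_hom h by (rule assms)
  show ?thesis by (simp add: insert_sign_def hom_power hom_uminus)
qed

lemma contract_hom:
  assumes "comm_ring_hom h"
  shows "h (contract p q A v b) = contract p q (\<lambda>j s. h (A j s)) (\<lambda>b. h (v b)) b"
proof -
  interpret comm_ring_hom h by (rule assms)
  show ?thesis
    by (cases b) (simp add: contract_def hom_sum hom_mult hom_insert_sign[OF assms])
qed

lemma insert_sign_swap:
  assumes "s \<notin> T" "s' \<notin> T" "s \<noteq> s'"
  shows "insert_sign T s * insert_sign (insert s T) s' =
     - (insert_sign T s' * insert_sign (insert s' T) s :: 'a::comm_ring_1)"
proof -
  have *: "insert_sign (insert a T) b = (if a < b then - insert_sign T b else (insert_sign T b :: 'a))"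
    if "a \<notin> T" for a b
  proof -
    have "{t \<in> insert a T. t < b} = (if a < b then insert a {t \<in> T. t < b} else {t \<in> T. t < b})"
      by auto
    then show ?thesis using that by (simp add: insert_sign_def)
  qed
  show ?thesis using assms by (auto simp: * algebra_simps)
qed

text \<open>The terms cancel in pairs.  Since the diagonal is left out, this is also true in characteristic two.\<close>

lemma antisymmetric_sum_zero:
  fixes G :: "nat \<Rightarrow> nat \<Rightarrow> 'a::ab_group_add"
  assumes fin: "finite I" and anti: "\<And>s t. s \<in> I \<Longrightarrow> t \<in> I \<Longrightarrow> s \<noteq> t \<Longrightarrow> G s t = - G t s"
  shows "sum (\<lambda>s. sum (G s) (I - {s})) I = 0"
proof -
  let ?D = "Sigma I (\<lambda>s. I - {s})"
  let ?L = "{(s, t) \<in> ?D. s < t}" and ?U = "{(s, t) \<in> ?D. t < s}"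
  have "(\<Sum>s\<in>I. \<Sum>t\<in>I - {s}. G s t) = (\<Sum>(s, t)\<in>?D. G s t)"
    using fin by (simp add: sum.Sigma)
  also have "?D = ?L \<union> ?U" by auto
  also have "(\<Sum>(s, t)\<in>?L \<union> ?U. G s t) = (\<Sum>(s, t)\<in>?L. G s t) + (\<Sum>(s, t)\<in>?U. G s t)"
  proof (rule sum.union_disjoint)
    have D: "finite ?D" using fin by simp
    show "finite ?L" by (rule finite_subset[OF _ D]) blast
    show "finite ?U" by (rule finite_subset[OF _ D]) blast
  qed auto
  also have "(\<Sum>(s, t)\<in>?U. G s t) = (\<Sum>(s, t)\<in>?L. G t s)"
    by (rule sum.reindex_bij_witness[of _ "\<lambda>(a, b). (b, a)" "\<lambda>(a, b). (b, a)"]) auto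
  also have "(\<Sum>(s, t)\<in>?L. G s t) + (\<Sum>(s, t)\<in>?L. G t s) = (\<Sum>(s, t)\<in>?L. G s t + G t s)"
    by (simp add: sum.distrib case_prod_unfold)
  also have "\<dots> = 0"
  proof (rule sum.neutral, rule ballI)
    fix x assume x: "x \<in> ?L"
    then obtain s t where st: "x = (s, t)" "s \<in> I" "t \<in> I" "s < t" by auto
    then have "G s t + G t s = 0" by (subst anti) auto
    then show "(case x of (s, t) \<Rightarrow> G s t + G t s) = 0" using st by simp
  qed
  finally show ?thesis .
qed

definition contract2_term ::
  "nat \<Rightarrow> (nat \<Rightarrow> nat \<Rightarrow> 'a::comm_ring_1) \<Rightarrow> (nat \<Rightarrow> nat \<Rightarrow> 'a) \<Rightarrow>
    (nat multiset \<times> nat set \<Rightarrow> 'a) \<Rightarrow> nat multiset \<Rightarrow> nat set \<Rightarrow> nat \<Rightarrow> nat \<Rightarrow> 'a" where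
  "contract2_term p A B v M T s t = insert_sign T s * insert_sign (insert s T) t *
     (\<Sum>i<p. \<Sum>j<p. A i s * B j t * v (add_mset j (add_mset i M), insert t (insert s T)))"

lemma contract_contract:
  "contract p q A (contract p q B v) (M, T) =
    (\<Sum>s\<in>{..<q} - T. \<Sum>t\<in>{..<q} - T - {s}. contract2_term p A B v M T s t)"
proof -
  have eq: "{..<q} - insert s T = {..<q} - T - {s}" for s by auto
  have "contract p q A (contract p q B v) (M, T) = (\<Sum>i<p. \<Sum>s\<in>{..<q} - T. \<Sum>j<p. \<Sum>t\<in>{..<q} - T - {s}.
      insert_sign T s * insert_sign (insert s T) t *
       (A i s * B j t * v (add_mset j (add_mset i M), insert t (insert s T))))"
    by (simp add: contract_def sum_distrib_left eq mult_ac)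
  also have "\<dots> = (\<Sum>s\<in>{..<q} - T. \<Sum>i<p. \<Sum>t\<in>{..<q} - T - {s}. \<Sum>j<p. 
      insert_sign T s * insert_sign (insert s T) t *
       (A i s * B j t * v (add_mset j (add_mset i M), insert t (insert s T))))"
    by (subst sum.swap, intro sum.cong refl sum.swap)
  also have "\<dots> = (\<Sum>s\<in>{..<q} - T. \<Sum>t\<in>{..<q} - T - {s}. \<Sum>i<p. \<Sum>j<p.
      insert_sign T s * insert_sign (insert s T) t *
       (A i s * B j t * v (add_mset j (add_mset i M), insert t (insert s T))))"
    by (intro sum.cong refl sum.swap)
  finally show ?thesis
    by (simp add: contract2_term_def sum_distrib_left)
qed

text \<open>Inserting \<open>s\<close> and then \<open>t\<close> into \<open>T\<close> reaches the same label as inserting them in the other order, and the symmetric part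
  ignores the order of the two factors; only the sign of the exterior part changes.\<close>

lemma contract2_term_swap:
  assumes "s \<notin> T" "t \<notin> T" "s \<noteq> t"
  shows "contract2_term p A B v M T s t = - contract2_term p B A v M T t s"
proof -
  have *: "(\<Sum>i<p. \<Sum>j<p. A i s * B j t * v (add_mset j (add_mset i M), insert t (insert s T)))
     = (\<Sum>i<p. \<Sum>j<p. B i t * A j s * v (add_mset j (add_mset i M), insert s (insert t T)))"
    by (subst sum.swap) (simp add: mult_ac add_mset_commute insert_commute)
  show ?thesis
    unfolding contract2_term_def * by (subst insert_sign_swap[OF assms]) simp
qed

lemma contract_anticommute:
  "contract p q A (contract p q B v) = (\<lambda>b. - contract p q B (contract p q A v) b)"
proof (rule ext, clarify)
  fix M T
  have "contract p q A (contract p q B v) (M, T) =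
     (\<Sum>s\<in>{..<q} - T. \<Sum>t\<in>{..<q} - T - {s}. - contract2_term p B A v M T t s)"
    unfolding contract_contract
    by (intro sum.cong refl contract2_term_swap) auto
  also have "\<dots> = - (\<Sum>(s, t)\<in>Sigma ({..<q} - T) (\<lambda>s. {..<q} - T - {s}). contract2_term p B A v M T t s)"
    by (simp add: sum.Sigma sum_negf)
  also have "(\<Sum>(s, t)\<in>Sigma ({..<q} - T) (\<lambda>s. {..<q} - T - {s}). contract2_term p B A v M T t s)
     = (\<Sum>(s, t)\<in>Sigma ({..<q} - T) (\<lambda>s. {..<q} - T - {s}). contract2_term p B A v M T s t)"
    by (rule sum.reindex_bij_witness[of _ "\<lambda>(a, b). (b, a)" "\<lambda>(a, b). (b, a)"]) auto
  finally show "contract p q A (contract p q B v) (M, T) = - contract p q B (contract p q A v) (M, T)"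
    by (simp add: contract_contract sum.Sigma)
qed

lemma contract_square [simp]: "contract p q A (contract p q A v) = (\<lambda>b. 0)"
proof (rule ext, clarify)
  fix M T
  show "contract p q A (contract p q A v) (M, T) = 0"
    unfolding contract_contract
    by (rule antisymmetric_sum_zero) (auto intro: contract2_term_swap)
qed

text \<open>The matrix of the differential as it is defined column by column in the complex.\<close>

definition en_entry :: "(nat \<Rightarrow> nat \<Rightarrow> 'a::comm_ring_1) \<Rightarrow> nat multiset \<times> nat set \<Rightarrow>
    nat multiset \<times> nat set \<Rightarrow> 'a" where
  "en_entry A = (\<lambda>(M', T') (M, T). \<Sum>s\<in>T. \<Sum>j\<in>set_mset M.
      if M' = M - {#j#} \<and> T' = T - {s} then insert_sign T s * A j s else 0)"

lemma sum_en_entry: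
  assumes b: "b \<in> en_labels p q k"
  shows "(\<Sum>c\<in>en_labels p q (Suc k). en_entry A b c * v c) = contract p q A v b"
proof -
  obtain M' T' where b_eq: "b = (M', T')" by force
  have bT: "set_mset M' \<subseteq> {..<p}" "size M' = k" "T' \<subseteq> {..<q}" "card T' = p + k"
    using b by (auto simp: b_eq en_labels_def)
  have finT: "finite T'" using bT(3) finite_subset by blast
  let ?L = "en_labels p q (Suc k)"
  let ?Z = "SIGMA c:?L. snd c \<times> set_mset (fst c)"
  let ?P = "\<lambda>(c, s, j). M' = fst c - {#j#} \<and> T' = snd c - {s}"
  let ?F = "\<lambda>(c, s, j). insert_sign (snd c) s * A j s * v c"
  have finL: "finite (snd c)" if "c \<in> ?L" for c
    using that by (auto simp: en_labels_def intro: finite_subset[of _ "{..<q}"])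
  have finZ: "finite ?Z" by (rule finite_SigmaI) (auto simp: finL)
  have "(\<Sum>c\<in>?L. en_entry A b c * v c) =
      (\<Sum>c\<in>?L. \<Sum>sj\<in>snd c \<times> set_mset (fst c). if ?P (c, sj) then ?F (c, sj) else 0)"
    by (intro sum.cong refl)
      (auto simp: en_entry_def b_eq sum_distrib_right sum.cartesian_product intro!: sum.cong)
  also have "\<dots> = (\<Sum>z\<in>?Z. if ?P z then ?F z else 0)"
    by (subst sum.Sigma) (auto simp: finL case_prod_unfold intro!: sum.cong)
  also have "\<dots> = (\<Sum>z\<in>{z \<in> ?Z. ?P z}. ?F z)"
    by (rule sum.inter_filter[symmetric, OF finZ])
  also have "\<dots> = (\<Sum>(j, s)\<in>{..<p} \<times> ({..<q} - T'). insert_sign T' s * A j s * v (add_mset j M', insert s T'))"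
  proof (rule sum.reindex_bij_witness[of _
        "\<lambda>(j, s). ((add_mset j M', insert s T'), s, j)" "\<lambda>(c, s, j). (j, s)"])
    fix z assume "z \<in> {z \<in> ?Z. ?P z}"
    then obtain M T s j where z: "z = ((M, T), s, j)" "(M, T) \<in> ?L" "s \<in> T" "j \<in># M"
      "M' = M - {#j#}" "T' = T - {s}" by auto
    have MT: "M = add_mset j M'" "T = insert s T'" using z by auto
    show "(case case z of (c, s, j) \<Rightarrow> (j, s) of (j, s) \<Rightarrow> ((add_mset j M', insert s T'), s, j)) = z"
      using MT z by simp
    show "(case z of (c, s, j) \<Rightarrow> (j, s)) \<in> {..<p} \<times> ({..<q} - T')"
      using z by (auto simp: en_labels_def)
    have "{t \<in> T. t < s} = {t \<in> T'. t < s}" using z by auto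
    then show "(case case z of (c, s, j) \<Rightarrow> (j, s) of
         (j, s) \<Rightarrow> insert_sign T' s * A j s * v (add_mset j M', insert s T')) = ?F z"
      unfolding z(1) using MT by (simp add: insert_sign_def)
  next
    fix y assume "y \<in> {..<p} \<times> ({..<q} - T')"
    then obtain j s where y: "y = (j, s)" "j < p" "s < q" "s \<notin> T'" by auto
    show "(case case y of (j, s) \<Rightarrow> ((add_mset j M', insert s T'), s, j) of (c, s, j) \<Rightarrow> (j, s)) = y"
      using y by simp
    show "(case y of (j, s) \<Rightarrow> ((add_mset j M', insert s T'), s, j)) \<in> {z \<in> ?Z. ?P z}"
      using y bT finT by (auto simp: en_labels_def)
  qed
  also have "\<dots> = contract p q A v b"
    by (simp add: contract_def b_eq sum.cartesian_product)
  finally show ?thesis .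
qed

lemma basis_eagon_northcott:
  assumes "A \<in> carrier_mat p q"
  shows "basis (eagon_northcott A) (Suc k) = en_labels p q k"
  using assms by (auto simp: eagon_northcott_def en_labels_def)

lemma diff_eagon_northcott:
  "diff (eagon_northcott A) (Suc k) b c = en_entry (\<lambda>j s. A $$ (j, s)) b c"
  by (simp add: eagon_northcott_def en_entry_def insert_sign_def case_prod_unfold cong: if_cong)

section \<open>Exactness and base change\<close>

text \<open>The degree \<open>k = 0\<close> is left out because the maximal minors are not part of \<open>contract\<close>, which vanishes on
  \<open>\<Lambda>\<^sup>p F\<close>.\<close>

definition contract_exact :: "nat \<Rightarrow> nat \<Rightarrow> (nat \<Rightarrow> nat \<Rightarrow> 'a::comm_ring_1) \<Rightarrow> bool" where
  "contract_exact p q A \<longleftrightarrow> (\<forall>k\<ge>1. \<forall>v\<in>en_space p q k. contract p q A v = (\<lambda>b. 0) \<longrightarrow>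
     (\<exists>w\<in>en_space p q (Suc k). v = contract p q A w))"

lemma poly_subst_closed:
  assumes h: "comm_ring_hom h"
    and zero: "0 \<in> R" and one: "1 \<in> R"
    and add: "\<And>a b. a \<in> R \<Longrightarrow> b \<in> R \<Longrightarrow> a + b \<in> R" and mult: "\<And>a b. a \<in> R \<Longrightarrow> b \<in> R \<Longrightarrow> a * b \<in> R"
    and const: "\<And>c. h c \<in> R" and var: "\<And>i. \<sigma> i \<in> R"
  shows "poly_subst h \<sigma> f \<in> R"
proof -
  have pow: "a ^ k \<in> R" if "a \<in> R" for a and k :: nat
    using that by (induction k) (auto intro: one mult)
  have prod: "(\<Prod>i\<in>I. F i) \<in> R" if "\<And>i. F i \<in> R" for F and I :: "nat set"
    using that by (induction I rule: infinite_finite_induct) (auto intro: one mult)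
  have sum: "(\<Sum>i\<in>I. F i) \<in> R" if "\<And>i. F i \<in> R" for F and I :: "(nat \<Rightarrow>\<^sub>0 nat) set"
    using that by (induction I rule: infinite_finite_induct) (auto intro: zero add)
  show ?thesis
    unfolding poly_subst_def monom_eval_def by (intro sum mult const prod pow var)
qed

lemma mem_mpoly_ring: "f \<in> carrier (mpoly_ring n) \<longleftrightarrow>
    (\<forall>m\<in>Poly_Mapping.keys f. Poly_Mapping.keys m \<subseteq> {..<n})"
  by (simp add: mpoly_ring_def)

lemma mpoly_ring_zero: "0 \<in> carrier (mpoly_ring n)"
  and mpoly_ring_one: "1 \<in> carrier (mpoly_ring n)"
  by (simp_all add: mem_mpoly_ring)

lemma mpoly_ring_add:
  "f \<in> carrier (mpoly_ring n) \<Longrightarrow> g \<in> carrier (mpoly_ring n) \<Longrightarrow> f + g \<in> carrier (mpoly_ring n)"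
  using Poly_Mapping.keys_add[of f g] by (auto simp: mem_mpoly_ring)

lemma mpoly_ring_mult:
  assumes "f \<in> carrier (mpoly_ring n)" "g \<in> carrier (mpoly_ring n)"
  shows "f * g \<in> carrier (mpoly_ring n)"
  unfolding mem_mpoly_ring
proof
  fix m assume "m \<in> Poly_Mapping.keys (f * g)"
  then obtain a b where "m = a + b" "a \<in> Poly_Mapping.keys f" "b \<in> Poly_Mapping.keys g"
    using keys_mult[of f g] by blast
  then show "Poly_Mapping.keys m \<subseteq> {..<n}"
    using assms Poly_Mapping.keys_add[of a b] unfolding mem_mpoly_ring by blast
qed

lemma mpoly_ring_sum:
  "(\<And>i. i \<in> I \<Longrightarrow> F i \<in> carrier (mpoly_ring n)) \<Longrightarrow> sum F I \<in> carrier (mpoly_ring n)"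
  by (induction I rule: infinite_finite_induct) (auto intro: mpoly_ring_zero mpoly_ring_add)

lemma lookup_const_mult: "Poly_Mapping.lookup (const_poly c * G) \<rho> = c * Poly_Mapping.lookup G \<rho>"
  unfolding const_poly_def mult_map_scale_conv_mult[symmetric] by (simp add: Poly_Mapping.map.rep_eq when_def)

lemma lookup_contract_const:
  "Poly_Mapping.lookup (contract p q (\<lambda>j s. const_poly (A j s)) V b) \<rho>
   = contract p q A (\<lambda>b. Poly_Mapping.lookup (V b) \<rho>) b"
proof -
  have "Poly_Mapping.lookup (insert_sign T s * const_poly (A j s) * g) \<rho> =
      insert_sign T s * A j s * Poly_Mapping.lookup g \<rho>" for T s j g
    using lookup_const_mult[of "insert_sign T s :: 'a" "const_poly (A j s) * g" \<rho>]
      lookup_const_mult[of "A j s" g \<rho>]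
    by (simp add: hom_insert_sign[OF comm_ring_hom_const_poly] mult.assoc)
  then show ?thesis
    by (cases b) (simp add: contract_def lookup_sum)
qed

lemma id_comm_ring_hom: "comm_ring_hom (\<lambda>x::'c::comm_ring_1. x)"
  by standard auto

lemma comm_ring_hom_comp:
  assumes "comm_ring_hom f" "comm_ring_hom g"
  shows "comm_ring_hom (\<lambda>x. f (g x))"
proof -
  interpret f: comm_ring_hom f by fact
  interpret g: comm_ring_hom g by fact
  show ?thesis by standard (simp_all add: f.hom_add g.hom_add f.hom_mult g.hom_mult f.hom_one g.hom_one)
qed

text \<open>Collecting the variables \<open>x\<^sub>i\<close> with \<open>i \<ge> n\<close> separately turns a polynomial into a polynomial in these variables
  whose coefficients involve only the first \<open>n\<close> variables.\<close>

definition split_vars :: "nat \<Rightarrow> 'k::field mpoly \<Rightarrow> 'k mpoly mpoly" where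
  "split_vars n = poly_subst (\<lambda>c. const_poly (const_poly c))
     (\<lambda>i. if i < n then const_poly (var_poly i) else var_poly i)"

lemma comm_ring_hom_const2: "comm_ring_hom (\<lambda>c::'c::comm_ring_1. const_poly (const_poly c))"
  by (rule comm_ring_hom_comp[OF comm_ring_hom_const_poly comm_ring_hom_const_poly])

lemma comm_ring_hom_split_vars: "comm_ring_hom (split_vars n)"
  unfolding split_vars_def by (rule comm_ring_hom_poly_subst[OF comm_ring_hom_const2])

lemma lookup_split_vars_carrier:
  "Poly_Mapping.lookup (split_vars n f) \<rho> \<in> carrier (mpoly_ring n)"
proof -
  let ?R = "{G :: 'a mpoly mpoly. \<forall>\<rho>. Poly_Mapping.lookup G \<rho> \<in> carrier (mpoly_ring n)}"
  have "split_vars n f \<in> ?R"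
    unfolding split_vars_def
  proof (rule poly_subst_closed[OF comm_ring_hom_const2])
    fix a b :: "'a mpoly mpoly" assume ab: "a \<in> ?R" "b \<in> ?R"
    show "a + b \<in> ?R" using ab by (simp add: lookup_add mpoly_ring_add)
    have "a * b = (\<Sum>m\<in>Poly_Mapping.keys a. \<Sum>m'\<in>Poly_Mapping.keys b.
        Poly_Mapping.single (m + m') (Poly_Mapping.lookup a m * Poly_Mapping.lookup b m'))"
      unfolding mult_single[symmetric] sum_product[symmetric]
        poly_mapping_sum_singles[of a, symmetric] poly_mapping_sum_singles[of b, symmetric] ..
    then show "a * b \<in> ?R"
      using ab by (simp add: lookup_sum lookup_single when_def
          mpoly_ring_sum mpoly_ring_mult mpoly_ring_zero)
  qed (auto simp: const_poly_def var_poly_def lookup_single when_def lookup_one mem_mpoly_ring)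
  then show ?thesis by simp
qed

lemma split_vars_of_carrier:
  assumes "f \<in> carrier (mpoly_ring n)"
  shows "split_vars n f = const_poly f"
proof -
  interpret S: comm_ring_hom "split_vars n :: 'a mpoly \<Rightarrow> _" by (rule comm_ring_hom_split_vars)
  interpret C: comm_ring_hom "const_poly :: 'a mpoly \<Rightarrow> _" by (rule comm_ring_hom_const_poly)
  have "split_vars n (Poly_Mapping.single m c) = const_poly (Poly_Mapping.single m c)"
    if m: "Poly_Mapping.keys m \<subseteq> {..<n}" for m and c :: 'a
  proof -
    have "Poly_Mapping.single m c = const_poly c * Poly_Mapping.single m 1"
      by (simp add: const_poly_mult_single)
    moreover have "split_vars n (Poly_Mapping.single m c) = const_poly (const_poly c) *
        (\<Prod>i\<in>Poly_Mapping.keys m. const_poly (var_poly i) ^ Poly_Mapping.lookup m i)"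
      unfolding split_vars_def poly_subst_single[OF comm_ring_hom_const2] monom_eval_def
      using m by (intro arg_cong2[where f = times] prod.cong) auto
    ultimately show ?thesis
      by (simp only: C.hom_mult monom_as_var_product[of m] monom_eval_def C.hom_prod C.hom_power)
  qed
  then have "split_vars n (\<Sum>m\<in>Poly_Mapping.keys f. Poly_Mapping.single m (Poly_Mapping.lookup f m))
     = const_poly (\<Sum>m\<in>Poly_Mapping.keys f. Poly_Mapping.single m (Poly_Mapping.lookup f m))"
    unfolding S.hom_sum C.hom_sum using assms by (intro sum.cong) (auto simp: mem_mpoly_ring)
  then show ?thesis unfolding poly_mapping_sum_singles[of f, symmetric] .
qed

lemma merge_split_vars: "poly_subst (\<lambda>x. x) var_poly (split_vars n f) = f"
proof (rule poly_hom_unique[of "\<lambda>f. poly_subst (\<lambda>x. x) var_poly (split_vars n f)" "\<lambda>f. f"])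
  show "comm_ring_hom (\<lambda>f :: 'a mpoly. poly_subst (\<lambda>x. x) var_poly (split_vars n f))"
    by (rule comm_ring_hom_comp[OF comm_ring_hom_poly_subst[OF id_comm_ring_hom] comm_ring_hom_split_vars])
qed (simp_all add: id_comm_ring_hom split_vars_def poly_subst_const[OF id_comm_ring_hom]
    poly_subst_var[OF id_comm_ring_hom] poly_subst_const[OF comm_ring_hom_const2] 
    poly_subst_var[OF comm_ring_hom_const2])

text \<open>Polynomials in all variables form a free module over the polynomials in the first \<open>n\<close>, with the monomials in the
  other variables as a basis; a matrix over the first \<open>n\<close> variables acts on each coordinate separately.\<close>

lemma contract_exact_extend_vars:
  fixes A :: "nat \<Rightarrow> nat \<Rightarrow> 'k::field mpoly"
  assumes A: "\<And>j s. j < p \<Longrightarrow> s < q \<Longrightarrow> A j s \<in> carrier (mpoly_ring n)"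
    and exact: "\<And>k v. k \<ge> 1 \<Longrightarrow> v \<in> en_space p q k \<Longrightarrow> (\<And>b. v b \<in> carrier (mpoly_ring n)) \<Longrightarrow>
       contract p q A v = (\<lambda>b. 0) \<Longrightarrow> \<exists>w\<in>en_space p q (Suc k). v = contract p q A w"
  shows "contract_exact p q A"
  unfolding contract_exact_def
proof (intro allI impI ballI)
  fix k and v :: "nat multiset \<times> nat set \<Rightarrow> 'k mpoly"
  assume k: "1 \<le> k" and v: "v \<in> en_space p q k" and cycle: "contract p q A v = (\<lambda>b. 0)"
  interpret S: comm_ring_hom "split_vars n :: 'k mpoly \<Rightarrow> _" by (rule comm_ring_hom_split_vars)
  define V where "V b = split_vars n (v b)" for b
  define part where "part \<rho> b = Poly_Mapping.lookup (V b) \<rho>" for \<rho> b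
  have "\<exists>w\<in>en_space p q (Suc k). part \<rho> = contract p q A w" for \<rho>
  proof (rule exact[OF k])
    show "part \<rho> \<in> en_space p q k"
      using v by (auto simp: en_space_def part_def V_def)
    show "part \<rho> b \<in> carrier (mpoly_ring n)" for b
      by (simp add: part_def V_def lookup_split_vars_carrier)
    have "contract p q (\<lambda>j s. const_poly (A j s)) V b = 0" for b
    proof -
      have "contract p q (\<lambda>j s. const_poly (A j s)) V b = contract p q (\<lambda>j s. split_vars n (A j s)) V b"
        by (cases b) (auto simp: contract_def split_vars_of_carrier[OF A] intro!: sum.cong)
      also have "\<dots> = split_vars n (contract p q A v b)"
        by (simp add: contract_hom[OF comm_ring_hom_split_vars] V_def[abs_def])
      finally show ?thesis using cycle by simp
    qed
    then show "contract p q A (part \<rho>) = (\<lambda>b. 0)"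
      using lookup_contract_const[of p q A V _ \<rho>] by (simp add: part_def[abs_def] fun_eq_iff)
  qed
  then obtain w where w: "\<And>\<rho>. w \<rho> \<in> en_space p q (Suc k)" "\<And>\<rho>. part \<rho> = contract p q A (w \<rho>)"
    by metis
  define I where "I = (\<Union>b\<in>en_labels p q k. Poly_Mapping.keys (V b))"
  have finI: "finite I" by (simp add: I_def)
  have "v b = (\<Sum>\<rho>\<in>I. monom_eval var_poly \<rho> * part \<rho> b)" for b
  proof -
    have "Poly_Mapping.keys (V b) \<subseteq> I"
    proof (cases "b \<in> en_labels p q k")
      case False
      then have "V b = 0" using v by (cases b) (simp add: V_def en_space_def)
      then show ?thesis by simp
    qed (auto simp: I_def)
    then have "poly_subst (\<lambda>x. x) var_poly (V b) = (\<Sum>\<rho>\<in>I. part \<rho> b * monom_eval var_poly \<rho>)"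
      unfolding part_def by (rule poly_subst_superset[OF id_comm_ring_hom finI])
    then show ?thesis by (simp add: V_def merge_split_vars mult.commute)
  qed
  then have "v = contract p q A (\<lambda>b. \<Sum>\<rho>\<in>I. monom_eval var_poly \<rho> * w \<rho> b)"
    by (simp add: fun_eq_iff contract_sum contract_scale w(2))
  moreover have "(\<lambda>b. \<Sum>\<rho>\<in>I. monom_eval var_poly \<rho> * w \<rho> b) \<in> en_space p q (Suc k)"
    using w(1) by (auto simp: en_space_def intro!: sum.neutral)
  ultimately show "\<exists>w\<in>en_space p q (Suc k). v = contract p q A w" by blast
qed

section \<open>Specialisation to a generic matrix\<close>

lemma comm_ring_hom_pCons: "comm_ring_hom (\<lambda>c::'a::comm_ring_1. [:c:])"
  by standard (simp_all add: one_pCons)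

lemma comm_ring_hom_const_pCons: "comm_ring_hom (\<lambda>c::'k::field. [:const_poly c:])"
  by (rule comm_ring_hom_comp[OF comm_ring_hom_pCons comm_ring_hom_const_poly])

lemma comm_ring_hom_map_poly:
  assumes "comm_ring_hom h"
  shows "comm_ring_hom (map_poly h)"
proof -
  interpret comm_ring_hom h by (rule assms)
  show ?thesis
    by standard (auto intro!: poly_eqI simp: coeff_map_poly coeff_mult hom_sum hom_mult hom_add hom_one)
qed

lemma insert_sign_mult_poly: "insert_sign T s * (g :: 'a::comm_ring_1 poly) = smult (insert_sign T s) g"
  unfolding hom_insert_sign[OF comm_ring_hom_pCons, symmetric] by simp

lemma coeff_contract_pencil:
  fixes A B :: "nat \<Rightarrow> nat \<Rightarrow> 'a::comm_ring_1"
  shows "coeff (contract p q (\<lambda>j s. [:A j s, B j s:]) W b) e =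
    contract p q A (\<lambda>b. coeff (W b) e) b +
    (if e = 0 then 0 else contract p q B (\<lambda>b. coeff (W b) (e - 1)) b)"
proof -
  have "coeff (insert_sign T s * [:x, y:] * g) e = insert_sign T s * x * coeff g e +
      (if e = 0 then 0 else insert_sign T s * y * coeff g (e - 1))" for T s and x y :: 'a and g
    by (cases e) (simp_all only: insert_sign_mult_poly mult.assoc, simp_all add: algebra_simps)
  then show ?thesis
    by (cases b) (simp add: contract_def coeff_sum sum.distrib)
qed

lemma comm_ring_hom_poly_at: "comm_ring_hom (\<lambda>g :: 'a::comm_ring_1 poly. poly g x)"
  by standard simp_all

text \<open>Solving order by order in the deformation parameter: the constant term of a cycle is a cycle of the
  undeformed operator, hence a boundary, and subtracting the corresponding boundary of the deformed
  operator makes the cycle divisible by the parameter.\<close>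

lemma contract_deformation:
  fixes A B :: "nat \<Rightarrow> nat \<Rightarrow> 'a::comm_ring_1"
  assumes exact: "contract_exact p q A" and k: "k \<ge> 1"
    and V: "V \<in> en_space p q k" "contract p q (\<lambda>j s. [:A j s, B j s:]) V = (\<lambda>b. 0)"
  shows "\<exists>W\<in>en_space p q (Suc k). \<exists>U\<in>en_space p q k.
    V = (\<lambda>b. contract p q (\<lambda>j s. [:A j s, B j s:]) W b + [:0, 1:] ^ e * U b)"
proof (induction e)
  case 0
  have "(\<lambda>b. 0 :: 'a poly) \<in> en_space p q (Suc k)" by (simp add: en_space_def)
  then show ?case using V(1) by (intro bexI[of _ "\<lambda>b. 0"] bexI[of _ V]) auto
next
  case (Suc e)
  let ?D = "contract p q (\<lambda>j s. [:A j s, B j s:])"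
  from Suc obtain W U where W: "W \<in> en_space p q (Suc k)" and U: "U \<in> en_space p q k"
    and eq: "V = (\<lambda>b. ?D W b + [:0, 1:] ^ e * U b)" by blast
  have cancel: "g = 0" if "[:0, 1:] ^ e * g = 0" for g :: "'a poly"
    using that by (induction e) (auto simp: mult.assoc)
  have "(\<lambda>b. [:0, 1:] ^ e * ?D U b) = ?D (\<lambda>b. [:0, 1:] ^ e * U b)"
    by (simp add: contract_scale)
  also have "\<dots> = (\<lambda>b. ?D V b - ?D (?D W) b)"
    unfolding contract_diff[symmetric] by (simp add: eq)
  also have "\<dots> = (\<lambda>b. 0)" by (simp add: V(2))
  finally have eq0: "(\<lambda>b. [:0, 1:] ^ e * ?D U b) = (\<lambda>b. 0)" .
  have DU: "?D U b = 0" for b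
    by (rule cancel) (rule fun_cong[OF eq0, of b])
  have "contract p q A (\<lambda>b. poly (U b) 0) b = poly (?D U b) 0" for b
    by (subst contract_hom[OF comm_ring_hom_poly_at]) simp
  then have "contract p q A (\<lambda>b. poly (U b) 0) = (\<lambda>b. 0)"
    using DU by (intro ext) simp
  moreover have "(\<lambda>b. poly (U b) 0) \<in> en_space p q k"
    using U by (simp add: en_space_def)
  ultimately obtain w where w: "w \<in> en_space p q (Suc k)" "(\<lambda>b. poly (U b) 0) = contract p q A w"
    using exact k unfolding contract_exact_def by meson
  define U0 where "U0 b = U b - ?D (\<lambda>b. [:w b:]) b" for b
  have const: "(\<lambda>b. [:w b:]) \<in> en_space p q (Suc k)"
    using w(1) by (simp add: en_space_def)
  have U0: "U0 \<in> en_space p q k"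
    using U contract_en_space[OF const] unfolding U0_def en_space_def by auto
  have U0_at: "poly (U0 b) 0 = 0" for b
  proof -
    have "poly (?D (\<lambda>b. [:w b:]) b) 0 = contract p q A w b"
      by (subst contract_hom[OF comm_ring_hom_poly_at]) simp
    then show ?thesis using fun_cong[OF w(2), of b] by (simp add: U0_def)
  qed
  have "\<exists>g. U0 b = [:0, 1:] * g \<and> (U0 b = 0 \<longrightarrow> g = 0)" for b
    using U0_at[of b] by (cases "U0 b") auto
  then obtain U1 where U1: "\<And>b. U0 b = [:0, 1:] * U1 b" "\<And>b. U0 b = 0 \<longrightarrow> U1 b = 0" by metis
  define W1 where "W1 b = W b + [:0, 1:] ^ e * [:w b:]" for b
  have "W1 \<in> en_space p q (Suc k)"
    using W w(1) by (simp add: en_space_def W1_def)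
  moreover have "U1 \<in> en_space p q k"
    using U0 U1(2) by (simp add: en_space_def)
  moreover have "V b = ?D W1 b + [:0, 1:] ^ Suc e * U1 b" for b
  proof -
    have "?D W1 b = ?D W b + [:0, 1:] ^ e * ?D (\<lambda>b. [:w b:]) b"
      unfolding W1_def contract_add contract_scale ..
    moreover have "[:0, 1:] ^ Suc e * U1 b = [:0, 1:] ^ e * U0 b"
      by (simp only: U1(1) power_Suc2 mult.assoc)
    ultimately show ?thesis
      by (simp add: eq U0_def algebra_simps)
  qed
  ultimately show ?case by blast
qed

text \<open>Each monomial of the special matrix \<open>\<Sum>\<^sub>\<mu> x\<^sup>\<mu> coef \<mu>\<close> is replaced by a variable of its own.\<close>

definition generic_matrix :: "(nat \<Rightarrow>\<^sub>0 nat) set \<Rightarrow> ((nat \<Rightarrow>\<^sub>0 nat) \<Rightarrow> nat \<Rightarrow> nat \<Rightarrow> 'k::field) \<Rightarrow>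
    ((nat \<Rightarrow>\<^sub>0 nat) \<Rightarrow> nat) \<Rightarrow> nat \<Rightarrow> nat \<Rightarrow> 'k mpoly" where
  "generic_matrix supp coef f j s = (\<Sum>\<mu>\<in>supp. var_poly (f \<mu>) * const_poly (coef \<mu> j s))"

locale polynomial_matrix =
  fixes p q n :: nat and supp :: "(nat \<Rightarrow>\<^sub>0 nat) set"
    and coef :: "(nat \<Rightarrow>\<^sub>0 nat) \<Rightarrow> nat \<Rightarrow> nat \<Rightarrow> 'k::field"
  assumes finite_supp: "finite supp"
    and keys_supp: "\<mu> \<in> supp \<Longrightarrow> Poly_Mapping.keys \<mu> \<subseteq> {..<n}"
    and nonconstant: "0 \<notin> supp"
begin

definition special :: "nat \<Rightarrow> nat \<Rightarrow> 'k mpoly" where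
  "special j s = (\<Sum>\<mu>\<in>supp. Poly_Mapping.single \<mu> 1 * const_poly (coef \<mu> j s))"

abbreviation generic :: "((nat \<Rightarrow>\<^sub>0 nat) \<Rightarrow> nat) \<Rightarrow> nat \<Rightarrow> nat \<Rightarrow> 'k mpoly" where
  "generic \<equiv> generic_matrix supp coef"

text \<open>Substituting \<open>x\<^sup>\<mu> + \<lambda> y\<^sub>\<mu>\<close> for \<open>y\<^sub>\<mu>\<close>; all old variables are moved out of the way of the \<open>x\<^sub>i\<close>.\<close>

definition shift_vars :: "((nat \<Rightarrow>\<^sub>0 nat) \<Rightarrow> nat) \<Rightarrow> 'k mpoly \<Rightarrow> 'k mpoly poly" where
  "shift_vars f = poly_subst (\<lambda>c. [:const_poly c:])
     (\<lambda>i. if i \<in> f ` supp then [:Poly_Mapping.single (the_inv_into supp f i) 1, var_poly (n + i):]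
          else [:var_poly (n + i):])"

text \<open>Setting the \<open>x\<^sub>i\<close> to \<open>0\<close> and moving the old variables back to their places.\<close>

definition unshift_vars :: "'k mpoly \<Rightarrow> 'k mpoly" where
  "unshift_vars = poly_subst const_poly (\<lambda>i. if i < n then 0 else var_poly (i - n))"

lemma comm_ring_hom_shift_vars: "comm_ring_hom (shift_vars f)"
  unfolding shift_vars_def by (rule comm_ring_hom_poly_subst[OF comm_ring_hom_const_pCons])

lemma comm_ring_hom_unshift_vars: "comm_ring_hom unshift_vars"
  unfolding unshift_vars_def by (rule comm_ring_hom_poly_subst[OF comm_ring_hom_const_poly])

lemma shift_vars_generic:
  assumes "inj_on f supp"
  shows "shift_vars f (generic f j s) = [:special j s, generic (\<lambda>\<mu>. n + f \<mu>) j s:]"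
proof -
  interpret S: comm_ring_hom "shift_vars f" by (rule comm_ring_hom_shift_vars)
  have sum_pCons: "(\<Sum>\<mu>\<in>I. [:a \<mu>, b \<mu>:]) = [:\<Sum>\<mu>\<in>I. a \<mu>, \<Sum>\<mu>\<in>I. b \<mu>:]"
    for I :: "(nat \<Rightarrow>\<^sub>0 nat) set" and a b :: "_ \<Rightarrow> 'k mpoly"
    by (induction I rule: infinite_finite_induct) simp_all
  have "shift_vars f (var_poly (f \<mu>) * const_poly (coef \<mu> j s)) =
     [:Poly_Mapping.single \<mu> 1 * const_poly (coef \<mu> j s), var_poly (n + f \<mu>) * const_poly (coef \<mu> j s):]"
    if "\<mu> \<in> supp" for \<mu>
    unfolding S.hom_mult
    using that assms by (simp add: shift_vars_def poly_subst_var[OF comm_ring_hom_const_pCons]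
        poly_subst_const[OF comm_ring_hom_const_pCons] the_inv_into_f_f mult.commute)
  then show ?thesis
    by (simp add: generic_matrix_def special_def S.hom_sum sum_pCons)
qed

lemma unshift_vars_monom:
  assumes \<mu>: "\<mu> \<in> supp"
  shows "unshift_vars (Poly_Mapping.single \<mu> 1) = 0"
proof -
  from \<mu> nonconstant obtain i where i: "i \<in> Poly_Mapping.keys \<mu>" by fastforce
  then have "i < n" using keys_supp[OF \<mu>] by auto
  with i have "monom_eval (\<lambda>i. if i < n then 0 else var_poly (i - n)) \<mu> = (0 :: 'k mpoly)"
    unfolding monom_eval_def by (intro prod_zero) (auto simp: in_keys_iff)
  then show ?thesis
    unfolding unshift_vars_def poly_subst_single[OF comm_ring_hom_const_poly] by simp
qed

lemma unshift_vars_special [simp]: "unshift_vars (special j s) = 0"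
proof -
  interpret U: comm_ring_hom unshift_vars by (rule comm_ring_hom_unshift_vars)
  show ?thesis by (simp add: special_def U.hom_sum U.hom_mult unshift_vars_monom)
qed

lemma unshift_vars_generic: "unshift_vars (generic (\<lambda>\<mu>. n + f \<mu>) j s) = generic f j s"
proof -
  interpret U: comm_ring_hom unshift_vars by (rule comm_ring_hom_unshift_vars)
  show ?thesis
    by (simp add: generic_matrix_def U.hom_sum U.hom_mult)
      (simp add: unshift_vars_def poly_subst_var[OF comm_ring_hom_const_poly]
        poly_subst_const[OF comm_ring_hom_const_poly])
qed

text \<open>For \<open>x = 0\<close> and \<open>\<lambda> = 1\<close> the substitution is the identity.\<close>

lemma sum_unshift_coeff_shift:
  assumes inj: "inj_on f supp" and N: "degree (shift_vars f g) \<le> N"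
  shows "(\<Sum>e\<le>N. unshift_vars (coeff (shift_vars f g) e)) = g"
proof -
  interpret U: comm_ring_hom unshift_vars by (rule comm_ring_hom_unshift_vars)
  let ?H = "\<lambda>G. poly (map_poly unshift_vars G) 1"
  have H: "comm_ring_hom ?H"
    by (rule comm_ring_hom_comp[OF comm_ring_hom_poly_at comm_ring_hom_map_poly[OF comm_ring_hom_unshift_vars]])
  have 1: "?H (shift_vars f g) = (\<Sum>e\<le>N. unshift_vars (coeff (shift_vars f g) e))"
  proof -
    have "degree (map_poly unshift_vars (shift_vars f g)) \<le> N"
      using N by (intro degree_le) (auto simp: coeff_map_poly coeff_eq_0)
    then show ?thesis
      by (subst poly_as_sum_of_monoms'[symmetric]) (auto simp: poly_sum poly_monom coeff_map_poly)
  qed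
  have "?H (shift_vars f g) = g"
  proof (rule poly_hom_unique[of "\<lambda>g. ?H (shift_vars f g)" "\<lambda>g. g"])
    show "comm_ring_hom (\<lambda>g. ?H (shift_vars f g))"
      by (rule comm_ring_hom_comp[OF H comm_ring_hom_shift_vars])
    have *: "unshift_vars (const_poly c) = const_poly c" "unshift_vars (var_poly (n + i)) = var_poly i" for c i
      by (simp_all add: unshift_vars_def poly_subst_var[OF comm_ring_hom_const_poly]
        poly_subst_const[OF comm_ring_hom_const_poly])
    show "?H (shift_vars f (const_poly c)) = const_poly c" for c
      by (simp add: shift_vars_def poly_subst_const[OF comm_ring_hom_const_pCons] * map_poly_pCons)
    show "?H (shift_vars f (var_poly i)) = var_poly i" for i
      using inj by (auto simp add: shift_vars_def poly_subst_var[OF comm_ring_hom_const_pCons] * unshift_vars_monom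
          map_poly_pCons the_inv_into_f_f)
  qed (rule id_comm_ring_hom)
  with 1 show ?thesis by simp
qed

text \<open>A cycle of the generic operator becomes, after the substitution, a cycle of the special operator deformed by \<open>\<lambda>\<close>
  times the generic one, and is therefore a boundary up to an arbitrarily high power of \<open>\<lambda>\<close>.  At \<open>x = 0\<close> the special
  operator vanishes, because no monomial in \<open>supp\<close> is constant, so there the
  coefficients of the powers of \<open>\<lambda>\<close> exhibit the parts of the cycle as boundaries of the generic operator alone.\<close>

theorem contract_exact_generic:
  assumes exact: "contract_exact p q special" and inj: "inj_on f supp"
  shows "contract_exact p q (generic f)"
  unfolding contract_exact_def
proof (intro allI impI ballI)
  fix k and v :: "nat multiset \<times> nat set \<Rightarrow> 'k mpoly"
  assume k: "1 \<le> k" and v: "v \<in> en_space p q k" and cycle: "contract p q (generic f) v = (\<lambda>b. 0)"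
  let ?s = "shift_vars f" and ?B = "generic (\<lambda>\<mu>. n + f \<mu>)"
  interpret S: comm_ring_hom ?s by (rule comm_ring_hom_shift_vars)
  interpret U: comm_ring_hom unshift_vars by (rule comm_ring_hom_unshift_vars)
  let ?D = "contract p q (\<lambda>j s. [:special j s, ?B j s:])"
  define V where "V b = ?s (v b)" for b
  have V: "V \<in> en_space p q k" using v by (simp add: V_def en_space_def)
  have DV: "?D V = (\<lambda>b. 0)"
  proof (rule ext)
    fix b
    have "?s (contract p q (generic f) v b) = ?D V b"
      unfolding contract_hom[OF comm_ring_hom_shift_vars] shift_vars_generic[OF inj] V_def ..
    then show "?D V b = 0" by (simp add: cycle)
  qed
  \<comment> \<open>Beyond the degree of the cycle in \<open>\<lambda>\<close> the error term no longer matters.\<close>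
  define N where "N = Max (insert 0 ((\<lambda>b. degree (V b)) ` en_labels p q k))"
  have deg: "degree (V b) \<le> N" for b
  proof (cases "b \<in> en_labels p q k")
    case True
    then show ?thesis by (auto simp: N_def intro: Max_ge)
  next
    case False
    then have "V b = 0" using V by (cases b) (simp add: en_space_def)
    then show ?thesis by simp
  qed
  obtain W U where W: "W \<in> en_space p q (Suc k)"
    and eq: "V = (\<lambda>b. ?D W b + [:0, 1:] ^ Suc N * U b)"
    using contract_deformation[OF exact k V DV] by blast
  define w where "w b = (\<Sum>e<N. unshift_vars (coeff (W b) e))" for b
  have coeff_V: "coeff (V b) e = coeff (?D W b) e" if "e \<le> N" for b e
  proof -
    have "[:0, 1:] ^ Suc N = (monom 1 (Suc N) :: 'k mpoly poly)"
      by (simp add: monom_altdef)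
    then show ?thesis
      using that by (subst eq) (simp add: coeff_monom_mult)
  qed
  have unshift: "unshift_vars (coeff (V b) e) =
      (if e = 0 then 0 else contract p q (generic f) (\<lambda>b. unshift_vars (coeff (W b) (e - 1))) b)"
    if "e \<le> N" for b e
  proof -
    have "unshift_vars (contract p q special X' b) = 0" for X'
      unfolding contract_hom[OF comm_ring_hom_unshift_vars] by (cases b) (simp add: contract_def)
    moreover have "unshift_vars (contract p q ?B X' b) = contract p q (generic f) (\<lambda>b. unshift_vars (X' b)) b" for X'
      unfolding contract_hom[OF comm_ring_hom_unshift_vars] unshift_vars_generic ..
    ultimately show ?thesis
      unfolding coeff_V[OF that] coeff_contract_pencil U.hom_add by simp
  qed
  have "v b = contract p q (generic f) w b" for b
  proof -
    have "v b = (\<Sum>e\<le>N. unshift_vars (coeff (V b) e))"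
      unfolding V_def by (rule sum_unshift_coeff_shift[OF inj, symmetric]) (use deg in \<open>simp add: V_def\<close>)
    also have "\<dots> = (\<Sum>e\<le>N. if e = 0 then 0 else
        contract p q (generic f) (\<lambda>b. unshift_vars (coeff (W b) (e - 1))) b)"
      by (intro sum.cong refl unshift) simp
    also have "\<dots> = (\<Sum>e<N. contract p q (generic f) (\<lambda>b. unshift_vars (coeff (W b) e)) b)"
      by (simp add: sum.atMost_shift)
    also have "\<dots> = contract p q (generic f) w b"
      unfolding w_def[abs_def] contract_sum ..
    finally show ?thesis .
  qed
  moreover have "w \<in> en_space p q (Suc k)"
    using W by (simp add: en_space_def w_def)
  ultimately show "\<exists>w\<in>en_space p q (Suc k). v = contract p q (generic f) w" by blast
qed

end

section \<open>Generic points form a regular sequence\<close>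

text \<open>Multiplying the variables from \<open>Y\<close> by a parameter makes the degree in these variables visible: the coefficient of
  its \<open>e\<close>-th power is the part that is homogeneous of degree \<open>e\<close> in them.\<close>

definition scale_vars :: "nat set \<Rightarrow> 'k::field mpoly \<Rightarrow> 'k mpoly poly" where
  "scale_vars Y = poly_subst (\<lambda>c. [:const_poly c:])
     (\<lambda>i. if i \<in> Y then [:0, var_poly i:] else [:var_poly i:])"

definition hom_part :: "nat set \<Rightarrow> nat \<Rightarrow> 'k::field mpoly \<Rightarrow> 'k mpoly" where
  "hom_part Y e g = coeff (scale_vars Y g) e"

lemma comm_ring_hom_scale_vars: "comm_ring_hom (scale_vars Y)"
  unfolding scale_vars_def by (rule comm_ring_hom_poly_subst[OF comm_ring_hom_const_pCons])

lemma scale_vars_const [simp]: "scale_vars Y (const_poly c) = [:const_poly c:]"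
  and scale_vars_var [simp]:
    "scale_vars Y (var_poly i) = (if i \<in> Y then [:0, var_poly i:] else [:var_poly i:])"
  by (simp_all add: scale_vars_def poly_subst_var[OF comm_ring_hom_const_pCons]
      poly_subst_const[OF comm_ring_hom_const_pCons])

lemma hom_part_zero [simp]: "hom_part Y e 0 = 0"
proof -
  interpret comm_ring_hom "scale_vars Y :: 'a mpoly \<Rightarrow> _" by (rule comm_ring_hom_scale_vars)
  show ?thesis by (simp add: hom_part_def)
qed

lemma hom_part_add: "hom_part Y e (f + g) = hom_part Y e f + hom_part Y e g"
proof -
  interpret comm_ring_hom "scale_vars Y :: 'a mpoly \<Rightarrow> _" by (rule comm_ring_hom_scale_vars)
  show ?thesis by (simp add: hom_part_def hom_add)
qed

lemma hom_part_sum: "hom_part Y e (sum F I) = (\<Sum>i\<in>I. hom_part Y e (F i))"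
  by (induction I rule: infinite_finite_induct) (simp_all add: hom_part_add)

lemma scale_vars_single:
  "\<exists>d. scale_vars Y (Poly_Mapping.single m c) = monom (Poly_Mapping.single m c) d"
proof -
  interpret comm_ring_hom "scale_vars Y :: 'a mpoly \<Rightarrow> _" by (rule comm_ring_hom_scale_vars)
  let ?\<delta> = "\<lambda>i. if i \<in> Y then 1 else 0 :: nat"
  have var: "scale_vars Y (var_poly i :: 'a mpoly) = monom (var_poly i) (?\<delta> i)" for i
    by (simp add: monom_altdef)
  have prod: "(\<Prod>i\<in>I. monom (a i) (d i)) = monom (\<Prod>i\<in>I. a i) (\<Sum>i\<in>I. d i)"
    for I :: "nat set" and a :: "nat \<Rightarrow> 'a mpoly" and d
    by (induction I rule: infinite_finite_induct) (simp_all add: mult_monom)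
  have m: "Poly_Mapping.single m c = const_poly c * monom_eval var_poly m"
    unfolding monom_as_var_product[symmetric] const_poly_mult_single by simp
  have "scale_vars Y (const_poly c * monom_eval var_poly m) =
      monom (const_poly c * monom_eval var_poly m) (\<Sum>i\<in>Poly_Mapping.keys m. ?\<delta> i * Poly_Mapping.lookup m i)"
    by (simp only: hom_mult monom_eval_def hom_prod hom_power var monom_power prod scale_vars_const)
      (simp add: smult_monom)
  then show ?thesis unfolding m by (rule exI)
qed

lemma hom_part_hom_part: "hom_part Y e (hom_part Y e' g) = (if e = e' then hom_part Y e g else 0)"
proof -
  have 1: "hom_part Y e (hom_part Y e' (Poly_Mapping.single m c)) =
      (if e = e' then hom_part Y e (Poly_Mapping.single m c) else 0)" for m and c :: 'a
  proof -
    obtain d where d: "scale_vars Y (Poly_Mapping.single m c) = monom (Poly_Mapping.single m c) d"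
      using scale_vars_single by blast
    have part: "hom_part Y i (Poly_Mapping.single m c) = (if i = d then Poly_Mapping.single m c else 0)" for i
      by (simp add: hom_part_def d)
    show ?thesis by (cases "e' = d") (simp_all add: part)
  qed
  have "hom_part Y e (hom_part Y e' (\<Sum>m\<in>Poly_Mapping.keys g. Poly_Mapping.single m (Poly_Mapping.lookup g m)))
     = (if e = e' then hom_part Y e (\<Sum>m\<in>Poly_Mapping.keys g. Poly_Mapping.single m (Poly_Mapping.lookup g m)) else 0)"
    by (simp add: hom_part_sum 1)
  then show ?thesis unfolding poly_mapping_sum_singles[of g, symmetric] .
qed

lemma sum_hom_part:
  assumes N: "\<And>e. e > N \<Longrightarrow> hom_part Y e g = 0"
  shows "(\<Sum>e\<le>N. hom_part Y e g) = g"
proof -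
  have 1: "(\<Sum>e\<le>M. hom_part Y e g) = poly (scale_vars Y g) 1" if "degree (scale_vars Y g) \<le> M" for M
    using arg_cong[OF poly_as_sum_of_monoms'[OF that], of "\<lambda>G. poly G 1"]
    by (simp add: poly_sum poly_monom hom_part_def)
  have "poly (scale_vars Y g) 1 = g"
  proof (rule poly_hom_unique[of "\<lambda>g. poly (scale_vars Y g) 1" "\<lambda>g. g"])
    show "comm_ring_hom (\<lambda>g :: 'a mpoly. poly (scale_vars Y g) 1)"
      by (rule comm_ring_hom_comp[OF comm_ring_hom_poly_at comm_ring_hom_scale_vars])
  qed (simp_all add: id_comm_ring_hom)
  moreover have "(\<Sum>e\<le>max N (degree (scale_vars Y g)). hom_part Y e g) = (\<Sum>e\<le>N. hom_part Y e g)"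
    by (rule sum.mono_neutral_right) (auto intro: N)
  ultimately show ?thesis using 1[of "max N (degree (scale_vars Y g))"] by simp
qed

lemma hom_part_eventually_zero: "\<exists>N. \<forall>e\<ge>N. hom_part Y e g = 0"
  by (rule exI[of _ "Suc (degree (scale_vars Y g))"]) (auto simp: hom_part_def coeff_eq_0)

lemma hom_part_contract_const:
  assumes "\<And>j s. scale_vars Y (A j s) = [:A j s:]"
  shows "hom_part Y e (contract p q A v b) = contract p q A (\<lambda>b. hom_part Y e (v b)) b"
proof -
  have "scale_vars Y (contract p q A v b) = contract p q (\<lambda>j s. [:A j s, 0:]) (\<lambda>b. scale_vars Y (v b)) b"
    unfolding contract_hom[OF comm_ring_hom_scale_vars] assms by simp
  moreover have "contract p q (\<lambda>j s. 0) v' b = 0" for v' :: "_ \<Rightarrow> 'a mpoly"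
    by (cases b) (simp add: contract_def)
  ultimately show ?thesis by (simp add: hom_part_def coeff_contract_pencil del: pCons_0_0)
qed

lemma hom_part_contract_linear:
  assumes "\<And>j s. scale_vars Y (A j s) = [:0, A j s:]"
  shows "hom_part Y e (contract p q A v b) =
    (if e = 0 then 0 else contract p q A (\<lambda>b. hom_part Y (e - 1) (v b)) b)"
proof -
  have "scale_vars Y (contract p q A v b) = contract p q (\<lambda>j s. [:0, A j s:]) (\<lambda>b. scale_vars Y (v b)) b"
    unfolding contract_hom[OF comm_ring_hom_scale_vars] assms by simp
  moreover have "contract p q (\<lambda>j s. 0) v' b = 0" for v' :: "_ \<Rightarrow> 'a mpoly"
    by (cases b) (simp add: contract_def)
  ultimately show ?thesis by (simp add: hom_part_def coeff_contract_pencil)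
qed

text \<open>The index \<open>i\<close> numbers independent generic points: the matrices for different \<open>i\<close> have no variable in common, so the
  degree in the coordinates of one point is not affected by the operators of the others.\<close>

locale generic_points =
  fixes p q :: nat and supp :: "(nat \<Rightarrow>\<^sub>0 nat) set"
    and coef :: "(nat \<Rightarrow>\<^sub>0 nat) \<Rightarrow> nat \<Rightarrow> nat \<Rightarrow> 'k::field" and y :: "nat \<Rightarrow> (nat \<Rightarrow>\<^sub>0 nat) \<Rightarrow> nat"
  assumes y_distinct: "i \<noteq> i' \<Longrightarrow> y i \<mu> \<noteq> y i' \<mu>'"
    and exact: "contract_exact p q (generic_matrix supp coef (y i))"
begin

definition d :: "nat \<Rightarrow> (nat multiset \<times> nat set \<Rightarrow> 'k mpoly) \<Rightarrow> nat multiset \<times> nat set \<Rightarrow> 'k mpoly" where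
  "d i = contract p q (generic_matrix supp coef (y i))"

definition Y :: "nat \<Rightarrow> nat set" where
  "Y i = y i ` supp"

definition joint_kernel :: "nat \<Rightarrow> nat \<Rightarrow> (nat multiset \<times> nat set \<Rightarrow> 'k mpoly) set" where
  "joint_kernel r k = {v \<in> en_space p q k. \<forall>i<r. d i v = (\<lambda>b. 0)}"

lemma scale_vars_generic_other:
  assumes "i \<noteq> r"
  shows "scale_vars (Y r) (generic_matrix supp coef (y i) j s) = [:generic_matrix supp coef (y i) j s:]"
proof -
  interpret comm_ring_hom "scale_vars (Y r) :: 'k mpoly \<Rightarrow> _" by (rule comm_ring_hom_scale_vars)
  interpret C: comm_ring_hom "\<lambda>c::'k mpoly. [:c:]" by (rule comm_ring_hom_pCons)
  have "scale_vars (Y r) (generic_matrix supp coef (y i) j s) =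
      (\<Sum>\<mu>\<in>supp. [:var_poly (y i \<mu>) * const_poly (coef \<mu> j s):])"
    unfolding generic_matrix_def hom_sum hom_mult
    by (intro sum.cong) (use y_distinct[OF assms] in \<open>auto simp: Y_def mult.commute\<close>)
  then show ?thesis by (simp only: C.hom_sum generic_matrix_def)
qed

lemma scale_vars_generic_same:
  "scale_vars (Y r) (generic_matrix supp coef (y r) j s) = [:0, generic_matrix supp coef (y r) j s:]"
proof -
  interpret comm_ring_hom "scale_vars (Y r) :: 'k mpoly \<Rightarrow> _" by (rule comm_ring_hom_scale_vars)
  have sum_pCons: "(\<Sum>\<mu>\<in>I. [:0, a \<mu>:]) = [:0, \<Sum>\<mu>\<in>I. a \<mu>:]" for I :: "(nat \<Rightarrow>\<^sub>0 nat) set" and a :: "_ \<Rightarrow> 'k mpoly"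
    by (induction I rule: infinite_finite_induct) simp_all
  have "scale_vars (Y r) (generic_matrix supp coef (y r) j s) =
      (\<Sum>\<mu>\<in>supp. [:0, var_poly (y r \<mu>) * const_poly (coef \<mu> j s):])"
    unfolding generic_matrix_def hom_sum hom_mult by (intro sum.cong) (auto simp: Y_def mult.commute)
  then show ?thesis by (simp add: sum_pCons generic_matrix_def)
qed

lemma hom_part_d_other:
  "i \<noteq> r \<Longrightarrow> hom_part (Y r) e (d i v b) = d i (\<lambda>b. hom_part (Y r) e (v b)) b"
  unfolding d_def by (rule hom_part_contract_const, rule scale_vars_generic_other)

lemma hom_part_d_same:
  "hom_part (Y r) e (d r v b) = (if e = 0 then 0 else d r (\<lambda>b. hom_part (Y r) (e - 1) (v b)) b)"
  unfolding d_def by (rule hom_part_contract_linear, rule scale_vars_generic_same)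

lemma d_square: "d i (d i v) = (\<lambda>b. 0)"
  by (simp add: d_def)

lemma d_anticommute: "d i (d j v) = (\<lambda>b. - d j (d i v) b)"
  unfolding d_def by (rule contract_anticommute)

lemma d_zero [simp]: "d i (\<lambda>b. 0) = (\<lambda>b. 0)"
  by (simp add: d_def)

lemma d_en_space: "v \<in> en_space p q (Suc k) \<Longrightarrow> d i v \<in> en_space p q k"
  unfolding d_def by (rule contract_en_space)

lemma d_joint_kernel:
  assumes "v \<in> joint_kernel r (Suc k)"
  shows "d i v \<in> joint_kernel r k"
  using assms d_anticommute[of _ i v] by (simp add: joint_kernel_def d_en_space)

text \<open>The kernels of generic operators are cut down one operator at a time without losing exactness.
  If \<open>v = d\<^sub>r w\<close> is killed by \<open>d\<^sub>i\<close>, then \<open>d\<^sub>i w\<close> lies again in the kernel of \<open>d\<^sub>r\<close> and of \<open>d\<^sub>i\<close> but has smaller degree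
  in the coordinates of the \<open>r\<close>-th point; by induction on that degree it is \<open>d\<^sub>i u\<close> with \<open>d\<^sub>r u = 0\<close>.\<close>

theorem joint_kernel_exact:
  assumes "i \<ge> r" "k \<ge> 1" "v \<in> joint_kernel r k" "d i v = (\<lambda>b. 0)"
  shows "\<exists>w\<in>joint_kernel r (Suc k). v = d i w"
  using assms
proof (induction r arbitrary: i k v)
  case 0
  then show ?case
    using exact[of i] unfolding contract_exact_def joint_kernel_def d_def by simp
next
  case (Suc r)
  note outer_IH = Suc.IH and ir0 = Suc.prems(1) and k = Suc.prems(2)
  have step: "\<exists>w\<in>joint_kernel (Suc r) (Suc k). v = d i w"
    if "v \<in> joint_kernel (Suc r) k" "d i v = (\<lambda>b. 0)" "\<And>e' b. e' \<ge> e \<Longrightarrow> hom_part (Y r) e' (v b) = 0" for e v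
    using that
  proof (induction e arbitrary: v)
    case 0
    have "v b = 0" for b
      using sum_hom_part[of 0 "Y r" "v b"] 0(3) by simp
    then have "v = d i (\<lambda>b. 0)" by (simp add: fun_eq_iff)
    moreover have "(\<lambda>b. 0) \<in> joint_kernel (Suc r) (Suc k)"
      by (simp add: joint_kernel_def en_space_def)
    ultimately show ?case by blast
  next
    case (Suc e)
    have ir: "i \<noteq> r" "i \<ge> r" using ir0 by auto
    have v: "v \<in> joint_kernel r k" "d r v = (\<lambda>b. 0)"
      using Suc.prems(1) by (auto simp: joint_kernel_def)
    obtain w where w: "w \<in> joint_kernel r (Suc k)" "v = d r w"
      using outer_IH[OF _ k v] by auto
    define w' where "w' b = (\<Sum>e'<e. hom_part (Y r) e' (w b))" for b
    have dw': "d j w' = (\<lambda>b. \<Sum>e'<e. d j (\<lambda>b. hom_part (Y r) e' (w b)) b)" for j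
      unfolding w'_def[abs_def] d_def contract_sum ..
    have v_w': "v = d r w'"
    proof (rule ext)
      fix b
      have "v b = (\<Sum>e'\<le>e. hom_part (Y r) e' (v b))"
        using Suc.prems(3) by (intro sum_hom_part[symmetric]) simp
      also have "\<dots> = (\<Sum>e'<e. hom_part (Y r) (Suc e') (d r w b))"
        unfolding w(2) by (simp add: sum.atMost_shift hom_part_d_same)
      also have "\<dots> = d r w' b"
        unfolding dw' by (simp add: hom_part_d_same)
      finally show "v b = d r w' b" .
    qed
    have w': "w' \<in> joint_kernel r (Suc k)"
    proof -
      have "d j w' b = 0" if "j < r" for j b
      proof -
        have "d j w = (\<lambda>b. 0)" using w(1) that by (simp add: joint_kernel_def)
        then have "d j (\<lambda>b. hom_part (Y r) e' (w b)) b = 0" for e'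
          using hom_part_d_other[of j r e' w b] that by (metis hom_part_zero less_irrefl)
        then show ?thesis unfolding dw' by simp
      qed
      then show ?thesis
        using w(1) by (simp add: joint_kernel_def en_space_def w'_def fun_eq_iff)
    qed
    have part_w': "hom_part (Y r) e' (w' b) = 0" if "e' \<ge> e" for e' b
      unfolding w'_def hom_part_sum hom_part_hom_part using that by (intro sum.neutral) auto
    have "\<exists>u\<in>joint_kernel (Suc r) (Suc k). d i w' = d i u"
    proof (rule Suc.IH)
      have "d r (d i w') = (\<lambda>b. 0)"
        using d_anticommute[of r i w'] Suc.prems(2) by (simp add: v_w')
      then show "d i w' \<in> joint_kernel (Suc r) k"
        using d_joint_kernel[OF w', of i] by (auto simp: joint_kernel_def less_Suc_eq)
      show "hom_part (Y r) e' (d i w' b) = 0" if "e' \<ge> e" for e' b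
        using that ir by (simp add: hom_part_d_other part_w')
    qed (rule d_square)
    then obtain u where u: "u \<in> joint_kernel (Suc r) (Suc k)" "d i w' = d i u" by blast
    have "\<exists>u'\<in>joint_kernel r (Suc (Suc k)). (\<lambda>b. w' b - u b) = d i u'"
    proof (rule outer_IH)
      show "(\<lambda>b. w' b - u b) \<in> joint_kernel r (Suc k)"
        using w' u(1) by (auto simp: joint_kernel_def en_space_def d_def contract_diff)
      show "d i (\<lambda>b. w' b - u b) = (\<lambda>b. 0)"
        using u(2) by (simp add: d_def contract_diff)
    qed (use ir in auto)
    then obtain u' where u': "u' \<in> joint_kernel r (Suc (Suc k))" "(\<lambda>b. w' b - u b) = d i u'" by blast
    define z where "z b = - d r u' b" for b
    have "d r u = (\<lambda>b. 0)" using u(1) by (simp add: joint_kernel_def)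
    then have "v = d r (\<lambda>b. w' b - u b)"
      unfolding v_w' by (simp add: d_def contract_diff)
    also have "\<dots> = (\<lambda>b. - d i (d r u') b)"
      unfolding u'(2) by (rule d_anticommute)
    also have "\<dots> = d i z"
      unfolding z_def[abs_def] by (simp add: d_def contract_uminus)
    finally have "v = d i z" .
    moreover have "z \<in> joint_kernel (Suc r) (Suc k)"
    proof -
      have "d j (d r u') = (\<lambda>b. 0)" if "j < Suc r" for j
      proof (cases "j = r")
        case False
        then show ?thesis
          using that u'(1) d_anticommute[of j r u'] by (simp add: joint_kernel_def)
      qed (simp add: d_square)
      then show ?thesis
        using d_joint_kernel[OF u'(1), of r]
        by (auto simp: joint_kernel_def z_def[abs_def] en_space_def d_def contract_uminus)
    qed
    ultimately show ?case by blast
  qed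
  have "\<exists>N. \<forall>b. \<forall>e\<ge>N. hom_part (Y r) e (v b) = 0"
  proof -
    have "\<forall>b. \<exists>N. \<forall>e\<ge>N. hom_part (Y r) e (v b) = 0"
      by (intro allI hom_part_eventually_zero)
    then have "\<exists>N. \<forall>b. \<forall>e\<ge>N b. hom_part (Y r) e (v b) = 0"
      by (rule choice)
    then obtain N where N: "\<forall>b. \<forall>e\<ge>N b. hom_part (Y r) e (v b) = 0" by blast
    have "hom_part (Y r) e (v b) = 0" if "e \<ge> Max (insert 0 (N ` en_labels p q k))" for e b
    proof (cases "b \<in> en_labels p q k")
      case True
      then have "N b \<le> Max (insert 0 (N ` en_labels p q k))" by (intro Max_ge) auto
      with that have "N b \<le> e" by (rule order_trans[rotated])
      with N show ?thesis by blast
    next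
      case False
      then show ?thesis using Suc.prems(3) by (cases b) (simp add: joint_kernel_def en_space_def)
    qed
    then show ?thesis by blast
  qed
  then show ?case using step[OF Suc.prems(3,4)] by blast
qed

end

section \<open>Regular sequences of anticommuting operators\<close>

text \<open>The condition \<open>regular\<close> says that \<open>d\<^sub>r\<close> is exact in positive degrees on the common kernel of \<open>d\<^sub>0, \<dots>, d\<^sub>r\<^sub>-\<^sub>1\<close>.\<close>

locale regular_operators = vector_space scale
  for scale :: "'f::field \<Rightarrow> 'v::ab_group_add \<Rightarrow> 'v" +
  fixes E :: "nat \<Rightarrow> 'v set" and d :: "nat \<Rightarrow> 'v \<Rightarrow> 'v" and m :: nat
  assumes subspace_E: "subspace (E k)"
    and d_linear: "Vector_Spaces.linear scale scale (d i)"
    and d_E: "v \<in> E (Suc k) \<Longrightarrow> d i v \<in> E k"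
    and d_square: "d i (d i v) = 0"
    and d_anticommute: "d i (d j v) = - d j (d i v)"
    and E_top: "k > m \<Longrightarrow> v \<in> E k \<Longrightarrow> v = 0"
    and regular: "k \<ge> 1 \<Longrightarrow> v \<in> E k \<Longrightarrow> (\<And>i. i \<le> r \<Longrightarrow> d i v = 0) \<Longrightarrow>
      \<exists>w\<in>E (Suc k). (\<forall>i<r. d i w = 0) \<and> v = d r w"
    and finite_dim: "\<exists>B. finite B \<and> E k \<subseteq> span B"
begin

sublocale d: Vector_Spaces.linear scale scale "d i" for i by (rule d_linear)

text \<open>A product of anticommuting operators over a set is only defined up to sign, so products are compared up to sign.\<close>

definition pm :: "'v \<Rightarrow> 'v \<Rightarrow> bool" where
  "pm v w \<longleftrightarrow> v = w \<or> v = - w"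

lemma pm_refl [simp]: "pm v v"
  by (simp add: pm_def)

lemma pm_sym: "pm v w \<Longrightarrow> pm w v"
  by (auto simp: pm_def)

lemma pm_trans: "pm u v \<Longrightarrow> pm v w \<Longrightarrow> pm u w"
  by (auto simp: pm_def)

lemma pm_d: "pm v w \<Longrightarrow> pm (d i v) (d i w)"
  by (auto simp: pm_def d.neg)

lemma pm_zero: "pm v 0 \<Longrightarrow> v = 0"
  by (auto simp: pm_def)

lemma pm_subspace: "pm v w \<Longrightarrow> subspace S \<Longrightarrow> v \<in> S \<longleftrightarrow> w \<in> S"
  by (auto simp: pm_def subspace_neg dest: subspace_neg)

definition d_list :: "nat list \<Rightarrow> 'v \<Rightarrow> 'v" where
  "d_list xs = foldr d xs"

lemma d_list_Nil [simp]: "d_list [] v = v"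
  and d_list_Cons [simp]: "d_list (x # xs) v = d x (d_list xs v)"
  and d_list_append: "d_list (xs @ ys) v = d_list xs (d_list ys v)"
  by (simp_all add: d_list_def)

lemma linear_d_list: "Vector_Spaces.linear scale scale (d_list xs)"
proof (induction xs)
  case Nil
  show ?case unfolding d_list_def foldr.simps id_def by unfold_locales auto
next
  case (Cons x xs)
  then interpret L: Vector_Spaces.linear scale scale "d_list xs" .
  have "d_list (x # xs) = (\<lambda>v. d x (d_list xs v))" by (simp add: d_list_def comp_def)
  then show ?case
    by (simp only:) (unfold_locales, simp_all add: L.add L.scale d.add d.scale)
qed

sublocale dl: Vector_Spaces.linear scale scale "d_list xs" for xs by (rule linear_d_list)

lemma d_list_d: "pm (d_list xs (d i v)) (d i (d_list xs v))"
proof (induction xs)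
  case (Cons x xs)
  have "pm (d x (d_list xs (d i v))) (d x (d i (d_list xs v)))"
    using Cons by (rule pm_d)
  moreover have "pm (d x (d i (d_list xs v))) (d i (d x (d_list xs v)))"
    unfolding pm_def by (rule disjI2, rule d_anticommute)
  ultimately show ?case by (auto intro: pm_trans)
qed simp

lemma pm_d_list: "pm v w \<Longrightarrow> pm (d_list xs v) (d_list xs w)"
  by (induction xs) (auto intro: pm_d)

lemma d_list_remove: "x \<in> set xs \<Longrightarrow> pm (d_list xs v) (d x (d_list (remove1 x xs) v))"
proof (induction xs)
  case (Cons y xs)
  show ?case
  proof (cases "x = y")
    case False
    then have "pm (d y (d_list xs v)) (d y (d x (d_list (remove1 x xs) v)))"
      using Cons by (intro pm_d) auto
    moreover have "pm (d y (d x (d_list (remove1 x xs) v))) (d x (d y (d_list (remove1 x xs) v)))"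
      unfolding pm_def by (rule disjI2, rule d_anticommute)
    ultimately show ?thesis using False by (auto intro: pm_trans)
  qed simp
qed simp

lemma d_list_mset: "mset xs = mset ys \<Longrightarrow> pm (d_list xs v) (d_list ys v)"
proof (induction xs arbitrary: ys)
  case (Cons x xs)
  then have x: "x \<in> set ys" by (metis list.set_intros(1) mset_eq_setD)
  have "mset xs = mset (remove1 x ys)"
    using Cons.prems by (metis mset_remove1 remove1.simps(2))
  then have "pm (d x (d_list xs v)) (d x (d_list (remove1 x ys) v))"
    by (intro pm_d Cons.IH)
  then show ?case
    using d_list_remove[OF x, of v] by (auto intro: pm_trans pm_sym)
qed simp

lemma d_d_list_zero: "i \<in> set xs \<Longrightarrow> d i (d_list xs v) = 0"
  using pm_d[OF d_list_remove[of i xs v], of i] by (simp add: d_square pm_zero)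

lemma d_list_d_zero: "i \<in> set xs \<Longrightarrow> d_list xs (d i v) = 0"
  using d_list_d[of xs i v] by (simp add: d_d_list_zero pm_zero)

lemma d_list_E: "v \<in> E (length xs + k) \<Longrightarrow> d_list xs v \<in> E k"
  by (induction xs arbitrary: k) (simp, metis Suc_eq_plus1 add_Suc add_Suc_right d_E d_list_Cons length_Cons)

text \<open>An element of degree \<open>k\<close> killed by the first \<open>r\<close> operators comes from degree \<open>k + r\<close>, and there is nothing above degree \<open>m\<close>.\<close>

lemma joint_kernel_zero:
  assumes "k \<ge> 1" "v \<in> E k" "\<And>i. i < r \<Longrightarrow> d i v = 0" "k + r > m"
  shows "v = 0"
  using assms
proof (induction r arbitrary: k v)
  case 0
  then show ?case using E_top by auto
next
  case (Suc r)
  then obtain w where w: "w \<in> E (Suc k)" "\<forall>i<r. d i w = 0" "v = d r w"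
    using regular[of k v r] by (auto simp: less_Suc_eq_le)
  then have "w = 0" using Suc.IH[of "Suc k" w] Suc.prems by simp
  then show ?case using w by simp
qed

lemma joint_kernel_image:
  assumes "k \<ge> 1" "v \<in> E k" "\<And>i. i < r \<Longrightarrow> d i v = 0"
  shows "\<exists>w\<in>E (r + k). v = d_list [0..<r] w"
  using assms
proof (induction r arbitrary: k v)
  case (Suc r)
  then obtain w where w: "w \<in> E (Suc k)" "\<forall>i<r. d i w = 0" "v = d r w"
    using regular[of k v r] by (auto simp: less_Suc_eq_le)
  then obtain u where u: "u \<in> E (r + Suc k)" "w = d_list [0..<r] u"
    using Suc.IH[of "Suc k" w] Suc.prems by auto
  have "pm (d_list [0..<Suc r] u) v"
    using d_list_d[of "[0..<r]" r u] u w by (simp add: d_list_append)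
  then have "v = d_list [0..<Suc r] u \<or> v = d_list [0..<Suc r] (- u)"
    by (auto simp: pm_def dl.neg)
  moreover have "- u \<in> E (r + Suc k)" using u(1) subspace_E subspace_neg by blast
  ultimately show ?case using u(1) by auto
qed simp

text \<open>If \<open>d\<^sub>0 \<cdots> d\<^sub>r\<close> kills \<open>v\<close>, then \<open>d\<^sub>0 \<cdots> d\<^sub>r\<^sub>-\<^sub>1 v\<close> lies in the kernel of \<open>d\<^sub>r\<close> on the common kernel of the previous
  operators, so it is \<open>d\<^sub>r\<close> of a product \<open>d\<^sub>0 \<cdots> d\<^sub>r\<^sub>-\<^sub>1 w\<close>; subtracting \<open>d\<^sub>r w\<close> from \<open>v\<close> leaves the case of \<open>r\<close> factors.\<close>

lemma kernel_of_product:
  assumes "v \<in> E k" "k \<ge> r" "d_list [0..<r] v = 0"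
  shows "\<exists>u. (\<forall>i<r. u i \<in> E (Suc k)) \<and> v = (\<Sum>i<r. d i (u i))"
  using assms
proof (induction r arbitrary: v)
  case (Suc r)
  let ?P = "d_list [0..<r]"
  have "d r (?P v) = 0"
    using d_list_d[of "[0..<r]" r v] Suc.prems by (simp add: d_list_append) (metis pm_sym pm_zero)
  moreover have "d i (?P v) = 0" if "i < r" for i
    using that by (intro d_d_list_zero) simp
  ultimately have ker: "\<And>i. i \<le> r \<Longrightarrow> d i (?P v) = 0"
    by (metis le_neq_implies_less)
  have kr: "1 \<le> k - r" using Suc.prems(2) by simp
  have "?P v \<in> E (k - r)" using Suc.prems by (intro d_list_E) simp
  then obtain w where w: "w \<in> E (Suc (k - r))" "\<forall>i<r. d i w = 0" "?P v = d r w"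
    using regular[of "k - r" "?P v" r] ker kr by auto
  obtain w' where w': "w' \<in> E (r + Suc (k - r))" "w = ?P w'"
    using joint_kernel_image[of "Suc (k - r)" w r] w by auto
  have w'E: "w' \<in> E (Suc k)" using w'(1) Suc.prems(2) by simp
  have "pm (?P (d r w')) (?P v)"
    using d_list_d[of "[0..<r]" r w'] w w' by simp
  then obtain y where y: "y \<in> E (Suc k)" "?P v = ?P (d r y)"
    using w'E subspace_E subspace_neg unfolding pm_def
    by (metis d.neg dl.neg add.inverse_inverse)
  have "?P (v - d r y) = 0" using y by (simp add: dl.diff)
  moreover have "v - d r y \<in> E k"
    using Suc.prems(1) d_E[OF y(1)] subspace_E subspace_diff by blast
  ultimately obtain u where u: "\<forall>i<r. u i \<in> E (Suc k)" "v - d r y = (\<Sum>i<r. d i (u i))"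
    using Suc.IH[of "v - d r y"] Suc.prems(2) by auto
  have "v = (\<Sum>i<Suc r. d i ((u(r := y)) i))"
    using u(2) by (simp add: algebra_simps)
  then show ?case using u(1) y(1) by (intro exI[of _ "u(r := y)"]) (auto simp: less_Suc_eq)
qed simp

subsection \<open>The flag of product images\<close>

text \<open>In the application, restricting the maximal minors to the space spanned by \<open>m + 1\<close> generic points identifies \<open>E\<^sub>0\<close> with
  the forms of degree \<open>p\<close> in coordinates \<open>z\<^sub>0, \<dots>, z\<^sub>m\<close>, and the \<open>j\<close>-th step of the flag should be pictured as the forms
  that vanish for \<open>z\<^sub>j = \<dots> = z\<^sub>m = 0\<close>.\<close>

definition flag :: "nat \<Rightarrow> 'v set" where
  "flag j = d_list [0..<j] ` E j"

lemma flagI: "w \<in> E j \<Longrightarrow> d_list [0..<j] w \<in> flag j"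
  by (simp add: flag_def)

lemma subspace_flag: "subspace (flag j)"
  unfolding flag_def by (intro dl.subspace_image subspace_E)

lemma flag_0: "flag 0 = E 0"
  by (simp add: flag_def)

lemma flag_Suc: "flag (Suc j) \<subseteq> flag j"
  by (auto simp: flag_def d_list_append intro: d_E)

lemma flag_antimono: "i \<le> j \<Longrightarrow> flag j \<subseteq> flag i"
  by (rule lift_Suc_antimono_le[of flag, OF flag_Suc])

lemma flag_top: "v \<in> flag (Suc m) \<Longrightarrow> v = 0"
proof -
  assume "v \<in> flag (Suc m)"
  then obtain w where "w \<in> E (Suc m)" "v = d_list [0..<Suc m] w" by (auto simp: flag_def)
  moreover from this have "w = 0" using E_top[of "Suc m" w] by simp
  ultimately show ?thesis by (simp only: dl.zero)
qed

lemma flag_pm: "pm v w \<Longrightarrow> v \<in> flag j \<longleftrightarrow> w \<in> flag j"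
  by (rule pm_subspace[OF _ subspace_flag])

text \<open>Membership in the step \<open>j + 1\<close> of the flag has to be tested with \<open>d\<^sub>0, \<dots>, d\<^sub>j\<^sub>-\<^sub>1\<close> only.  The induction on \<open>t\<close> rewrites
  \<open>v\<close> as \<open>d\<^sub>0 \<cdots> d\<^sub>t\<^sub>-\<^sub>1 u\<close>, neglecting terms that \<open>d\<^sub>j\<close> kills; for \<open>t = j\<close> the conclusion is immediate.\<close>

lemma flag_d:
  assumes v: "v \<in> E 1" and flag: "\<And>i. i < j \<Longrightarrow> d i v \<in> flag (Suc j)"
  shows "d j v \<in> flag (Suc j)"
proof -
  have "\<exists>u\<in>E (Suc t). (\<forall>i<j. d i (d_list [0..<t] u) \<in> flag (Suc j)) \<and> d j v = d j (d_list [0..<t] u)"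
    if "t \<le> j" for t
    using that
  proof (induction t)
    case 0
    then show ?case using v flag by auto
  next
    case (Suc t)
    then obtain u where u: "u \<in> E (Suc t)" "\<And>i. i < j \<Longrightarrow> d i (d_list [0..<t] u) \<in> flag (Suc j)"
      "d j v = d j (d_list [0..<t] u)" by auto
    have tj: "t < j" using Suc.prems by simp
    have split: "[0..<Suc j] = [0..<Suc t] @ [Suc t..<Suc j]"
      using upt_add_eq_append[of 0 "Suc t" "j - t"] tj by (simp del: upt_Suc)
    have "pm (d_list [0..<Suc t] u) (d t (d_list [0..<t] u))"
      using d_list_d[of "[0..<t]" t u] by (simp add: d_list_append)
    then have "d_list [0..<Suc t] u \<in> flag (Suc j)"
      using u(2)[OF tj] flag_pm by blast
    then obtain w where w: "w \<in> E (Suc j)" "d_list [0..<Suc t] u = d_list [0..<Suc j] w"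
      by (auto simp: flag_def)
    define y where "y = d_list [Suc t..<Suc j] w"
    have y: "y \<in> E (Suc t)" unfolding y_def using w(1) tj by (intro d_list_E) simp
    have "d_list [0..<Suc t] (u - y) = 0"
      using w(2) unfolding y_def split d_list_append dl.diff by simp
    moreover have "u - y \<in> E (Suc t)" using u(1) y subspace_E subspace_diff by blast
    ultimately obtain z where z: "\<forall>i<Suc t. z i \<in> E (Suc (Suc t))" "u - y = (\<Sum>i<Suc t. d i (z i))"
      using kernel_of_product[of "u - y" "Suc t" "Suc t"] by auto
    have "u = y + (\<Sum>i<t. d i (z i)) + d t (z t)"
      using z(2) by (simp add: algebra_simps)
    moreover have "d_list [0..<t] (\<Sum>i<t. d i (z i)) = 0"
      unfolding dl.sum by (intro sum.neutral ballI d_list_d_zero) simp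
    ultimately have Pu: "d_list [0..<t] u = d_list ([0..<t] @ [Suc t..<Suc j]) w + d_list [0..<Suc t] (z t)"
      by (simp add: dl.add d_list_append y_def)
    \<comment> \<open>The neglected term: a product in which exactly the operators with index at most \<open>j\<close> except \<open>t\<close> occur.\<close>
    let ?rest = "d_list ([0..<t] @ [Suc t..<Suc j]) w"
    have rest: "d i ?rest = 0" if "i \<le> j" "i \<noteq> t" for i
      by (rule d_d_list_zero) (use that tj in auto)
    have "mset (t # [0..<t] @ [Suc t..<Suc j]) = mset [0..<Suc j]"
      unfolding split by simp
    then have "pm (d_list (t # [0..<t] @ [Suc t..<Suc j]) w) (d_list [0..<Suc j] w)"
      by (rule d_list_mset)
    then have rest_t: "d t ?rest \<in> flag (Suc j)"
      using flagI[OF w(1)] flag_pm by (metis d_list_Cons)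
    have "d i (d_list [0..<Suc t] (z t)) \<in> flag (Suc j)" if "i < j" for i
    proof -
      have "d i ?rest \<in> flag (Suc j)"
        using rest[of i] rest_t that subspace_0[OF subspace_flag] by (cases "i = t") auto
      moreover have "d i (d_list [0..<Suc t] (z t)) = d i (d_list [0..<t] u) - d i ?rest"
        unfolding Pu by (simp add: d.add)
      ultimately show ?thesis
        using u(2)[OF that] subspace_flag subspace_diff by metis
    qed
    moreover have "d j v = d j (d_list [0..<Suc t] (z t))"
      unfolding u(3) Pu using rest[of j] tj by (simp add: d.add)
    ultimately show ?case using z(1) by blast
  qed
  from this[of j] obtain u where u: "u \<in> E (Suc j)" "d j v = d j (d_list [0..<j] u)" by auto
  have "pm (d_list [0..<Suc j] u) (d j (d_list [0..<j] u))"
    using d_list_d[of "[0..<j]" j u] by (simp add: d_list_append)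
  then show ?thesis
    using flagI[OF u(1)] flag_pm unfolding u(2) by blast
qed

subsection \<open>Products over finite sets\<close>

definition d_set :: "nat set \<Rightarrow> 'v \<Rightarrow> 'v" where
  "d_set A = d_list (sorted_list_of_set A)"

lemma mset_sorted_list_of_set: "finite A \<Longrightarrow> mset (sorted_list_of_set A) = mset_set A"
  by (metis distinct_sorted_list_of_set mset_set_set set_sorted_list_of_set)

lemma d_set_empty [simp]: "d_set {} v = v"
  by (simp add: d_set_def)

lemma d_set_atMost: "d_set {..<j} = d_list [0..<j]"
  by (simp add: d_set_def atLeast0LessThan[symmetric])

lemma d_d_set_zero: "finite A \<Longrightarrow> a \<in> A \<Longrightarrow> d a (d_set A v) = 0"
  unfolding d_set_def by (intro d_d_list_zero) simp

lemma d_set_d_zero: "finite A \<Longrightarrow> a \<in> A \<Longrightarrow> d_set A (d a v) = 0"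
  unfolding d_set_def by (intro d_list_d_zero) simp

lemma d_set_insert: "finite A \<Longrightarrow> a \<notin> A \<Longrightarrow> pm (d_set (insert a A) v) (d a (d_set A v))"
  using d_list_mset[of "sorted_list_of_set (insert a A)" "a # sorted_list_of_set A" v]
  by (simp add: d_set_def)

lemma d_set_d: "finite A \<Longrightarrow> a \<notin> A \<Longrightarrow> pm (d_set A (d a v)) (d_set (insert a A) v)"
  unfolding d_set_def
  using d_list_mset[of "sorted_list_of_set A @ [a]" "sorted_list_of_set (insert a A)" v]
  by (simp add: d_list_append)

lemma d_set_union:
  assumes "finite A" "finite B" "A \<inter> B = {}"
  shows "pm (d_set A (d_set B v)) (d_set (A \<union> B) v)"
  unfolding d_set_def
  using d_list_mset[of "sorted_list_of_set A @ sorted_list_of_set B" "sorted_list_of_set (A \<union> B)" v] assms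
  by (simp add: d_list_append mset_set_Union mset_sorted_list_of_set)

lemma d_set_d_set_zero:
  assumes "finite A" "finite B" "a \<in> A" "a \<in> B"
  shows "d_set A (d_set B v) = 0"
proof -
  have "pm (d_set B v) (d a (d_set (B - {a}) v))"
    using d_set_insert[of "B - {a}" a v] assms by (simp add: insert_absorb)
  then have "pm (d_set A (d_set B v)) (d_set A (d a (d_set (B - {a}) v)))"
    unfolding d_set_def by (rule pm_d_list)
  then show ?thesis using d_set_d_zero[of A a] assms by (simp add: pm_zero)
qed

lemma d_set_E: "finite A \<Longrightarrow> v \<in> E (card A + k) \<Longrightarrow> d_set A v \<in> E k"
  unfolding d_set_def by (rule d_list_E) simp

sublocale ds: Vector_Spaces.linear scale scale "d_set A" for A
  unfolding d_set_def by (rule linear_d_list)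

text \<open>The analogue of \<open>flag_d\<close> in all degrees: a product over a set containing \<open>j\<close> is \<open>d\<^sub>j\<close> applied to an element of degree one.\<close>

lemma flag_extend:
  assumes v: "v \<in> E k" and flag: "\<And>A. A \<subseteq> {..<j} \<Longrightarrow> card A = k \<Longrightarrow> d_set A v \<in> flag (Suc j)"
    and A: "A \<subseteq> {..<Suc j}" "card A = k"
  shows "d_set A v \<in> flag (Suc j)"
proof (cases "j \<in> A")
  case False
  then show ?thesis using A by (intro flag) (auto simp: less_Suc_eq)
next
  case True
  define B where "B = A - {j}"
  have B: "A = insert j B" "j \<notin> B" "B \<subseteq> {..<j}" "finite A" "finite B"
    using True A finite_subset[OF A(1)] by (auto simp: B_def less_Suc_eq)
  then have Bk: "Suc (card B) = k" using A(2) by auto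
  have "d i (d_set B v) \<in> flag (Suc j)" if "i < j" for i
  proof (cases "i \<in> B")
    case True
    then show ?thesis using B subspace_0[OF subspace_flag] by (simp add: d_d_set_zero)
  next
    case False
    then have "d_set (insert i B) v \<in> flag (Suc j)"
      using B Bk that False by (intro flag) auto
    then show ?thesis using d_set_insert[OF B(5) False, of v] flag_pm by blast
  qed
  moreover have "d_set B v \<in> E 1" using B Bk v by (intro d_set_E) auto
  ultimately have "d j (d_set B v) \<in> flag (Suc j)" by (intro flag_d)
  then show ?thesis using d_set_insert[OF B(5,2), of v] flag_pm B(1) by blast
qed

lemma d_set_injective:
  assumes "v \<in> E k" "\<And>A. A \<subseteq> {..<m} \<Longrightarrow> card A = k \<Longrightarrow> d_set A v = 0"
  shows "v = 0"
  using assms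
proof (induction k arbitrary: v)
  case 0
  then show ?case using 0(2)[of "{}"] by simp
next
  case (Suc k)
  have "d i v = 0" if i: "i < m" for i
  proof (rule Suc.IH)
    show "d i v \<in> E k" using Suc.prems(1) by (rule d_E)
    fix A assume A: "A \<subseteq> {..<m}" "card A = k"
    then have fin: "finite A" using finite_subset by blast
    show "d_set A (d i v) = 0"
    proof (cases "i \<in> A")
      case False
      then have "d_set (insert i A) v = 0" using A i fin by (intro Suc.prems(2)) auto
      then show ?thesis using d_set_d[OF fin False, of v] by (simp add: pm_zero)
    qed (simp add: fin d_set_d_zero)
  qed
  then show ?case using joint_kernel_zero[of "Suc k" v m] Suc.prems(1) by simp
qed

subsection \<open>A basis adapted to the flag\<close>

lemma adapted_basis:
  obtains B and lev :: "'v \<Rightarrow> nat" where "finite B" "independent B" "\<And>b. b \<in> B \<Longrightarrow> lev b \<le> m"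
    "\<And>j. j \<le> Suc m \<Longrightarrow> span {b \<in> B. j \<le> lev b} = flag j"
proof -
  have "\<exists>B lev. finite B \<and> independent B \<and> (\<forall>b\<in>B. j \<le> lev b \<and> lev b \<le> m) \<and>
     (\<forall>i. j \<le> i \<and> i \<le> Suc m \<longrightarrow> span {b \<in> B. i \<le> lev b} = flag i)" if "j \<le> Suc m" for j
    using that
  proof (induction rule: inc_induct)
    case base
    have "flag (Suc m) = {0}"
      using flag_top subspace_0[OF subspace_flag] by blast
    then have "span {b \<in> {}. i \<le> (0 :: nat)} = flag i" if "Suc m \<le> i" "i \<le> Suc m" for i
      using that by (metis Collect_empty_eq empty_iff le_antisym span_empty)
    then show ?case
      by (intro exI[of _ "{}"] exI[of _ "\<lambda>_. 0"]) (simp add: independent_empty, metis le_antisym)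
  next
    case (step j)
    then obtain B lev where B: "finite B" "independent B" "\<And>b. b \<in> B \<Longrightarrow> Suc j \<le> lev b \<and> lev b \<le> m"
      "\<And>i. Suc j \<le> i \<Longrightarrow> i \<le> Suc m \<Longrightarrow> span {b \<in> B. i \<le> lev b} = flag i" by blast
    have "{b \<in> B. Suc j \<le> lev b} = B" using B(3) by auto
    then have "span B = flag (Suc j)" using B(4)[of "Suc j"] step.hyps by simp
    then have "B \<subseteq> flag j" using flag_Suc span_superset by blast
    then obtain C where C: "B \<subseteq> C" "C \<subseteq> flag j" "independent C" "flag j \<subseteq> span C"
      using maximal_independent_subset_extend[OF _ B(2)] by blast
    obtain D where D: "finite D" "E 0 \<subseteq> span D" using finite_dim by blast
    have "C \<subseteq> span D" using C(2) flag_antimono[of 0 j] D(2) by (auto simp: flag_0)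
    then have finC: "finite C" using independent_span_bound[OF D(1) C(3)] by blast
    have spanC: "span C = flag j" using C(2,4) span_minimal[OF _ subspace_flag] by blast
    define lev' where "lev' b = (if b \<in> B then lev b else j)" for b
    have "span {b \<in> C. i \<le> lev' b} = flag i" if i: "j \<le> i" "i \<le> Suc m" for i
    proof (cases "i = j")
      case True
      have "{b \<in> C. j \<le> lev' b} = C" using B(3) by (auto simp: lev'_def dest: Suc_leD)
      then show ?thesis using True spanC by simp
    next
      case False
      have "{b \<in> C. i \<le> lev' b} = {b \<in> B. i \<le> lev b}"
        using False i C(1) by (auto simp: lev'_def)
      then show ?thesis using B(4)[of i] i False by simp
    qed
    moreover have "\<forall>b\<in>C. j \<le> lev' b \<and> lev' b \<le> m"
      using B(3) step.hyps by (auto simp: lev'_def dest: Suc_leD)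
    ultimately show ?case using finC C(3) by (intro exI[of _ C] exI[of _ lev']) blast
  qed
  from this[of 0] show thesis using that by auto
qed

end

section \<open>Leading labels\<close>

text \<open>The leading label of an element is the first one, in the order given by \<open>key\<close>, at which its coordinate \<open>\<psi>\<close> is nonzero.\<close>

definition leading :: "'l set \<Rightarrow> ('l \<Rightarrow> nat) \<Rightarrow> ('l \<Rightarrow> 'b \<Rightarrow> 'a::zero) \<Rightarrow> 'b set \<Rightarrow> 'l set" where
  "leading S key \<psi> V = {x \<in> S. \<exists>v\<in>V. \<psi> x v \<noteq> 0 \<and> (\<forall>y\<in>S. key y < key x \<longrightarrow> \<psi> y v = 0)}"

context vector_space
begin

text \<open>Imposing the vanishing of the first coordinate lowers the dimension by one if the first label is leading, and not at all
  otherwise.\<close>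

lemma basis_card_leading:
  fixes key :: "'l \<Rightarrow> nat" and \<psi> :: "'l \<Rightarrow> 'b \<Rightarrow> 'a"
  assumes S: "finite S" "inj_on key S" and V: "subspace V"
    and add: "\<And>x v w. x \<in> S \<Longrightarrow> v \<in> V \<Longrightarrow> w \<in> V \<Longrightarrow> \<psi> x (v + w) = \<psi> x v + \<psi> x w"
    and sc: "\<And>x c v. x \<in> S \<Longrightarrow> v \<in> V \<Longrightarrow> \<psi> x (scale c v) = c * \<psi> x v"
    and inj: "\<And>v. v \<in> V \<Longrightarrow> (\<And>x. x \<in> S \<Longrightarrow> \<psi> x v = 0) \<Longrightarrow> v = 0"
  shows "\<exists>B. finite B \<and> independent B \<and> span B = V \<and> card B = card (leading S key \<psi> V)"
  using S V add sc inj
proof (induction "card S" arbitrary: S V)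
  case 0
  then have "S = {}" by simp
  then have "V = {0}" using 0 subspace_0 by auto
  then show ?case using \<open>S = {}\<close> by (intro exI[of _ "{}"]) (simp add: leading_def independent_empty)
next
  case (Suc n)
  have "S \<noteq> {}" using Suc.hyps(2) by auto
  then obtain x where x: "x \<in> S" "\<And>y. y \<in> S \<Longrightarrow> key x \<le> key y"
  proof -
    have "Min (key ` S) \<in> key ` S" using Suc.prems(1) \<open>S \<noteq> {}\<close> by (intro Min_in) auto
    then obtain x where "x \<in> S" "key x = Min (key ` S)" by auto
    then show thesis using that[of x] Suc.prems(1) by simp
  qed
  have x_min: "\<not> key y < key x" if "y \<in> S" for y using x(2)[OF that] by simp
  define V' where "V' = {v \<in> V. \<psi> x v = 0}"
  define S' where "S' = S - {x}"
  have zero: "\<psi> x 0 = 0" using Suc.prems(5)[of x 0 0] x(1) subspace_0[OF Suc.prems(3)] by simp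
  have V': "subspace V'"
    using Suc.prems(3) x(1) by (auto simp: subspace_def V'_def Suc.prems(4,5) zero)
  have "\<exists>B. finite B \<and> independent B \<and> span B = V' \<and> card B = card (leading S' key \<psi> V')"
  proof (rule Suc.hyps(1))
    show "n = card S'" using Suc.hyps(2) x(1) by (simp add: S'_def)
    show "finite S'" "inj_on key S'" using Suc.prems(1,2) by (auto simp: S'_def inj_on_diff)
    show "v = 0" if "v \<in> V'" "\<And>x. x \<in> S' \<Longrightarrow> \<psi> x v = 0" for v
      using that Suc.prems(6)[of v] unfolding V'_def S'_def by blast
  qed (use V' Suc.prems(4,5) in \<open>auto simp: V'_def S'_def\<close>)
  then obtain B where B: "finite B" "independent B" "span B = V'" "card B = card (leading S' key \<psi> V')" by blast
  have lead_eq: "leading S key \<psi> V - {x} = leading S' key \<psi> V'"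
  proof -
    have "key x < key y" if "y \<in> S'" for y
      using that x Suc.prems(2) by (metis DiffE S'_def inj_onD insertI1 le_neq_implies_less)
    then show ?thesis
      using x(1) unfolding leading_def S'_def V'_def by blast
  qed
  show ?case
  proof (cases "V' = V")
    case True
    then have "x \<notin> leading S key \<psi> V" by (auto simp: leading_def V'_def)
    then show ?thesis using B lead_eq True by auto
  next
    case False
    then obtain v where v: "v \<in> V" "\<psi> x v \<noteq> 0" by (auto simp: V'_def)
    then have lead: "x \<in> leading S key \<psi> V" using x(1) x_min by (auto simp: leading_def)
    have notin: "v \<notin> span B" using v B(3) by (simp add: V'_def)
    have "span (insert v B) = V"
    proof
      show "span (insert v B) \<subseteq> V"
        using v(1) B(3) span_superset[of B] Suc.prems(3) by (intro span_minimal) (auto simp: V'_def)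
      show "V \<subseteq> span (insert v B)"
      proof
        fix w assume w: "w \<in> V"
        let ?c = "\<psi> x w / \<psi> x v"
        have "\<psi> x (w - scale ?c v) = 0"
          using Suc.prems(4)[of x w "scale (- ?c) v"] Suc.prems(5)[of x v "- ?c"] x(1) v w
            subspace_scale[OF Suc.prems(3) v(1), of "- ?c"] by simp
        moreover have "w - scale ?c v \<in> V"
          using w v(1) Suc.prems(3) by (simp add: subspace_diff subspace_scale)
        ultimately have "w - scale ?c v \<in> span B" using B(3) by (simp add: V'_def)
        then show "w \<in> span (insert v B)" unfolding span_insert by blast
      qed
    qed
    moreover have "independent (insert v B)" using notin B(2) by (rule independent_insertI)
    moreover have "card (insert v B) = card (leading S key \<psi> V)"
    proof -
      have "v \<notin> B" using notin span_superset by blast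
      moreover have "finite (leading S key \<psi> V)" using Suc.prems(1) by (simp add: leading_def)
      ultimately show ?thesis
        using B(1,4) lead lead_eq by (simp add: card_Suc_Diff1[symmetric, of "leading S key \<psi> V" x])
    qed
    ultimately show ?thesis using B(1) by blast
  qed
qed

lemma dim_eq_card_leading:
  fixes key :: "'l \<Rightarrow> nat" and \<psi> :: "'l \<Rightarrow> 'b \<Rightarrow> 'a"
  assumes "finite S" "inj_on key S" "subspace V"
    "\<And>x v w. x \<in> S \<Longrightarrow> v \<in> V \<Longrightarrow> w \<in> V \<Longrightarrow> \<psi> x (v + w) = \<psi> x v + \<psi> x w"
    "\<And>x c v. x \<in> S \<Longrightarrow> v \<in> V \<Longrightarrow> \<psi> x (scale c v) = c * \<psi> x v"
    "\<And>v. v \<in> V \<Longrightarrow> (\<And>x. x \<in> S \<Longrightarrow> \<psi> x v = 0) \<Longrightarrow> v = 0"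
  shows "dim V = card (leading S key \<psi> V)"
proof -
  obtain B where "independent B" "span B = V" "card B = card (leading S key \<psi> V)"
    using basis_card_leading[where \<psi> = \<psi> and key = key, OF assms] by blast
  then show ?thesis using dim_span_eq_card_independent[of B] by simp
qed

end

section \<open>Dimensions of graded submodules\<close>

text \<open>Labels will be numbered by natural numbers written with digits of decreasing significance.\<close>

lemma two_digit_less:
  assumes "c < (M::nat)" "c' < M"
  shows "x * M + c < y * M + c' \<longleftrightarrow> x < y \<or> x = y \<and> c < c'"
proof -
  have "x * M + c < y * M + c'" if "x < y"
  proof -
    have "x * M + c < Suc x * M" using assms by simp
    also have "\<dots> \<le> y * M" using that by (intro mult_le_mono1) simp
    finally show ?thesis by simp
  qed
  moreover have "y * M + c' < x * M + c" if "y < x"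
  proof -
    have "y * M + c' < Suc y * M" using assms by simp
    also have "\<dots> \<le> x * M" using that by (intro mult_le_mono1) simp
    finally show ?thesis by simp
  qed
  ultimately show ?thesis by (cases x y rule: linorder_cases) auto
qed

lemma set_encode_bound: "A \<subseteq> {..<m} \<Longrightarrow> set_encode A < 2 ^ m"
proof -
  assume A: "A \<subseteq> {..<m}"
  have "set_encode A \<le> (\<Sum>i<m. 2 ^ i)"
    unfolding set_encode_def using A by (intro sum_mono2) auto
  also have "\<dots> < 2 ^ m" by (induction m) auto
  finally show ?thesis .
qed

context regular_operators
begin

text \<open>The labels are the pairs \<open>(b, A)\<close> with \<open>b\<close> in the adapted basis and \<open>A\<close> a set of indices below its level, and the coordinate
  of \<open>v\<close> at \<open>(b, A)\<close> is the one of \<open>d\<^sub>A v\<close> along \<open>b\<close>.  The levels come first in the order, so that an element whose coordinates of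
  lower level vanish has all its products deep in the flag (\<open>in_flag\<close>).\<close>

theorem graded_submodule_dimensions:
  obtains B :: "'v set" and lev :: "'v \<Rightarrow> nat" where "finite B" "\<And>b. b \<in> B \<Longrightarrow> lev b \<le> m"
    "\<And>k. dim (E k) = (\<Sum>b\<in>B. lev b choose k)"
    "\<And>V. (\<And>k. subspace (V k)) \<Longrightarrow> (\<And>k. V k \<subseteq> E k) \<Longrightarrow> (\<And>k i v. v \<in> V (Suc k) \<Longrightarrow> d i v \<in> V k) \<Longrightarrow>
      \<exists>\<Delta>. (\<forall>b\<in>B. \<forall>A\<in>\<Delta> b. A \<subseteq> {..<lev b} \<and> (\<forall>a\<in>A. A - {a} \<in> \<Delta> b)) \<and>
        (\<forall>k. dim (V k) = (\<Sum>b\<in>B. card {A \<in> \<Delta> b. card A = k}))"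
proof -
  obtain B lev where B: "finite B" "independent B" "\<And>b. b \<in> B \<Longrightarrow> lev b \<le> m"
    and flag: "\<And>j. j \<le> Suc m \<Longrightarrow> span {b \<in> B. j \<le> lev b} = flag j"
    by (rule adapted_basis) blast
  define coord where "coord b w = representation B w b" for b w
  have spanB: "span B = E 0" using flag[of 0] by (simp add: flag_0)
  have flag_E0: "flag j \<subseteq> E 0" for j using flag_antimono[of 0 j] by (simp add: flag_0)
  have coord_flag: "coord b w = 0" if "w \<in> flag j" "lev b < j" "j \<le> Suc m" for b w j
  proof -
    have "representation B w = representation {b \<in> B. j \<le> lev b} w"
      using representation_extend[OF B(2), of w "{b \<in> B. j \<le> lev b}"] flag[OF that(3)] that(1) by auto
    then show ?thesis
      using representation_ne_zero[of "{b \<in> B. j \<le> lev b}" w b] that(2) by (auto simp: coord_def)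
  qed
  have flag_coord: "w \<in> flag j" if "w \<in> E 0" "\<And>b. b \<in> B \<Longrightarrow> lev b < j \<Longrightarrow> coord b w = 0" "j \<le> Suc m" for w j
  proof -
    have "w = (\<Sum>b\<in>B. scale (coord b w) b)"
      using sum_representation_eq[OF B(2), of w B] that(1) spanB B(1) by (simp add: coord_def)
    also have "\<dots> = (\<Sum>b\<in>{b \<in> B. j \<le> lev b}. scale (coord b w) b)"
      using B(1) that(2) by (intro sum.mono_neutral_right) (auto simp: not_le)
    also have "\<dots> \<in> span {b \<in> B. j \<le> lev b}"
      by (intro span_sum span_scale span_base)
    finally show ?thesis using flag[OF that(3)] by simp
  qed
  obtain idx where idx: "bij_betw idx B {..<card B}"
    using ex_bij_betw_finite_nat[OF B(1)] by (auto simp: atLeast0LessThan)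
  define ord where "ord b = lev b * card B + idx b" for b
  have idx_less: "idx b < card B" if "b \<in> B" for b
    using idx that by (auto simp: bij_betw_def)
  have ord_less: "ord b < ord b' \<longleftrightarrow> lev b < lev b' \<or> lev b = lev b' \<and> idx b < idx b'" if "b \<in> B" "b' \<in> B" for b b'
    unfolding ord_def by (rule two_digit_less) (use idx_less that in auto)
  have ord_inj: "b = b'" if "ord b = ord b'" "b \<in> B" "b' \<in> B" for b b'
  proof -
    have "idx b = idx b'"
      using ord_less[of b b'] ord_less[of b' b] that by (metis less_irrefl linorder_neqE_nat)
    then show ?thesis using idx that by (auto simp: bij_betw_def inj_on_def)
  qed
  \<comment> \<open>The binary code of \<open>A\<close> drops by \<open>2\<^sup>a\<close> when \<open>a\<close> is removed, so removing a common element preserves the order.\<close>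
  define key where "key = (\<lambda>(b, A). ord b * 2 ^ m + set_encode A)"
  define labels where "labels k = {(b, A). b \<in> B \<and> A \<subseteq> {..<lev b} \<and> card A = k}" for k
  define \<psi> where "\<psi> = (\<lambda>(b, A) v. coord b (d_set A v))"
  have code_less: "set_encode A < 2 ^ m" if "(b, A) \<in> labels k" for b A k
    using that B(3) by (intro set_encode_bound) (fastforce simp: labels_def)
  have fin: "finite A" if "(b, A) \<in> labels k" for b A k
    using that finite_subset by (auto simp: labels_def)
  have key_less: "key (b, A) < key (b', A') \<longleftrightarrow> ord b < ord b' \<or> ord b = ord b' \<and> set_encode A < set_encode A'"
    if "(b, A) \<in> labels k" "(b', A') \<in> labels k'" for b A b' A' k k'
    unfolding key_def prod.case by (rule two_digit_less) (use code_less that in auto)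
  have finite_labels: "finite (labels k)" for k
    by (rule finite_subset[of _ "Sigma B (\<lambda>b. Pow {..<lev b})"]) (auto simp: labels_def B(1))
  have inj_key: "inj_on key (labels k)" for k
  proof (rule inj_onI)
    fix x x' assume x: "x \<in> labels k" "x' \<in> labels k" "key x = key x'"
    obtain b A b' A' where eq: "x = (b, A)" "x' = (b', A')" by force
    have "ord b = ord b'" "set_encode A = set_encode A'"
      using key_less[of b A k b' A' k] key_less[of b' A' k b A k] x unfolding eq
      by (metis less_irrefl linorder_neqE_nat)+
    moreover have "b \<in> B" "b' \<in> B" using x by (auto simp: eq labels_def)
    ultimately have "b = b'" "A = A'"
      using ord_inj fin[of b A k] fin[of b' A' k] x unfolding eq by (auto simp: set_encode_inf dest: set_encode_eq[THEN iffD1, rotated 2])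
    then show "x = x'" by (simp add: eq)
  qed
  have dset0: "d_set A v \<in> E 0" if "v \<in> E k" "(b, A) \<in> labels k" for v k b A
    using d_set_E[of A v 0] that fin[OF that(2)] by (simp add: labels_def)
  have \<psi>_add: "\<psi> x (v + w) = \<psi> x v + \<psi> x w" if "x \<in> labels k" "v \<in> E k" "w \<in> E k" for x v w k
  proof -
    obtain b A where x: "x = (b, A)" by force
    show ?thesis
      using dset0[of v k b A] dset0[of w k b A] that spanB
      unfolding x \<psi>_def coord_def by (simp add: ds.add representation_add[OF B(2)])
  qed
  have \<psi>_scale: "\<psi> x (scale c v) = c * \<psi> x v" if "x \<in> labels k" "v \<in> E k" for x v c k
  proof -
    obtain b A where x: "x = (b, A)" by force
    show ?thesis
      using dset0[of v k b A] that spanB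
      unfolding x \<psi>_def coord_def by (simp add: ds.scale representation_scale[OF B(2)])
  qed
  have in_flag: "d_set A v \<in> flag j"
    if "v \<in> E k" "\<And>b A. (b, A) \<in> labels k \<Longrightarrow> lev b < j \<Longrightarrow> \<psi> (b, A) v = 0" "j \<le> Suc m"
      "A \<subseteq> {..<min j m}" "card A = k" for v k j A
    using that(2-)
  proof (induction j arbitrary: A)
    case 0
    then show ?case using that(1) by (simp add: flag_0)
  next
    case (Suc j)
    have step: "d_set A v \<in> flag (Suc j)" if A: "A \<subseteq> {..<j}" "card A = k" for A
    proof (rule flag_coord)
      have A': "A \<subseteq> {..<min j m}" using A Suc.prems(2) by auto
      have finA: "finite A" using A(1) finite_subset by blast
      show "d_set A v \<in> E 0" using d_set_E[OF finA, of v 0] A(2) \<open>v \<in> E k\<close> by simp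
      fix b assume b: "b \<in> B" "lev b < Suc j"
      show "coord b (d_set A v) = 0"
      proof (cases "lev b = j")
        case True
        then have "(b, A) \<in> labels k" using A b by (simp add: labels_def)
        then show ?thesis using Suc.prems(1)[of b A] b by (simp add: \<psi>_def)
      next
        case False
        have "d_set A v \<in> flag j" using Suc.IH[of A] Suc.prems(1,2) A' A(2) by simp
        then show ?thesis using coord_flag[of _ j b] b False Suc.prems(2) by simp
      qed
    qed (use Suc.prems(2) in simp)
    show ?case
      by (rule flag_extend[OF \<open>v \<in> E k\<close> step]) (use Suc.prems(3,4) in auto)
  qed
  have inj: "v = 0" if "v \<in> E k" "\<And>x. x \<in> labels k \<Longrightarrow> \<psi> x v = 0" for v k
  proof (rule d_set_injective[OF that(1)])
    fix A assume "A \<subseteq> {..<m}" "card A = k"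
    then show "d_set A v = 0"
      using in_flag[of v k "Suc m" A] that flag_top by auto
  qed
  have dim_leading: "dim V = card (leading (labels k) key \<psi> V)" if V: "subspace V" "V \<subseteq> E k" for V k
  proof (rule dim_eq_card_leading[where \<psi> = \<psi> and key = key])
    show "finite (labels k)" "inj_on key (labels k)" by (rule finite_labels inj_key)+
    show "v = 0" if "v \<in> V" "\<And>x. x \<in> labels k \<Longrightarrow> \<psi> x v = 0" for v
      using inj[of v k] that V(2) by blast
  qed (use V \<psi>_add \<psi>_scale in \<open>blast+\<close>)
  have split: "card S = (\<Sum>b\<in>B. card {A. (b, A) \<in> S})" if "S \<subseteq> labels k" for S k
  proof -
    have S_eq: "S = Sigma B (\<lambda>b. {A. (b, A) \<in> S})" using that by (auto simp: labels_def)
    have "finite {A. (b, A) \<in> S}" for b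
      by (rule finite_subset[of _ "Pow {..<lev b}"]) (use that in \<open>auto simp: labels_def\<close>)
    then have "card (Sigma B (\<lambda>b. {A. (b, A) \<in> S})) = (\<Sum>b\<in>B. card {A. (b, A) \<in> S})"
      using B(1) by (intro card_SigmaI) auto
    then show ?thesis using S_eq by (rule trans[OF arg_cong[of _ _ card], rotated])
  qed
  have closed: "(b, A - {a}) \<in> leading (labels k) key \<psi> (V k)"
    if V: "\<And>k. V k \<subseteq> E k" "\<And>k i v. v \<in> V (Suc k) \<Longrightarrow> d i v \<in> V k"
      and lead: "(b, A) \<in> leading (labels (Suc k)) key \<psi> (V (Suc k))" and a: "a \<in> A" for V b A a k
  proof -
    from lead obtain v where v: "(b, A) \<in> labels (Suc k)" "v \<in> V (Suc k)" "\<psi> (b, A) v \<noteq> 0"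
      "\<And>y. y \<in> labels (Suc k) \<Longrightarrow> key y < key (b, A) \<Longrightarrow> \<psi> y v = 0" by (auto simp: leading_def)
    have vE: "v \<in> E (Suc k)" using v(2) V(1) by blast
    have bA: "b \<in> B" "A \<subseteq> {..<lev b}" "card A = Suc k" "finite A" using v(1) fin[OF v(1)] by (auto simp: labels_def)
    have lab: "(b, A - {a}) \<in> labels k"
      using bA a by (auto simp: labels_def card_Diff_singleton)
    have coord_pm: "coord b' w = 0 \<longleftrightarrow> coord b' w' = 0" if "pm w w'" "w \<in> E 0" for b' w w'
    proof (cases "w = w'")
      case False
      then have w': "w' = - w" using that(1) by (simp add: pm_def)
      show ?thesis
        unfolding w' coord_def using representation_neg[OF B(2), of w] that(2) spanB by simp
    qed simp
    have shift: "\<psi> (b', A') (d a v) = 0 \<longleftrightarrow> coord b' (d_set (insert a A') v) = 0"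
      if "(b', A') \<in> labels k" "a \<notin> A'" for b' A'
      unfolding \<psi>_def prod.case
      by (rule coord_pm[OF d_set_d]) (use that fin[OF that(1)] dset0[OF d_E[OF vE] that(1)] in auto)
    have "\<psi> (b, A - {a}) (d a v) \<noteq> 0"
      using shift[OF lab] v(3) a by (simp add: \<psi>_def insert_absorb)
    moreover have "\<psi> y (d a v) = 0" if y: "y \<in> labels k" "key y < key (b, A - {a})" for y
    proof -
      obtain b' A' where y_eq: "y = (b', A')" by force
      have y': "b' \<in> B" "A' \<subseteq> {..<lev b'}" "card A' = k" "finite A'"
        using y(1) fin[OF y(1)[unfolded y_eq]] by (auto simp: labels_def y_eq)
      show ?thesis
      proof (cases "a \<in> A'")
        case True
        then show ?thesis
          using d_set_d_zero[OF y'(4) True, of v] by (simp add: y_eq \<psi>_def coord_def representation_zero)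
      next
        case False
        have cases: "ord b' < ord b \<or> ord b' = ord b \<and> set_encode A' < set_encode (A - {a})"
          using y(2) key_less[OF y(1)[unfolded y_eq] lab] unfolding y_eq by auto
        have "coord b' (d_set (insert a A') v) = 0"
        proof (cases "lev b' = lev b")
          case True
          have lab': "(b', insert a A') \<in> labels (Suc k)"
            using y' bA a True False by (auto simp: labels_def)
          have "set_encode A = 2 ^ a + set_encode (A - {a})"
            using bA(4) a by (metis Diff_iff finite_Diff insertI1 insert_Diff set_encode_insert)
          moreover have "set_encode (insert a A') = 2 ^ a + set_encode A'"
            using y'(4) False by (rule set_encode_insert)
          ultimately have "key (b', insert a A') < key (b, A)"
            using cases key_less[OF lab' v(1)] by auto
          then show ?thesis using v(4)[OF lab'] by (simp add: \<psi>_def)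
        next
          case False
          then have less: "lev b' < lev b" using cases ord_less[of b' b] ord_less[of b b'] y'(1) bA(1)
            by (metis less_irrefl linorder_neqE_nat ord_inj)
          have "d_set (insert a A') v \<in> flag (lev b)"
          proof (rule in_flag[OF vE])
            show "\<psi> (c, C) v = 0" if "(c, C) \<in> labels (Suc k)" "lev c < lev b" for c C
            proof -
              have "c \<in> B" using that by (simp add: labels_def)
              then have "key (c, C) < key (b, A)"
                using that key_less[OF that(1) v(1)] ord_less[of c b] bA(1) by simp
              then show ?thesis using v(4)[OF that(1)] by simp
            qed
            show "lev b \<le> Suc m" using B(3)[OF bA(1)] by simp
            show "insert a A' \<subseteq> {..<min (lev b) m}"
              using y'(2) less a bA(2) B(3)[OF bA(1)] by auto
            show "card (insert a A') = Suc k" using y' \<open>a \<notin> A'\<close> by simp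
          qed
          then show ?thesis using coord_flag[OF _ less] B(3)[OF bA(1)] by simp
        qed
        then show ?thesis using shift[of b' A'] y(1) False unfolding y_eq by blast
      qed
    qed
    ultimately show ?thesis
      using lab V(2)[OF v(2)] by (auto simp: leading_def)
  qed
  show thesis
  proof (rule that[OF B(1,3)])
    fix k
    have "leading (labels k) key \<psi> (E k) = labels k"
    proof
      show "labels k \<subseteq> leading (labels k) key \<psi> (E k)"
      proof (clarify)
        fix b A assume lab: "(b, A) \<in> labels k"
        then have bA: "b \<in> B" "A \<subseteq> {..<lev b}" "card A = k" "finite A" using fin[OF lab] by (auto simp: labels_def)
        have "b \<in> flag (lev b)"
          using flag[of "lev b"] span_base[of b "{c \<in> B. lev b \<le> lev c}"] bA(1) B(3)[OF bA(1)] by simp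
        then obtain w where w: "w \<in> E (lev b)" "b = d_set {..<lev b} w"
          by (auto simp: flag_def d_set_atMost)
        \<comment> \<open>An element with leading label \<open>(b, A)\<close>: write \<open>b\<close> as the full product below its level and omit the factors in \<open>A\<close>.\<close>
        define C where "C = {..<lev b} - A"
        have C: "finite C" "A \<inter> C = {}" "A \<union> C = {..<lev b}" "card C + k = lev b"
          using bA card_Diff_subset[OF bA(4,2)] card_mono[OF _ bA(2)] by (auto simp: C_def)
        have vE: "d_set C w \<in> E k" using C w(1) by (intro d_set_E) auto
        have AC: "pm (d_set A (d_set C w)) b"
          using d_set_union[OF bA(4) C(1,2), of w] w(2) C(3) by simp
        have coord_basis: "coord c b = (if c = b then 1 else 0)" for c
          using representation_basis[OF B(2) bA(1)] by (simp add: coord_def)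
        have coord_uminus: "coord c (- b) = - coord c b" for c
          using representation_neg[OF B(2), of b] span_base[OF bA(1)] by (simp add: coord_def)
        have ACc: "coord c (d_set A (d_set C w)) = 0 \<longleftrightarrow> c \<noteq> b" for c
          using AC[unfolded pm_def]
        proof
          assume eq: "d_set A (d_set C w) = b"
          show ?thesis unfolding eq coord_basis by simp
        next
          assume eq: "d_set A (d_set C w) = - b"
          show ?thesis unfolding eq coord_uminus coord_basis by simp
        qed
        have nz: "\<psi> (b, A) (d_set C w) \<noteq> 0"
          using ACc[of b] by (simp add: \<psi>_def)
        have "\<psi> y (d_set C w) = 0" if y: "y \<in> labels k" "key y < key (b, A)" for y
        proof -
          obtain b' A' where y_eq: "y = (b', A')" by force
          have y': "b' \<in> B" "A' \<subseteq> {..<lev b'}" "card A' = k" "finite A'"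
            using y(1) fin[OF y(1)[unfolded y_eq]] by (auto simp: labels_def y_eq)
          have "ord b' \<le> ord b" using y(2) key_less[OF y(1)[unfolded y_eq] lab] unfolding y_eq by auto
          then have "lev b' \<le> lev b" using ord_less[OF bA(1) y'(1)] by (meson not_le)
          then have A': "A' \<subseteq> {..<lev b}" using y'(2) by auto
          show ?thesis
          proof (cases "A' \<inter> C = {}")
            case True
            then have "A' \<subseteq> A" using A' C(3) by blast
            then have "A' = A" using y'(3) bA(3) by (intro card_subset_eq[OF bA(4)]) auto
            moreover from this have "b' \<noteq> b" using y(2) by (auto simp: y_eq)
            ultimately show ?thesis
              using ACc[of b'] by (simp add: y_eq \<psi>_def)
          next
            case False
            then show ?thesis
              using d_set_d_set_zero[OF y'(4) C(1)] by (auto simp: y_eq \<psi>_def coord_def representation_zero)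
          qed
        qed
        then show "(b, A) \<in> leading (labels k) key \<psi> (E k)"
          using lab vE nz by (auto simp: leading_def)
      qed
    qed (auto simp: leading_def)
    then have "dim (E k) = card (labels k)"
      using dim_leading[OF subspace_E order_refl] by simp
    also have "\<dots> = (\<Sum>b\<in>B. card {A. A \<subseteq> {..<lev b} \<and> card A = k})"
      unfolding split[OF order_refl] by (intro sum.cong refl arg_cong[of _ _ card]) (auto simp: labels_def)
    also have "\<dots> = (\<Sum>b\<in>B. lev b choose k)"
      by (simp add: n_subsets)
    finally show "dim (E k) = (\<Sum>b\<in>B. lev b choose k)" .
  next
    fix V assume V: "\<And>k. subspace (V k)" "\<And>k. V k \<subseteq> E k" "\<And>k i v. v \<in> V (Suc k) \<Longrightarrow> d i v \<in> V k"
    define \<Delta> where "\<Delta> b = {A. (b, A) \<in> leading (labels (card A)) key \<psi> (V (card A))}" for b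
    have "A \<subseteq> {..<lev b} \<and> (\<forall>a\<in>A. A - {a} \<in> \<Delta> b)" if "A \<in> \<Delta> b" for b A
    proof -
      have lab: "(b, A) \<in> labels (card A)" using that by (auto simp: \<Delta>_def leading_def)
      have "A - {a} \<in> \<Delta> b" if a: "a \<in> A" for a
      proof -
        have "card A = Suc (card (A - {a}))" using card_Suc_Diff1[OF fin[OF lab] a] by simp
        then show ?thesis
          using closed[OF V(2,3), of b A "card (A - {a})" a] \<open>A \<in> \<Delta> b\<close> a by (simp add: \<Delta>_def)
      qed
      then show ?thesis using lab by (auto simp: labels_def)
    qed
    moreover have "dim (V k) = (\<Sum>b\<in>B. card {A \<in> \<Delta> b. card A = k})" for k
    proof -
      have "leading (labels k) key \<psi> (V k) \<subseteq> labels k" by (auto simp: leading_def)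
      from split[OF this] show ?thesis
        unfolding dim_leading[OF V(1,2)]
        by (simp, intro sum.cong refl arg_cong[of _ _ card]) (auto simp: \<Delta>_def leading_def labels_def)
    qed
    ultimately show "\<exists>\<Delta>. (\<forall>b\<in>B. \<forall>A\<in>\<Delta> b. A \<subseteq> {..<lev b} \<and> (\<forall>a\<in>A. A - {a} \<in> \<Delta> b)) \<and>
        (\<forall>k. dim (V k) = (\<Sum>b\<in>B. card {A \<in> \<Delta> b. card A = k}))"
      by (intro exI[of _ \<Delta>]) blast
  qed
qed

end

section \<open>The Eagon--Northcott space over the field of rational functions\<close>

lemma comm_ring_hom_to_fract: "comm_ring_hom (to_fract :: 'a::idom \<Rightarrow> 'a fract)"
  by standard simp_all

lemma contract_cong:
  assumes "\<And>j s. j < p \<Longrightarrow> s < q \<Longrightarrow> A j s = B j s"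
  shows "contract p q A v = contract p q B v"
  using assms by (auto simp: contract_def fun_eq_iff intro!: sum.cong)

abbreviation (input) fun_scale :: "'f::field \<Rightarrow> ('b \<Rightarrow> 'f) \<Rightarrow> 'b \<Rightarrow> 'f" where
  "fun_scale c v \<equiv> (\<lambda>b. c * v b)"

lemma vector_space_fun_scale: "vector_space (fun_scale :: 'f::field \<Rightarrow> ('b \<Rightarrow> 'f) \<Rightarrow> _)"
  by standard (auto simp: fun_eq_iff algebra_simps)

interpretation fs: vector_space "fun_scale :: 'f::field \<Rightarrow> ('b \<Rightarrow> 'f) \<Rightarrow> _"
  by (rule vector_space_fun_scale)

lemma subspace_en_space: "fs.subspace (en_space p q k)"
  by (auto simp: fs.subspace_def en_space_def)

lemma en_space_basis:
  "\<exists>B. finite B \<and> fs.independent B \<and> fs.span B = (en_space p q k :: (_ \<Rightarrow> 'f::field) set) \<and>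
    card B = card (en_labels p q k)"
proof -
  let ?S = "en_labels p q k" and ?\<psi> = "\<lambda>b (v :: nat multiset \<times> nat set \<Rightarrow> 'f). v b"
  obtain key :: "nat multiset \<times> nat set \<Rightarrow> nat" where key: "inj_on key ?S"
    using finite_imp_inj_to_nat_seg[OF finite_en_labels] by blast
  have "\<exists>B. finite B \<and> fs.independent B \<and> fs.span B = (en_space p q k :: (_ \<Rightarrow> 'f) set) \<and>
      card B = card (leading ?S key ?\<psi> (en_space p q k))"
  proof (rule fs.basis_card_leading[where \<psi> = ?\<psi> and key = key])
    show "v = 0" if "v \<in> en_space p q k" "\<And>x. x \<in> ?S \<Longrightarrow> v x = 0" for v :: "_ \<Rightarrow> 'f"
      using that by (auto simp: en_space_def fun_eq_iff)
  qed (auto simp: key subspace_en_space)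
  moreover have "leading ?S key ?\<psi> (en_space p q k) = ?S"
  proof
    show "?S \<subseteq> leading ?S key ?\<psi> (en_space p q k)"
    proof
      fix b assume b: "b \<in> ?S"
      let ?e = "\<lambda>c. if c = b then 1 else 0 :: 'f"
      have "?e \<in> en_space p q k" using b by (auto simp: en_space_def)
      then show "b \<in> leading ?S key ?\<psi> (en_space p q k)"
        unfolding leading_def using b by (intro CollectI conjI bexI[of _ ?e]) auto
    qed
  qed (auto simp: leading_def)
  ultimately show ?thesis by simp
qed

lemma common_denominator:
  fixes v :: "'b \<Rightarrow> 'a::idom fract"
  assumes "finite S"
  shows "\<exists>g. g \<noteq> 0 \<and> (\<forall>b\<in>S. \<exists>a. to_fract g * v b = to_fract a)"
  using assms
proof (induction S)
  case empty
  then show ?case by (intro exI[of _ 1]) auto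
next
  case (insert x S)
  interpret comm_ring_hom "to_fract :: 'a \<Rightarrow> _" by (rule comm_ring_hom_to_fract)
  obtain g where g: "g \<noteq> 0" "\<And>b. b \<in> S \<Longrightarrow> \<exists>a. to_fract g * v b = to_fract a" using insert.IH by blast
  obtain a c where ac: "v x = Fract a c" "c \<noteq> 0" by (cases "v x")
  then have x: "to_fract c * v x = to_fract a"
    by (simp add: to_fract_def eq_fract)
  have "\<exists>a. to_fract (g * c) * v b = to_fract a" if "b \<in> insert x S" for b
  proof (cases "b = x")
    case True
    have "to_fract (g * c) * v x = to_fract (g * a)" by (simp add: hom_mult x mult.assoc)
    then show ?thesis using True by blast
  next
    case False
    then obtain a' where "to_fract g * v b = to_fract a'" using g(2)[of b] \<open>b \<in> insert x S\<close> by auto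
    then have "to_fract (g * c) * v b = to_fract (c * a')" by (simp add: hom_mult mult_ac)
    then show ?thesis by blast
  qed
  then show ?case using g(1) ac(2) by (intro exI[of _ "g * c"]) simp
qed

lemma en_labels_top: "q < p + k \<Longrightarrow> en_labels p q k = {}"
proof -
  assume "q < p + k"
  show ?thesis
  proof (rule equals0I)
    fix x assume "x \<in> en_labels p q k"
    then have "snd x \<subseteq> {..<q}" "card (snd x) = p + k" by (auto simp: en_labels_def)
    then show False using card_mono[of "{..<q}" "snd x"] \<open>q < p + k\<close> by simp
  qed
qed

context generic_points
begin

definition D :: "nat \<Rightarrow> (nat multiset \<times> nat set \<Rightarrow> 'k mpoly fract) \<Rightarrow> nat multiset \<times> nat set \<Rightarrow> 'k mpoly fract" where
  "D i = contract p q (\<lambda>j s. to_fract (generic_matrix supp coef (y i) j s))"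

lemma to_fract_d: "to_fract (d i v b) = D i (\<lambda>b. to_fract (v b)) b"
  unfolding d_def D_def by (rule contract_hom[OF comm_ring_hom_to_fract])

text \<open>Regularity over the polynomial ring carries over to its field of fractions by clearing denominators.\<close>

lemma D_regular:
  assumes k: "k \<ge> 1" and v: "v \<in> en_space p q k" and ker: "\<And>i. i \<le> r \<Longrightarrow> D i v = 0"
  shows "\<exists>w\<in>en_space p q (Suc k). (\<forall>i<r. D i w = 0) \<and> v = D r w"
proof -
  obtain g where g: "g \<noteq> 0" "\<forall>b\<in>en_labels p q k. \<exists>a. to_fract g * v b = to_fract a"
    using common_denominator[of "en_labels p q k" v] by auto
  have "\<forall>b. \<exists>a. to_fract g * v b = to_fract a \<and> (b \<notin> en_labels p q k \<longrightarrow> a = 0)"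
  proof
    fix b show "\<exists>a. to_fract g * v b = to_fract a \<and> (b \<notin> en_labels p q k \<longrightarrow> a = 0)"
    proof (cases "b \<in> en_labels p q k")
      case False
      then have "v b = 0" using v by (cases b) (simp add: en_space_def)
      then show ?thesis by (intro exI[of _ 0]) simp
    qed (use g(2) in blast)
  qed
  then have "\<exists>u. \<forall>b. to_fract g * v b = to_fract (u b) \<and> (b \<notin> en_labels p q k \<longrightarrow> u b = 0)"
    by (rule choice)
  then obtain u where u: "\<And>b. to_fract g * v b = to_fract (u b)" "u \<in> en_space p q k"
    by (auto simp: en_space_def)
  have "d i u = (\<lambda>b. 0)" if "i \<le> r" for i
  proof
    fix b
    have "to_fract (d i u b) = to_fract g * D i v b"
      unfolding to_fract_d u(1)[symmetric] by (simp add: D_def contract_scale)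
    then show "d i u b = 0" using ker[OF that] by simp
  qed
  then obtain w where w: "w \<in> joint_kernel r (Suc k)" "u = d r w"
    using joint_kernel_exact[of r r k u] k u(2) by (auto simp: joint_kernel_def)
  define w' where "w' b = inverse (to_fract g) * to_fract (w b)" for b
  have D_w': "D i w' b = inverse (to_fract g) * to_fract (d i w b)" for i b
    unfolding w'_def[abs_def] to_fract_d by (simp add: D_def contract_scale)
  have "w' \<in> en_space p q (Suc k)" using w(1) by (simp add: joint_kernel_def en_space_def w'_def)
  moreover have "D i w' = 0" if "i < r" for i
    using that w(1) by (intro ext) (simp add: D_w' joint_kernel_def)
  moreover have "v = D r w'"
    using g(1) u(1) by (intro ext) (simp add: D_w' w(2)[symmetric] field_simps flip: u(1))
  ultimately show ?thesis by blast
qed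

lemma regular_operators_D:
  assumes "p \<le> q"
  shows "regular_operators fun_scale (en_space p q) D (q - p)"
proof (intro regular_operators.intro vector_space_fun_scale regular_operators_axioms.intro)
  fix k i j r and v :: "nat multiset \<times> nat set \<Rightarrow> 'k mpoly fract"
  show "fs.subspace (en_space p q k)" by (rule subspace_en_space)
  show "Vector_Spaces.linear fun_scale fun_scale (D i)"
    unfolding D_def by unfold_locales (auto simp: contract_scale contract_add plus_fun_def)
  show "D i v \<in> en_space p q k" if "v \<in> en_space p q (Suc k)"
    using that unfolding D_def by (rule contract_en_space)
  show "D i (D i v) = 0" by (simp add: D_def zero_fun_def)
  show "D i (D j v) = - D j (D i v)"
    unfolding D_def by (subst contract_anticommute) (simp add: fun_Compl_def)
  show "v = 0" if "q - p < k" "v \<in> en_space p q k"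
    using that assms by (auto simp: en_space_def en_labels_top fun_eq_iff)
  show "\<exists>w\<in>en_space p q (Suc k). (\<forall>i<r. D i w = 0) \<and> v = D r w"
    if "1 \<le> k" "v \<in> en_space p q k" "\<And>i. i \<le> r \<Longrightarrow> D i v = 0"
    using that by (rule D_regular)
  show "\<exists>B. finite B \<and> en_space p q k \<subseteq> fs.span B"
    using en_space_basis[of p q k] by blast
qed

end

section \<open>Face numbers are rank sequences of Koszul subcomplexes\<close>

definition koszul_entry :: "nat set \<Rightarrow> nat set \<Rightarrow> 'k::field mpoly" where
  "koszul_entry b c = (\<Sum>s\<in>c. if b = c - {s} then (-1) ^ card {t \<in> c. t \<le> s} * mvar s else 0)"

lemma diff_koszul: "diff (koszul m) i b c = koszul_entry b c"
  by (simp add: koszul_def koszul_entry_def)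

lemma basis_koszul: "basis (koszul m) i = {T. T \<subseteq> {..<m} \<and> card T = i}"
  by (simp add: koszul_def)

lemma koszul_sign:
  assumes "finite c" "s \<in> c"
  shows "(-1) ^ card {t \<in> c. t \<le> s} = - (insert_sign (c - {s}) s :: 'a::comm_ring_1)"
proof -
  have "{t \<in> c. t \<le> s} = insert s {t \<in> c - {s}. t < s}" using assms by auto
  then show ?thesis using assms by (simp add: insert_sign_def)
qed

lemma koszul_entry_carrier:
  assumes "c \<subseteq> {..<n}"
  shows "koszul_entry b c \<in> carrier (mpoly_ring n)"
  unfolding koszul_entry_def
proof (rule mpoly_ring_sum)
  fix s assume s: "s \<in> c"
  have "mvar s \<in> carrier (mpoly_ring n)"
    using assms s by (auto simp: mem_mpoly_ring mvar_def)
  moreover have "(-1) ^ k \<in> carrier (mpoly_ring n)" for k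
    by (cases "even k") (auto simp: mem_mpoly_ring)
  ultimately show "(if b = c - {s} then (-1) ^ card {t \<in> c. t \<le> s} * mvar s else 0) \<in> carrier (mpoly_ring n)"
    by (auto intro: mpoly_ring_mult mpoly_ring_zero)
qed

text \<open>Stated for an arbitrary set of intermediate faces, so that it serves the Koszul complex and its subcomplexes alike.\<close>

lemma koszul_square:
  assumes fin: "finite D" "finite c" and D: "\<And>s. s \<in> c \<Longrightarrow> c - {s} \<in> D" "\<And>b. b \<in> D \<Longrightarrow> finite b"
  shows "(\<Sum>b\<in>D. koszul_entry a b * koszul_entry b c) = (0 :: 'k::field mpoly)"
proof -
  define G where "G s t = (if a = c - {s} - {t} then
      insert_sign (c - {s} - {t}) t * insert_sign (c - {s}) s * (mvar s * mvar t) else (0 :: 'k mpoly))" for s t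
  have "(\<Sum>b\<in>D. koszul_entry a b * koszul_entry b c) =
      (\<Sum>b\<in>D. \<Sum>s\<in>c. if b = c - {s} then koszul_entry a b * (- insert_sign (c - {s}) s * mvar s) else 0 :: 'k mpoly)"
    unfolding koszul_entry_def[of _ c] sum_distrib_left
    by (intro sum.cong refl) (simp add: koszul_sign[OF fin(2)])
  also have "\<dots> = (\<Sum>s\<in>c. \<Sum>b\<in>D. if b = c - {s} then koszul_entry a b * (- insert_sign (c - {s}) s * mvar s) else 0)"
    by (rule sum.swap)
  also have "\<dots> = (\<Sum>s\<in>c. koszul_entry a (c - {s}) * (- insert_sign (c - {s}) s * mvar s))"
    by (intro sum.cong refl) (simp add: fin(1) D(1))
  also have "\<dots> = (\<Sum>s\<in>c. \<Sum>t\<in>c - {s}. G s t)"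
  proof (intro sum.cong refl)
    fix s assume s: "s \<in> c"
    show "koszul_entry a (c - {s}) * (- insert_sign (c - {s}) s * mvar s) = (\<Sum>t\<in>c - {s}. G s t)"
      unfolding koszul_entry_def sum_distrib_right
    proof (intro sum.cong refl)
      fix t assume t: "t \<in> c - {s}"
      have "finite (c - {s})" using fin(2) by simp
      note sign = koszul_sign[OF this t, where 'a = "'k mpoly"]
      show "(if a = c - {s} - {t} then (- 1) ^ card {u \<in> c - {s}. u \<le> t} * mvar t else 0) *
          (- insert_sign (c - {s}) s * mvar s) = G s t"
        unfolding sign G_def by (simp add: mult_ac)
    qed
  qed
  also have "\<dots> = 0"
  proof (rule antisymmetric_sum_zero[OF fin(2)])
    fix s t assume st: "s \<in> c" "t \<in> c" "s \<noteq> t"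
    define R where "R = c - {s} - {t}"
    have R: "c - {t} - {s} = R" "c - {s} = insert t R" "c - {t} = insert s R" "s \<notin> R" "t \<notin> R"
      using st by (auto simp: R_def)
    have "insert_sign R t * insert_sign (insert t R) s = - (insert_sign R s * insert_sign (insert s R) t :: 'k mpoly)"
      by (rule insert_sign_swap) (use R st in auto)
    then show "G s t = - G t s"
      unfolding G_def unfolding R_def[symmetric] R(1) unfolding R(2,3) by (simp add: mult.commute[of "mvar s"])
  qed
  finally show ?thesis .
qed

lemma mconst_0 [simp]: "mconst 0 = 0" and mconst_1 [simp]: "mconst 1 = 1"
  by (simp_all add: mconst_def)

text \<open>A simplicial complex spans a subcomplex of the Koszul complex on its vertices.\<close>

theorem face_numbers_in_RS_koszul:
  fixes \<Delta> :: "nat set set"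
  assumes vertices: "\<And>A. A \<in> \<Delta> \<Longrightarrow> A \<subseteq> {..<m}" and closed: "\<And>A a. A \<in> \<Delta> \<Longrightarrow> a \<in> A \<Longrightarrow> A - {a} \<in> \<Delta>"
    and n: "m \<le> n"
  shows "(\<lambda>k. card {A \<in> \<Delta>. card A = k}) \<in> RS n (koszul m :: (nat set, 'k::field mpoly) cplx)"
proof -
  let ?K = "koszul m :: (nat set, 'k mpoly) cplx"
  define face where "face d = {A \<in> \<Delta>. card A = d}" for d
  \<comment> \<open>Faces are encoded as natural numbers because these label the bases of subcomplexes.\<close>
  define F :: "(nat, 'k mpoly) cplx" where
    "F = \<lparr>basis = (\<lambda>d. set_encode ` face d), diff = (\<lambda>d b c. koszul_entry (set_decode b) (set_decode c))\<rparr>"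
  have F: "basis F d = set_encode ` face d" "diff F d b c = koszul_entry (set_decode b) (set_decode c)" for d b c
    by (simp_all add: F_def)
  have finite_face: "finite A" if "A \<in> face d" for A d
    using that vertices finite_subset by (auto simp: face_def)
  have decode: "set_decode (set_encode A) = A" if "A \<in> face d" for A d
    using finite_face[OF that] by simp
  have inj: "inj_on set_encode (face d)" for d
    by (rule inj_on_inverseI[of _ set_decode]) (rule decode)
  have finite_faces: "finite (face d)" for d
    by (rule finite_subset[of _ "Pow {..<m}"]) (auto simp: face_def dest: vertices)
  have face_K: "face d \<subseteq> basis ?K d" for d
    using vertices by (auto simp: face_def basis_koszul)
  have finite_K: "finite (basis ?K d)" for d
    by (rule finite_subset[of _ "Pow {..<m}"]) (auto simp: basis_koszul)
  have sumF: "(\<Sum>b\<in>basis F d. f (set_decode b)) = (\<Sum>A\<in>face d. f A)" for f :: "nat set \<Rightarrow> 'k mpoly" and d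
    unfolding F sum.reindex[OF inj] comp_def by (intro sum.cong refl) (simp add: decode)
  have carr: "koszul_entry b c \<in> carrier (mpoly_ring n)" if "c \<subseteq> {..<m}" for b c
    using that n by (intro koszul_entry_carrier) auto
  have free_K: "free_complex n ?K"
    unfolding free_complex_def diff_koszul
  proof (intro conjI allI ballI)
    fix i a c assume "a \<in> basis ?K i" and c: "c \<in> basis ?K (Suc (Suc i))"
    have "finite c" using c finite_subset by (auto simp: basis_koszul)
    then show "(\<Sum>b\<in>basis ?K (Suc i). koszul_entry a b * koszul_entry b c) = (0 :: 'k mpoly)"
      using c by (intro koszul_square finite_K) (auto simp: basis_koszul intro: finite_subset)
  qed (auto simp: finite_K basis_koszul intro: carr)
  have free_F: "free_complex n F"
    unfolding free_complex_def
  proof (intro conjI allI ballI)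
    fix i a c assume "a \<in> basis F i" and c: "c \<in> basis F (Suc (Suc i))"
    then obtain A where A: "c = set_encode A" "A \<in> face (Suc (Suc i))" by (auto simp: F)
    have "(\<Sum>b\<in>basis F (Suc i). koszul_entry (set_decode a) (set_decode b) * koszul_entry (set_decode b) A)
       = (\<Sum>b\<in>face (Suc i). koszul_entry (set_decode a) b * koszul_entry b A :: 'k mpoly)"
      by (rule sumF)
    also have "\<dots> = 0"
    proof (rule koszul_square[OF finite_faces finite_face[OF A(2)]])
      show "A - {s} \<in> face (Suc i)" if "s \<in> A" for s
        using A(2) closed[of A s] that finite_face[OF A(2)] by (simp add: face_def)
    qed (rule finite_face)
    finally show "(\<Sum>b\<in>basis F (Suc i). diff F i a b * diff F (Suc i) b c) = 0"
      unfolding F(2) A(1) decode[OF A(2)] .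
  next
    fix i show "finite (basis F i)" by (simp add: F finite_faces)
    fix b c assume "c \<in> basis F (Suc i)"
    then have "set_decode c \<subseteq> {..<m}" using decode vertices by (auto simp: F face_def)
    then show "diff F i b c \<in> carrier (mpoly_ring n)" unfolding F(2) by (rule carr)
  qed
  define \<phi> :: "nat \<Rightarrow> nat set \<Rightarrow> nat \<Rightarrow> 'k" where "\<phi> i b c = (if b = set_decode c then 1 else 0)" for i b c
  have decode_K: "set_decode c \<in> basis ?K i" if "c \<in> basis F i" for c i
  proof -
    from that obtain A where "c = set_encode A" "A \<in> face i" by (auto simp: F)
    then show ?thesis using decode[of A i] face_K[of i] by auto
  qed
  have "subcomplex n F ?K"
    unfolding subcomplex_def
  proof (intro conjI free_F free_K exI[of _ \<phi>] allI ballI)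
    fix i
    show "split_injective n (basis ?K i) (basis F i) (\<lambda>b c. mconst (\<phi> i b c))"
      unfolding split_injective_def
    proof (intro conjI ballI exI[of _ "\<lambda>c b. mconst (\<phi> i b c)"])
      fix c c' assume cc: "c \<in> basis F i" "c' \<in> basis F i"
      have "(\<Sum>b\<in>basis ?K i. mconst (\<phi> i b c) * mconst (\<phi> i b c')) =
         (\<Sum>b\<in>basis ?K i. if b = set_decode c then mconst (\<phi> i b c') else 0)"
        by (intro sum.cong) (auto simp: \<phi>_def)
      also have "\<dots> = mconst (\<phi> i (set_decode c) c')" using finite_K decode_K[OF cc(1)] by simp
      also have "\<dots> = (if c = c' then 1 else 0)"
        using cc decode by (auto simp: \<phi>_def F)
      finally show "(\<Sum>b\<in>basis ?K i. mconst (\<phi> i b c) * mconst (\<phi> i b c')) = (if c = c' then 1 else 0)" .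
    qed (auto simp: \<phi>_def mpoly_ring_zero mpoly_ring_one)
    show "full_column_rank (basis ?K i) (basis F i) (\<phi> i)"
      unfolding full_column_rank_def
    proof (intro allI impI ballI)
      fix v c assume v: "\<forall>b\<in>basis ?K i. (\<Sum>c\<in>basis F i. \<phi> i b c * v c) = 0" and c: "c \<in> basis F i"
      have "(\<Sum>c'\<in>basis F i. \<phi> i (set_decode c) c' * v c') = (\<Sum>c'\<in>basis F i. if c' = c then v c else 0)"
        by (intro sum.cong refl) (use c decode in \<open>auto simp: \<phi>_def F\<close>)
      then show "v c = 0" using v decode_K[OF c] c by (simp add: F finite_faces)
    qed
    fix b c assume b: "b \<in> basis ?K i" and c: "c \<in> basis F (Suc i)"
    obtain A where A: "c = set_encode A" "A \<in> face (Suc i)" using c by (auto simp: F)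
    have "(\<Sum>c'\<in>basis F i. mconst (\<phi> i b c') * diff F i c' c) =
        (\<Sum>B\<in>face i. mconst (if b = B then 1 else 0) * koszul_entry B A)"
      using sumF[of "\<lambda>B. mconst (if b = B then 1 else 0) * koszul_entry B A" i]
      unfolding F(2) A(1) decode[OF A(2)] \<phi>_def .
    also have "\<dots> = (\<Sum>B\<in>face i. if B = b then koszul_entry b A else 0)"
      by (intro sum.cong) auto
    also have "\<dots> = koszul_entry b A"
    proof (cases "b \<in> face i")
      case False
      then have "b \<noteq> A - {s}" if "s \<in> A" for s
        using that A(2) closed[of A s] b by (auto simp: face_def basis_koszul)
      then have "koszul_entry b A = (0 :: 'k mpoly)" by (simp add: koszul_entry_def)
      then show ?thesis by (simp cong: if_cong)
    qed (simp add: finite_faces)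
    also have "\<dots> = (\<Sum>b'\<in>basis ?K (Suc i). if b' = A then koszul_entry b A else 0)"
      using finite_K face_K A(2) by (simp add: subset_eq)
    also have "\<dots> = (\<Sum>b'\<in>basis ?K (Suc i). diff ?K i b b' * mconst (\<phi> (Suc i) b' c))"
      by (intro sum.cong) (auto simp: \<phi>_def diff_koszul A(1) decode[OF A(2)])
    finally show "(\<Sum>c'\<in>basis F i. mconst (\<phi> i b c') * diff F i c' c) =
        (\<Sum>b'\<in>basis ?K (Suc i). diff ?K i b b' * mconst (\<phi> (Suc i) b' c))" .
  qed
  moreover have "rank_seq F = (\<lambda>k. card {A \<in> \<Delta>. card A = k})"
    using card_image[OF inj] by (simp add: rank_seq_def F face_def)
  ultimately show ?thesis unfolding RS_def mem_Collect_eq by (intro exI[of _ F]) simp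
qed

section \<open>Counting\<close>

lemma card_en_labels: "card (en_labels p q k) = ((p + k - 1) choose k) * (q choose (p + k))"
proof -
  have "en_labels p q k = multisets_of_size {..<p} k \<times> {T. T \<subseteq> {..<q} \<and> card T = p + k}"
    by (auto simp: en_labels_def multisets_of_size_def)
  then show ?thesis
    by (simp add: card_cartesian_product card_multisets_of_size n_subsets)
qed

text \<open>Sort the \<open>(p + k)\<close>-subsets by their smallest element, above which there are \<open>p - 1 + l\<close> others: picking \<open>p - 1\<close> of
  these and then \<open>k\<close> of the remaining \<open>l\<close> is the same as picking \<open>p + k - 1\<close> and marking \<open>k\<close> of them.\<close>

lemma binomial_stratification:
  assumes p: "1 \<le> p"
  shows "((p + k - 1) choose k) * ((p + m) choose (p + k)) = (\<Sum>l\<le>m. ((p - 1 + l) choose (p - 1)) * (l choose k))"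
proof -
  have *: "((p - 1 + l) choose (p - 1)) * (l choose k) = ((p + k - 1) choose k) * ((p - 1 + l) choose (p + k - 1))" for l
  proof (cases "k \<le> l")
    case True
    have "(p - 1 + l choose (p - 1 + k)) * (p - 1 + k choose (p - 1)) =
        (p - 1 + l choose (p - 1)) * ((p - 1 + l - (p - 1)) choose (p - 1 + k - (p - 1)))"
      by (rule choose_mult) (use True in auto)
    moreover have "(p - 1 + k choose (p - 1)) = (p - 1 + k choose k)"
      using binomial_symmetric[of k "p - 1 + k"] by simp
    moreover have "p - 1 + k = p + k - 1" using p by simp
    ultimately show ?thesis by (simp add: mult.commute)
  next
    case False
    then show ?thesis using p by (simp add: binomial_eq_0)
  qed
  have "(\<Sum>l\<le>m. (p - 1 + l) choose (p + k - 1)) = (p + m) choose (p + k)"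
  proof (induction m)
    case 0
    show ?case
    proof (cases "k = 0")
      case False
      then show ?thesis using p by (simp add: binomial_eq_0)
    qed simp
  next
    case (Suc m)
    have "(p + Suc m) choose (p + k) = ((p + m) choose (p + k - 1)) + ((p + m) choose (p + k))"
      using p binomial_Suc_Suc[of "p + m" "p + k - 1"] by simp
    then show ?case using Suc p by simp
  qed
  then show ?thesis unfolding * by (simp add: sum_distrib_left[symmetric])
qed

text \<open>The system is triangular, because \<open>l choose k\<close> vanishes for \<open>l < k\<close> and equals \<open>1\<close> for \<open>l = k\<close>.\<close>

lemma level_counts_unique:
  fixes a b :: "nat \<Rightarrow> nat"
  assumes eq: "\<And>k. (\<Sum>l\<le>m. a l * (l choose k)) = (\<Sum>l\<le>m. b l * (l choose k))" and l: "l \<le> m"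
  shows "a l = b l"
  using l
proof (induction "m - l" arbitrary: l rule: less_induct)
  case less
  have split: "(\<Sum>j\<le>m. f j * (j choose l)) = f l + (\<Sum>j\<in>{l<..m}. f j * (j choose l))" for f :: "nat \<Rightarrow> nat"
  proof -
    have "(\<Sum>j\<le>m. f j * (j choose l)) = (\<Sum>j\<in>{l..m}. f j * (j choose l))"
      by (rule sum.mono_neutral_right) (auto simp: binomial_eq_0)
    also have "{l..m} = insert l {l<..m}" using less.prems by auto
    finally show ?thesis by simp
  qed
  have "a j = b j" if "j \<in> {l<..m}" for j
    using that by (intro less.hyps) auto
  then have "(\<Sum>j\<in>{l<..m}. a j * (j choose l)) = (\<Sum>j\<in>{l<..m}. b j * (j choose l))"
    by (intro sum.cong) auto
  then show ?case using eq[of l] by (simp add: split)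
qed

lemma sum_in_sum_sets:
  "finite I \<Longrightarrow> (\<And>i. i \<in> I \<Longrightarrow> f i \<in> A i) \<Longrightarrow> sum f I \<in> (\<Sum>i\<in>I. A i :: (nat \<Rightarrow> nat) set)"
  by (induction I rule: finite_induct) (auto intro: set_plus_intro)

lemma sum_in_set_multiple:
  assumes "finite I" "\<And>i. i \<in> I \<Longrightarrow> f i \<in> A"
  shows "sum f I \<in> set_multiple (card I) A"
proof -
  obtain h where h: "bij_betw h {..<card I} I"
    using ex_bij_betw_nat_finite[OF assms(1)] by (auto simp: atLeast0LessThan)
  have "sum f I = (\<Sum>i<card I. f (h i))"
    by (rule sum.reindex_bij_betw[OF h, symmetric])
  also have "\<dots> \<in> set_multiple (card I) A"
    unfolding set_multiple_def using h assms(2) by (intro sum_in_sum_sets) (auto simp: bij_betw_def)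
  finally show ?thesis .
qed

lemma sum_by_level:
  fixes lev :: "'b \<Rightarrow> nat"
  assumes B: "finite B" "\<And>b. b \<in> B \<Longrightarrow> lev b \<le> m" and f: "\<And>b. b \<in> B \<Longrightarrow> f b \<in> R (lev b)"
  shows "sum f B \<in> (\<Sum>j=0..m. set_multiple (card {b \<in> B. lev b = m - j}) (R (m - j)))"
proof -
  have "sum f B = (\<Sum>j=0..m. sum f {b \<in> B. m - lev b = j})"
    by (rule sum.group[symmetric]) (use B in auto)
  also have "\<dots> = (\<Sum>j=0..m. sum f {b \<in> B. lev b = m - j})"
  proof (intro sum.cong refl)
    fix j assume "j \<in> {0..m}"
    then have "m - lev b = j \<longleftrightarrow> lev b = m - j" if "b \<in> B" for b
      using B(2)[OF that] by auto
    then show "{b \<in> B. m - lev b = j} = {b \<in> B. lev b = m - j}" by blast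
  qed
  also have "\<dots> \<in> (\<Sum>j=0..m. set_multiple (card {b \<in> B. lev b = m - j}) (R (m - j)))"
  proof (intro sum_in_sum_sets sum_in_set_multiple)
    show "f b \<in> R (m - j)" if "b \<in> {b \<in> B. lev b = m - j}" for j b
      using f[of b] that by simp
  qed (use B(1) in auto)
  finally show ?thesis .
qed

section \<open>Subcomplexes of the Eagon--Northcott complex\<close>

lemma ring_mpoly_ring: "ring (mpoly_ring n :: 'k::field mpoly ring)"
proof (rule ringI)
  let ?R = "mpoly_ring n :: 'k mpoly ring"
  have ops: "x \<otimes>\<^bsub>?R\<^esub> y = x * y" "x \<oplus>\<^bsub>?R\<^esub> y = x + y" "\<one>\<^bsub>?R\<^esub> = 1" "\<zero>\<^bsub>?R\<^esub> = 0" for x y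
    by (simp_all add: mpoly_ring_def)
  show "abelian_group ?R"
  proof (rule abelian_groupI)
    fix x assume x: "x \<in> carrier ?R"
    then have "- x \<in> carrier ?R" by (simp add: mem_mpoly_ring)
    then show "\<exists>y\<in>carrier ?R. y \<oplus>\<^bsub>?R\<^esub> x = \<zero>\<^bsub>?R\<^esub>" by (intro bexI[of _ "- x"]) (auto simp: ops)
  qed (auto simp: ops mpoly_ring_add mpoly_ring_zero algebra_simps)
  show "monoid ?R"
    by (rule monoidI) (auto simp: ops mpoly_ring_mult mpoly_ring_one algebra_simps)
qed (auto simp: mpoly_ring_def algebra_simps)

lemma lookup_mult_zero_monom:
  "Poly_Mapping.lookup (f * g :: 'k::field mpoly) 0 = Poly_Mapping.lookup f 0 * Poly_Mapping.lookup g 0"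
proof -
  interpret comm_ring_hom "poly_subst (\<lambda>c::'k. c) (\<lambda>_. 0)"
    by (rule comm_ring_hom_poly_subst[OF id_comm_ring_hom])
  have "poly_subst (\<lambda>c::'k. c) (\<lambda>_. 0) f = Poly_Mapping.lookup f 0" for f
  proof -
    have *: "monom_eval (\<lambda>_. 0 :: 'k) m = (if m = 0 then 1 else 0)" for m
    proof (cases "m = 0")
      case False
      then obtain i where "i \<in> Poly_Mapping.keys m" by fastforce
      then show ?thesis using False by (auto simp: monom_eval_def in_keys_iff intro!: prod_zero)
    qed simp
    have "poly_subst (\<lambda>c::'k. c) (\<lambda>_. 0) f =
        (\<Sum>m\<in>Poly_Mapping.keys f. if m = 0 then Poly_Mapping.lookup f 0 else 0)"
      unfolding poly_subst_def * by (intro sum.cong) auto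
    then show ?thesis by (simp add: in_keys_iff)
  qed
  then show ?thesis using hom_mult[of f g] by simp
qed

text \<open>The polynomials without constant term form an ideal that contains the variables.\<close>

lemma irrelevant_ideal_no_constant:
  assumes "f \<in> irrelevant_ideal n"
  shows "Poly_Mapping.lookup f 0 = 0"
proof -
  let ?R = "mpoly_ring n :: 'a mpoly ring"
  let ?J = "{f \<in> carrier ?R. Poly_Mapping.lookup f 0 = 0}"
  interpret ring ?R by (rule ring_mpoly_ring)
  have ops: "x \<otimes>\<^bsub>?R\<^esub> y = x * y" "x \<oplus>\<^bsub>?R\<^esub> y = x + y" "\<zero>\<^bsub>?R\<^esub> = 0" for x y
    by (simp_all add: mpoly_ring_def)
  have inv: "\<ominus>\<^bsub>?R\<^esub> x = - x" if "x \<in> carrier ?R" for x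
  proof -
    have "- x \<in> carrier ?R" using that by (simp add: mem_mpoly_ring)
    then show ?thesis using that by (intro minus_equality) (auto simp: ops)
  qed
  have "ideal ?J ?R"
  proof (rule idealI)
    show "subgroup ?J (add_monoid ?R)"
    proof (rule add.subgroupI)
      show "\<ominus>\<^bsub>?R\<^esub> a \<in> ?J" if "a \<in> ?J" for a
        using that by (simp add: inv mem_mpoly_ring)
    qed (auto simp: ops mpoly_ring_add mpoly_ring_zero lookup_add)
  qed (auto simp: ring_mpoly_ring ops mpoly_ring_mult lookup_mult_zero_monom)
  moreover have "mvar ` {..<n} \<subseteq> ?J"
  proof -
    have "Poly_Mapping.single i (1::nat) \<noteq> 0" for i :: nat
      by (metis keys_single keys_zero insert_not_empty one_neq_zero)
    then show ?thesis by (auto simp: mem_mpoly_ring mvar_def lookup_single when_def)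
  qed
  ultimately have "irrelevant_ideal n \<subseteq> ?J"
    unfolding irrelevant_ideal_def by (rule genideal_minimal)
  then show ?thesis using assms by auto
qed

lemma lookup_insert_sign_mult:
  "Poly_Mapping.lookup (insert_sign T s * (f :: 'k::field mpoly)) \<mu> = insert_sign T s * Poly_Mapping.lookup f \<mu>"
  using lookup_const_mult[of "insert_sign T s :: 'k" f \<mu>]
  by (simp add: hom_insert_sign[OF comm_ring_hom_const_poly])

lemma lookup_en_entry:
  "Poly_Mapping.lookup (en_entry A b c) \<mu> = en_entry (\<lambda>j s. Poly_Mapping.lookup (A j s :: 'k::field mpoly) \<mu>) b c"
  by (cases b; cases c) (auto simp: en_entry_def lookup_sum lookup_insert_sign_mult intro!: sum.cong)

lemma en_entry_corner:
  assumes "finite T" "s \<in> T"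
  shows "en_entry A ({#}, T - {s}) ({#j#}, T) = insert_sign T s * A j s"
proof -
  have "en_entry A ({#}, T - {s}) ({#j#}, T) =
      (\<Sum>t\<in>T. if T - {s} = T - {t} then insert_sign T t * A j t else 0)"
    unfolding en_entry_def prod.case set_mset_add_mset_insert set_mset_empty
    by (intro sum.cong refl) simp
  also have "\<dots> = (\<Sum>t\<in>T. if s = t then insert_sign T t * A j t else 0)"
  proof (rule sum.cong)
    fix t assume "t \<in> T"
    then have "T - {s} = T - {t} \<longleftrightarrow> s = t" using assms(2) by blast
    then show "(if T - {s} = T - {t} then insert_sign T t * A j t else 0)
        = (if s = t then insert_sign T t * A j t else 0)" by simp
  qed (rule refl)
  also have "\<dots> = insert_sign T s * A j s"
    by (simp only: sum.delta'[OF assms(1)] assms(2) if_True)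
  finally show ?thesis .
qed

lemma lookup_mconst_mult:
  "Poly_Mapping.lookup (mconst c * f) \<mu> = c * Poly_Mapping.lookup f \<mu>"
  "Poly_Mapping.lookup (f * mconst c) \<mu> = c * Poly_Mapping.lookup f \<mu>"
  using lookup_const_mult[of c f \<mu>] by (simp_all add: mconst_def const_poly_def mult.commute[of f])

definition entry_monoms :: "nat \<Rightarrow> nat \<Rightarrow> 'k::field mpoly mat \<Rightarrow> (nat \<Rightarrow>\<^sub>0 nat) set" where
  "entry_monoms p q \<phi> = (\<Union>j<p. \<Union>s<q. Poly_Mapping.keys (\<phi> $$ (j, s)))"

definition entry_coeff :: "'k::field mpoly mat \<Rightarrow> (nat \<Rightarrow>\<^sub>0 nat) \<Rightarrow> nat \<Rightarrow> nat \<Rightarrow> 'k" where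
  "entry_coeff \<phi> \<mu> j s = Poly_Mapping.lookup (\<phi> $$ (j, s)) \<mu>"

context
  fixes n p q :: nat and \<phi> :: "'k::field mpoly mat"
  assumes pq: "p \<le> q" and \<phi>: "\<phi> \<in> carrier_mat p q" and entries: "elements_mat \<phi> \<subseteq> carrier (mpoly_ring n)"
    and res: "minimal_graded_resolution n (minors_ideal n \<phi>) (eagon_northcott \<phi>)"
begin

lemma entry_carrier: "j < p \<Longrightarrow> s < q \<Longrightarrow> \<phi> $$ (j, s) \<in> carrier (mpoly_ring n)"
proof -
  assume "j < p" "s < q"
  then have "\<phi> $$ (j, s) \<in> elements_mat \<phi>" 
    by (intro elements_matI[OF \<phi>]) auto
  then show ?thesis using entries by blast
qed

text \<open>For \<open>p < q\<close> every entry of the matrix occurs, up to sign, in the differential from degree \<open>2\<close> to degree \<open>1\<close>, which is minimal.\<close>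

lemma entry_no_constant:
  assumes "p < q" "j < p" "s < q"
  shows "Poly_Mapping.lookup (\<phi> $$ (j, s)) 0 = 0"
proof -
  obtain T0 where T0: "T0 \<subseteq> {..<q} - {s}" "card T0 = p" "finite T0"
  proof -
    have "p \<le> card ({..<q} - {s})" using assms(1,3) by simp
    from obtain_subset_with_card_n[OF this] show thesis using that by metis
  qed
  then have T0q: "T0 \<subseteq> {..<q}" by blast
  define T where "T = insert s T0"
  have T: "s \<in> T" "T \<subseteq> {..<q}" "card T = Suc p" "finite T" "T - {s} = T0" "s \<notin> T0"
  proof -
    have "s \<notin> T0" using T0(1) by blast
    then show "card T = Suc p" "T - {s} = T0" "s \<notin> T0" using T0(2,3) by (simp_all add: T_def)
    show "s \<in> T" "finite T" using T0(3) by (simp_all add: T_def)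
    show "T \<subseteq> {..<q}" unfolding T_def using T0q assms(3) by simp
  qed
  have "({#}, T0) \<in> en_labels p q 0"
    using T0q T0(2) by (simp add: en_labels_def)
  then have "({#}, T - {s}) \<in> basis (eagon_northcott \<phi>) (Suc 0)"
    by (simp only: basis_eagon_northcott[OF \<phi>] T(5))
  moreover have "({#j#}, T) \<in> en_labels p q (Suc 0)"
    using T(2,3) assms(2) by (simp add: en_labels_def)
  then have "({#j#}, T) \<in> basis (eagon_northcott \<phi>) (Suc (Suc 0))"
    by (simp only: basis_eagon_northcott[OF \<phi>])
  moreover have "minimal_complex n (eagon_northcott \<phi>)"
    using res by (simp add: minimal_graded_resolution_def)
  ultimately have "diff (eagon_northcott \<phi>) (Suc 0) ({#}, T - {s}) ({#j#}, T) \<in> irrelevant_ideal n"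
    unfolding minimal_complex_def by blast
  then have "insert_sign T s * \<phi> $$ (j, s) \<in> irrelevant_ideal n"
    unfolding diff_eagon_northcott en_entry_corner[OF T(4,1)] .
  then have "insert_sign T s * Poly_Mapping.lookup (\<phi> $$ (j, s)) 0 = 0"
    using irrelevant_ideal_no_constant lookup_insert_sign_mult by metis
  then show ?thesis by (simp add: insert_sign_def)
qed

lemma contract_exact_entries: "contract_exact p q (\<lambda>j s. \<phi> $$ (j, s))"
proof (rule contract_exact_extend_vars[OF entry_carrier])
  let ?G = "eagon_northcott \<phi>"
  fix k and v :: "nat multiset \<times> nat set \<Rightarrow> 'k mpoly"
  assume k: "k \<ge> 1" and v: "v \<in> en_space p q k" "\<And>b. v b \<in> carrier (mpoly_ring n)"
    and cycle: "contract p q (\<lambda>j s. \<phi> $$ (j, s)) v = (\<lambda>b. 0)"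
  obtain k' where k': "k = Suc k'" using k by (cases k) auto
  have "cyclic_resolution n (minors_ideal n \<phi>) ?G"
    using res by (simp add: minimal_graded_resolution_def)
  note exact = this[unfolded cyclic_resolution_def, THEN conjunct2, THEN conjunct2, THEN spec, THEN spec, THEN mp]
  have "\<exists>w. (\<forall>c \<in> basis ?G (Suc (Suc k)). w c \<in> carrier (mpoly_ring n)) \<and>
      (\<forall>b \<in> basis ?G (Suc k). v b = (\<Sum>c \<in> basis ?G (Suc (Suc k)). diff ?G (Suc k) b c * w c))"
  proof (rule exact[of k v], rule conjI)
    show "\<forall>a\<in>basis ?G k. (\<Sum>b\<in>basis ?G (Suc k). diff ?G k a b * v b) = 0"
      unfolding k' basis_eagon_northcott[OF \<phi>] diff_eagon_northcott
      using cycle by (simp add: sum_en_entry)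
  qed (use v(2) in blast)
  then obtain w where w: "\<And>b. b \<in> en_labels p q k \<Longrightarrow>
      v b = (\<Sum>c\<in>en_labels p q (Suc k). en_entry (\<lambda>j s. \<phi> $$ (j, s)) b c * w c)"
    unfolding basis_eagon_northcott[OF \<phi>] diff_eagon_northcott by blast
  define w' where "w' c = (if c \<in> en_labels p q (Suc k) then w c else 0)" for c
  have w': "w' \<in> en_space p q (Suc k)" by (simp add: en_space_def w'_def)
  have "v b = contract p q (\<lambda>j s. \<phi> $$ (j, s)) w' b" for b
  proof (cases "b \<in> en_labels p q k")
    case True
    then show ?thesis
      unfolding sum_en_entry[OF True, symmetric] w[OF True] by (intro sum.cong) (auto simp: w'_def)
  next
    case False
    then have "v b = 0" "contract p q (\<lambda>j s. \<phi> $$ (j, s)) w' b = 0"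
      using v(1) contract_en_space[OF w'] unfolding en_space_def by blast+
    then show ?thesis by simp
  qed
  then show "\<exists>w\<in>en_space p q (Suc k). v = contract p q (\<lambda>j s. \<phi> $$ (j, s)) w"
    using w' by blast
qed

text \<open>For \<open>p = q\<close> the entries may have constant terms, but then there is nothing in degree \<open>k \<ge> 1\<close>.\<close>

lemma contract_exact_generic_entries:
  assumes inj: "inj_on f (entry_monoms p q \<phi>)"
  shows "contract_exact p q (generic_matrix (entry_monoms p q \<phi>) (entry_coeff \<phi>) f)"
proof (cases "p = q")
  case True
  have "(\<lambda>b. 0) \<in> en_space p q (Suc k)" for k :: nat by (simp add: en_space_def)
  moreover have "v = (\<lambda>b. 0)" if "v \<in> en_space p q k" "k \<ge> 1" for v :: "_ \<Rightarrow> 'k mpoly" and k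
    using that en_labels_top[of q p k] True by (auto simp: en_space_def)
  ultimately show ?thesis unfolding contract_exact_def by (metis contract_zero)
next
  case False
  interpret polynomial_matrix p q n "entry_monoms p q \<phi>" "entry_coeff \<phi>"
  proof
    show "finite (entry_monoms p q \<phi>)" by (simp add: entry_monoms_def)
    show "Poly_Mapping.keys \<mu> \<subseteq> {..<n}" if "\<mu> \<in> (entry_monoms p q \<phi>)" for \<mu>
      using that entry_carrier by (auto simp: entry_monoms_def mem_mpoly_ring)
    show "0 \<notin> (entry_monoms p q \<phi>)"
      using entry_no_constant False pq by (auto simp: entry_monoms_def in_keys_iff)
  qed
  have "special j s = \<phi> $$ (j, s)" if "j < p" "s < q" for j s
  proof -
    have "special j s = (\<Sum>\<mu>\<in>(entry_monoms p q \<phi>). Poly_Mapping.single \<mu> (Poly_Mapping.lookup (\<phi> $$ (j, s)) \<mu>))"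
      unfolding special_def entry_coeff_def
      by (intro sum.cong refl) (simp only: mult.commute[of "Poly_Mapping.single _ _"] const_poly_mult_single mult_1_right)
    also have "\<dots> = (\<Sum>\<mu>\<in>Poly_Mapping.keys (\<phi> $$ (j, s)). Poly_Mapping.single \<mu> (Poly_Mapping.lookup (\<phi> $$ (j, s)) \<mu>))"
      using that finite_supp by (intro sum.mono_neutral_right) (auto simp: entry_monoms_def in_keys_iff)
    finally show ?thesis unfolding poly_mapping_sum_singles[symmetric] .
  qed
  then have "contract p q special v = contract p q (\<lambda>j s. \<phi> $$ (j, s)) v" for v
    by (rule contract_cong)
  then have "contract_exact p q special"
    using contract_exact_entries unfolding contract_exact_def by simp
  then show ?thesis by (rule contract_exact_generic[OF _ inj])
qed

end

lemma span_image_finite_sum: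
  assumes C: "finite C" and v: "v \<in> fs.span (f ` C)"
  shows "\<exists>a. v = (\<lambda>b. \<Sum>c\<in>C. a c * f c b)"
  using v
proof (induction rule: fs.span_induct_alt)
  case base
  show ?case by (rule exI[of _ "\<lambda>_. 0"]) (simp add: zero_fun_def)
next
  case (step x u w)
  then obtain c a where c: "c \<in> C" "u = f c" and a: "w = (\<lambda>b. \<Sum>c\<in>C. a c * f c b)" by auto
  have "(\<lambda>b. x * u b) + w = (\<lambda>b. \<Sum>c'\<in>C. (a(c := a c + x)) c' * f c' b)"
  proof
    fix b
    have "(\<Sum>c'\<in>C. (a(c := a c + x)) c' * f c' b) = (\<Sum>c'\<in>C. a c' * f c' b + (if c' = c then x * f c b else 0))"
      by (intro sum.cong) (auto simp: algebra_simps)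
    then show "((\<lambda>b. x * u b) + w) b = (\<Sum>c'\<in>C. (a(c := a c + x)) c' * f c' b)"
      using C c by (simp add: sum.distrib a)
  qed
  then show ?case by blast
qed

lemma sum_fun_apply: "(\<Sum>i\<in>I. F i) x = (\<Sum>i\<in>I. F i x)"
  by (induction I rule: infinite_finite_induct) simp_all

text \<open>The rows of a left inverse serve as coordinates for which every label is leading.\<close>

lemma dim_span_left_invertible:
  fixes f :: "'c \<Rightarrow> 'b \<Rightarrow> 'f::field"
  assumes C: "finite C" and inv: "\<And>c c'. c \<in> C \<Longrightarrow> c' \<in> C \<Longrightarrow> (\<Sum>b\<in>S. N c b * f c' b) = (if c = c' then 1 else 0)"
  shows "fs.dim (fs.span (f ` C)) = card C"
proof -
  let ?V = "fs.span (f ` C)" and ?\<psi> = "\<lambda>c v. \<Sum>b\<in>S. N c b * v b"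
  obtain key :: "'c \<Rightarrow> nat" where key: "inj_on key C"
    using finite_imp_inj_to_nat_seg[OF C] by blast
  have "fs.dim ?V = card (leading C key ?\<psi> ?V)"
  proof (rule fs.dim_eq_card_leading[where \<psi> = ?\<psi> and key = key, OF C key fs.subspace_span])
    show "?\<psi> c (v + w) = ?\<psi> c v + ?\<psi> c w" for c v w
      by (simp add: distrib_left sum.distrib)
    show "?\<psi> c (\<lambda>b. x * v b) = x * ?\<psi> c v" for c x v
      by (simp add: sum_distrib_left mult_ac)
    show "v = 0" if v: "v \<in> ?V" "\<And>c. c \<in> C \<Longrightarrow> ?\<psi> c v = 0" for v
    proof -
      obtain a where a: "v = (\<lambda>b. \<Sum>c\<in>C. a c * f c b)"
        using span_image_finite_sum[OF C v(1)] by blast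
      have "a c = 0" if c: "c \<in> C" for c
      proof -
        have "?\<psi> c v = (\<Sum>b\<in>S. \<Sum>c'\<in>C. a c' * (N c b * f c' b))"
          unfolding a by (simp add: sum_distrib_left mult_ac)
        also have "\<dots> = (\<Sum>c'\<in>C. a c' * (\<Sum>b\<in>S. N c b * f c' b))"
          unfolding sum_distrib_left by (rule sum.swap)
        also have "\<dots> = (\<Sum>c'\<in>C. if c' = c then a c else 0)"
          by (intro sum.cong) (auto simp: inv c)
        finally show ?thesis using v(2)[OF c] C c by simp
      qed
      then show ?thesis unfolding a by (intro ext) (simp add: sum.neutral)
    qed
  qed
  moreover have "leading C key ?\<psi> ?V = C"
  proof
    show "C \<subseteq> leading C key ?\<psi> ?V"
      unfolding leading_def
    proof (intro subsetI CollectI conjI)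
      fix c assume c: "c \<in> C"
      have "f c \<in> ?V" using c by (intro fs.span_base) simp
      moreover have "?\<psi> c (f c) \<noteq> 0" using inv[OF c c] by simp
      moreover have "\<forall>c'\<in>C. key c' < key c \<longrightarrow> ?\<psi> c' (f c) = 0" using inv c by auto
      ultimately show "\<exists>v\<in>?V. ?\<psi> c v \<noteq> 0 \<and> (\<forall>c'\<in>C. key c' < key c \<longrightarrow> ?\<psi> c' v = 0)" by blast
    qed
  qed (auto simp: leading_def)
  ultimately show ?thesis by simp
qed

theorem theorem2:
  fixes n p q :: nat
    and \<phi> :: "'k::field mpoly mat"
    and r :: "nat \<Rightarrow> nat"
  assumes "1 \<le> p" and "p \<le> q"
    and "\<phi> \<in> carrier_mat p q" and "elements_mat \<phi> \<subseteq> carrier (mpoly_ring n)"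
    and "codimension (mpoly_ring n) (minors_ideal n \<phi>) = enat (q - p + 1)"
    and "cohen_macaulay (mpoly_ring n Quot minors_ideal n \<phi>)"
    and "minimal_graded_resolution n (minors_ideal n \<phi>) (eagon_northcott \<phi>)"
    and "r \<in> RS n (eagon_northcott \<phi>)"
  shows "\<exists>s \<in> (\<Sum>j = 0..q - p. set_multiple ((q - j - 1) choose (p - 1))
                 (RS (q - p - j) (koszul (q - p - j) :: (nat set, 'k mpoly) cplx))).
           r = case_nat 0 s \<or> r = case_nat 1 s"
proof -
  let ?G = "eagon_northcott \<phi>" and ?m = "q - p"
  note \<phi> = assms(3) and pq = assms(2)
  note hyps = pq \<phi> assms(4,7)
  let ?supp = "entry_monoms p q \<phi>" and ?coeff = "entry_coeff \<phi>"
  have finite_supp: "finite ?supp" by (simp add: entry_monoms_def)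
  obtain idx :: "(nat \<Rightarrow>\<^sub>0 nat) \<Rightarrow> nat" where idx: "inj_on idx ?supp"
    using finite_imp_inj_to_nat_seg[OF finite_supp] by blast
  define y where "y i \<mu> = prod_encode (i, idx \<mu>)" for i and \<mu> :: "nat \<Rightarrow>\<^sub>0 nat"
  interpret GP: generic_points p q ?supp ?coeff y
  proof
    show "y i \<mu> \<noteq> y i' \<mu>'" if "i \<noteq> i'" for i i' \<mu> \<mu>' using that by (simp add: y_def)
    show "contract_exact p q (generic_matrix ?supp ?coeff (y i))" for i
      by (rule contract_exact_generic_entries[OF hyps]) (use idx in \<open>auto simp: y_def inj_on_def\<close>)
  qed
  interpret RO: regular_operators fun_scale "en_space p q" GP.D ?m
    by (rule GP.regular_operators_D[OF pq])
  obtain F :: "(nat, 'k mpoly) cplx" where F: "r = rank_seq F" "subcomplex n F ?G"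
    using assms(8) by (auto simp: RS_def)
  then obtain \<Phi> where
    split: "\<And>i. split_injective n (basis ?G i) (basis F i) (\<lambda>b c. mconst (\<Phi> i b c))" and
    rank: "\<And>i. full_column_rank (basis ?G i) (basis F i) (\<Phi> i)" and
    comm: "\<And>i b c. b \<in> basis ?G i \<Longrightarrow> c \<in> basis F (Suc i) \<Longrightarrow>
           (\<Sum>c' \<in> basis F i. mconst (\<Phi> i b c') * diff F i c' c) =
           (\<Sum>b' \<in> basis ?G (Suc i). diff ?G i b b' * mconst (\<Phi> (Suc i) b' c))"
    unfolding subcomplex_def by blast
  have fin: "finite (basis F i)" for i
    using F(2) by (simp add: subcomplex_def free_complex_def)
  define col :: "nat \<Rightarrow> nat \<Rightarrow> nat multiset \<times> nat set \<Rightarrow> 'k" where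
    "col k c b = (if b \<in> en_labels p q k then \<Phi> (Suc k) b c else 0)" for k c b
  define colK where "colK k c b = to_fract (const_poly (col k c b))" for k c b
  define V where "V k = fs.span (colK k ` basis F (Suc k))" for k
  interpret T: comm_ring_hom "\<lambda>x::'k. to_fract (const_poly x)"
    by (rule comm_ring_hom_comp[OF comm_ring_hom_to_fract comm_ring_hom_const_poly])
  interpret TF: comm_ring_hom "to_fract :: 'k mpoly \<Rightarrow> _" by (rule comm_ring_hom_to_fract)
  have col_space: "colK k c \<in> en_space p q k" for k c
    by (simp add: en_space_def colK_def col_def)
  have V_sub: "V k \<subseteq> en_space p q k" for k
    unfolding V_def using col_space by (intro fs.span_minimal subspace_en_space) auto
  have V_dim: "fs.dim (V k) = card (basis F (Suc k))" for k
  proof -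
    obtain N where N: "\<And>c c'. c \<in> basis F (Suc k) \<Longrightarrow> c' \<in> basis F (Suc k) \<Longrightarrow>
        (\<Sum>b\<in>en_labels p q k. N c b * mconst (\<Phi> (Suc k) b c')) = (if c = c' then 1 else 0)"
      using split[of "Suc k"] unfolding split_injective_def basis_eagon_northcott[OF \<phi>] by blast
    show ?thesis
      unfolding V_def
    proof (rule dim_span_left_invertible[OF fin, where N = "\<lambda>c b. to_fract (N c b)" and S = "en_labels p q k"])
      fix c c' assume c: "c \<in> basis F (Suc k)" "c' \<in> basis F (Suc k)"
      have "(\<Sum>b\<in>en_labels p q k. to_fract (N c b) * colK k c' b) =
          to_fract (\<Sum>b\<in>en_labels p q k. N c b * mconst (\<Phi> (Suc k) b c'))"
        by (simp add: TF.hom_sum TF.hom_mult colK_def col_def const_poly_def mconst_def)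
      then show "(\<Sum>b\<in>en_labels p q k. to_fract (N c b) * colK k c' b) = (if c = c' then 1 else 0)"
        by (simp add: N[OF c])
    qed
  qed
  have V_closed: "GP.D i v \<in> V k" if v: "v \<in> V (Suc k)" for i k v
  proof -
    define M where "M \<mu> c' c = Poly_Mapping.lookup (diff F (Suc k) c' c) \<mu>" for \<mu> c' c
    \<comment> \<open>The coefficient of \<open>x\<^sup>\<mu>\<close> in the condition that the inclusion maps commute with the differentials.\<close>
    have coeff_rel: "contract p q (?coeff \<mu>) (col (Suc k) c) b = (\<Sum>c'\<in>basis F (Suc k). M \<mu> c' c * col k c' b)"
      if c: "c \<in> basis F (Suc (Suc k))" for \<mu> c b
    proof (cases "b \<in> en_labels p q k")
      case True
      have "(\<Sum>c'\<in>basis F (Suc k). M \<mu> c' c * col k c' b) = (\<Sum>c'\<in>basis F (Suc k). Poly_Mapping.lookup (mconst (\<Phi> (Suc k) b c') * diff F (Suc k) c' c) \<mu>)"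
        using True by (intro sum.cong) (simp_all add: lookup_mconst_mult M_def col_def)
      also have "\<dots> = (\<Sum>b'\<in>en_labels p q (Suc k). Poly_Mapping.lookup (mconst (\<Phi> (Suc (Suc k)) b' c) * en_entry (\<lambda>j s. \<phi> $$ (j, s)) b b') \<mu>)"
        using comm[of b "Suc k" c] c True
        unfolding basis_eagon_northcott[OF \<phi>] diff_eagon_northcott lookup_sum[symmetric]
        by (simp only: mult.commute[of "mconst (\<Phi> (Suc (Suc k)) _ c)"])
      also have "\<dots> = (\<Sum>b'\<in>en_labels p q (Suc k). en_entry (?coeff \<mu>) b b' * col (Suc k) c b')"
        by (intro sum.cong) (simp_all add: lookup_mconst_mult lookup_en_entry entry_coeff_def[abs_def] col_def)
      also have "\<dots> = contract p q (?coeff \<mu>) (col (Suc k) c) b"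
        by (rule sum_en_entry[OF True])
      finally show ?thesis by simp
    next
      case False
      have "col (Suc k) c \<in> en_space p q (Suc k)" by (simp add: en_space_def col_def)
      from contract_en_space[OF this] have "contract p q (?coeff \<mu>) (col (Suc k) c) b = 0"
        using False unfolding en_space_def by blast
      then show ?thesis using False by (simp add: col_def)
    qed
    have gen: "GP.D i (colK (Suc k) c) \<in> V k" if c: "c \<in> basis F (Suc (Suc k))" for c
    proof -
      define Z where "Z c' = (\<Sum>\<mu>\<in>?supp. to_fract (var_poly (y i \<mu>)) * to_fract (const_poly (M \<mu> c' c)))" for c'
      have "GP.D i (colK (Suc k) c) b = (\<Sum>c'\<in>basis F (Suc k). Z c' * colK k c' b)" for b
      proof -
        have "GP.D i (colK (Suc k) c) b =
            (\<Sum>\<mu>\<in>?supp. to_fract (var_poly (y i \<mu>)) *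
              contract p q (\<lambda>j s. to_fract (const_poly (?coeff \<mu> j s))) (colK (Suc k) c) b)"
          unfolding GP.D_def generic_matrix_def TF.hom_sum TF.hom_mult contract_matrix_sum ..
        also have "\<dots> = (\<Sum>\<mu>\<in>?supp. to_fract (var_poly (y i \<mu>)) *
            to_fract (const_poly (contract p q (?coeff \<mu>) (col (Suc k) c) b)))"
          unfolding contract_hom[OF T.comm_ring_hom_axioms] colK_def ..
        also have "\<dots> = (\<Sum>\<mu>\<in>?supp. \<Sum>c'\<in>basis F (Suc k).
            to_fract (var_poly (y i \<mu>)) * to_fract (const_poly (M \<mu> c' c)) * colK k c' b)"
          unfolding coeff_rel[OF c] T.hom_sum T.hom_mult sum_distrib_left colK_def mult.assoc ..
        also have "\<dots> = (\<Sum>c'\<in>basis F (Suc k). Z c' * colK k c' b)"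
          unfolding Z_def sum_distrib_right by (rule sum.swap)
        finally show ?thesis .
      qed
      then have "GP.D i (colK (Suc k) c) = (\<Sum>c'\<in>basis F (Suc k). fun_scale (Z c') (colK k c'))"
        by (intro ext) (simp add: sum_fun_apply)
      also have "\<dots> \<in> V k"
        unfolding V_def by (intro fs.span_sum fs.span_scale fs.span_base imageI)
      finally show ?thesis .
    qed
    have "fs.subspace {v. GP.D i v \<in> V k}"
      unfolding V_def
      by (intro fs.subspaceI) (auto simp: RO.d.add RO.d.scale RO.d.zero intro: fs.span_add fs.span_scale fs.span_zero)
    then have "V (Suc k) \<subseteq> {v. GP.D i v \<in> V k}"
      unfolding V_def[of "Suc k"] using gen by (intro fs.span_minimal) auto
    then show ?thesis using v by blast
  qed
  have V_subspace: "fs.subspace (V k)" for k unfolding V_def by (rule fs.subspace_span)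
  show ?thesis
  proof (rule RO.graded_submodule_dimensions, goal_cases)
    case (1 B lev)
    note B = 1(1,2) and dimE = 1(3) and dimV = 1(4)
    from dimV[of V, OF V_subspace V_sub V_closed] obtain \<Delta> where
      \<Delta>: "\<forall>b\<in>B. \<forall>A\<in>\<Delta> b. A \<subseteq> {..<lev b} \<and> (\<forall>a\<in>A. A - {a} \<in> \<Delta> b)"
      and dim\<Delta>: "\<And>k. fs.dim (V k) = (\<Sum>b\<in>B. card {A \<in> \<Delta> b. card A = k})" by blast
    define f where "f b k = card {A \<in> \<Delta> b. card A = k}" for b k
    \<comment> \<open>The case \<open>V = E\<close> determines how many basis vectors there are of each level.\<close>
    have count: "card {b \<in> B. lev b = l} = (p - 1 + l) choose (p - 1)" if "l \<le> ?m" for l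
    proof (rule level_counts_unique[OF _ that])
      fix k
      have "(\<Sum>l\<le>?m. card {b \<in> B. lev b = l} * (l choose k)) = (\<Sum>l\<le>?m. \<Sum>b\<in>{b \<in> B. lev b = l}. lev b choose k)"
        by (intro sum.cong) auto
      also have "\<dots> = (\<Sum>b\<in>B. lev b choose k)"
        by (rule sum.group) (use B in auto)
      also have "\<dots> = card (en_labels p q k)"
      proof -
        obtain C where "fs.independent C" "fs.span C = (en_space p q k :: (_ \<Rightarrow> 'k mpoly fract) set)"
          "card C = card (en_labels p q k)" using en_space_basis by blast
        then show ?thesis using fs.dim_span_eq_card_independent[of C] dimE[of k] by simp
      qed
      also have "\<dots> = (\<Sum>l\<le>?m. ((p - 1 + l) choose (p - 1)) * (l choose k))"
        unfolding card_en_labels using binomial_stratification[OF assms(1), of k ?m] pq by simp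
      finally show "(\<Sum>l\<le>?m. card {b \<in> B. lev b = l} * (l choose k)) =
          (\<Sum>l\<le>?m. ((p - 1 + l) choose (p - 1)) * (l choose k))" .
    qed
    have "sum f B \<in> (\<Sum>j=0..?m. set_multiple (card {b \<in> B. lev b = ?m - j})
        (RS (?m - j) (koszul (?m - j) :: (nat set, 'k mpoly) cplx)))"
    proof (rule sum_by_level[OF B, where R = "\<lambda>l. RS l (koszul l :: (nat set, 'k mpoly) cplx)"])
      fix b assume b: "b \<in> B"
      show "f b \<in> RS (lev b) (koszul (lev b) :: (nat set, 'k mpoly) cplx)"
        unfolding f_def[abs_def] by (rule face_numbers_in_RS_koszul) (use \<Delta> b in auto)
    qed
    also have "\<dots> = (\<Sum>j=0..?m. set_multiple ((q - j - 1) choose (p - 1))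
        (RS (?m - j) (koszul (?m - j) :: (nat set, 'k mpoly) cplx)))"
    proof (intro sum.cong refl arg_cong2[where f = set_multiple])
      fix j assume "j \<in> {0..?m}"
      then have "p - 1 + (?m - j) = q - j - 1" using assms(1) pq by auto
      then show "card {b \<in> B. lev b = ?m - j} = (q - j - 1) choose (p - 1)"
        using count[of "?m - j"] by simp
    qed
    finally have mem: "sum f B \<in> \<dots>" .
    have r_Suc: "r (Suc k) = sum f B k" for k
      using V_dim[of k] dim\<Delta>[of k] by (simp add: F(1) rank_seq_def sum_fun_apply f_def)
    \<comment> \<open>The term in degree \<open>0\<close> has rank one, so two basis elements of the subcomplex would be dependent there.\<close>
    have r_0: "r 0 \<le> 1"
    proof (rule ccontr)
      assume "\<not> r 0 \<le> 1"
      then have "\<not> card (basis F 0) \<le> Suc 0" by (simp add: F(1) rank_seq_def)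
      then obtain c c' where c: "c \<in> basis F 0" "c' \<in> basis F 0" "c \<noteq> c'"
        unfolding card_le_Suc0_iff_eq[OF fin] by blast
      have G0: "basis ?G 0 = {({#}, {})}" by (simp add: eagon_northcott_def)
      let ?b = "({#}, {}) :: nat multiset \<times> nat set"
      have rank0: "(\<Sum>x\<in>basis F 0. \<Phi> 0 ?b x * v x) = 0 \<Longrightarrow> \<forall>x\<in>basis F 0. v x = 0" for v
        using rank[of 0] unfolding full_column_rank_def G0 by blast
      have pick: "(\<Sum>x\<in>basis F 0. \<Phi> 0 ?b x * (if x = c then s else if x = c' then t else 0)) =
          \<Phi> 0 ?b c * s + \<Phi> 0 ?b c' * t" for s t
      proof -
        have "(\<Sum>x\<in>basis F 0. \<Phi> 0 ?b x * (if x = c then s else if x = c' then t else 0)) =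
            (\<Sum>x\<in>basis F 0. (if x = c then \<Phi> 0 ?b c * s else 0) + (if x = c' then \<Phi> 0 ?b c' * t else 0))"
          using c(3) by (intro sum.cong) auto
        then show ?thesis using c fin by (simp add: sum.distrib)
      qed
      have "\<Phi> 0 ?b c' = 0"
        using rank0[of "\<lambda>x. if x = c then \<Phi> 0 ?b c' else if x = c' then - \<Phi> 0 ?b c else 0"] c
        unfolding pick by (auto simp: mult.commute)
      then show False
        using rank0[of "\<lambda>x. if x = c then 0 else if x = c' then 1 else 0"] c
        unfolding pick by auto
    qed
    have "r = case_nat (r 0) (sum f B)"
      using r_Suc by (auto simp: fun_eq_iff split: nat.split)
    moreover have "r 0 = 0 \<or> r 0 = 1" using r_0 by auto
    ultimately have "r = case_nat 0 (sum f B) \<or> r = case_nat 1 (sum f B)" by auto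
    from this mem show ?thesis by (rule bexI)
  qed
qed

end
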